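(* Let $d\ge 1$ and let $f$ be a smooth function on $\mathbf{R}^d$ of exponential growth. Let $g(x,y)=\int_{\mathbf{R}^d} f(t)\exp\left(\sum_{i,j=1}^d x_{ij}t_it_j+\sum_{i=1}^d y_it_i\right)dt$, regarded as a function of $(x,y)$, where $x$ is a real symmetric $d\times d$ matrix with $-x$ positive definite and $y\in\mathbf{R}^d$. If differential operators $P_1,\dots,P_s\in D_t$ annihilate $f$, then the following differential operators in $D_{xy}$ annihilate $g(x,y)$: $$\varphi(P_k)\ (1\le k\le s),\qquad \partial_{x_{ij}}-2\partial_{y_i}\partial_{y_j}\ (1\le i<j\le d),\qquad \partial_{x_{ii}}-\partial_{y_i}^2\ (1\le i\le d).$$ Moreover, these differential operators generate a holonomic (left) ideal in $D_{xy}$ if $P_1,\dots,P_s$ generate a holonomic (left) ideal in $D_t$.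
   Context: $D_t=\mathbf{C}\langle t_i,\partial_{t_i}: 1\le i\le d\rangle$ and $D_{xy}=\mathbf{C}\langle x_{ij},y_k,\partial_{x_{ij}},\partial_{y_k}: 1\le i\le j\le d,\ 1\le k\le d\rangle$ are the Weyl algebras (rings of differential operators with polynomial coefficients), where $\partial_{z}=\partial/\partial z$. The coordinates on symmetric matrices $x$ are $x_{ij}$ with $i\le j$, and we put $x_{ij}=x_{ji}$, $\partial_{x_{ij}}=\partial_{x_{ji}}$. The $\mathbf{C}$-algebra morphism $\varphi:D_t\to D_{xy}$ is defined by $t_i\mapsto \partial_{y_i}$ and $\partial_{t_i}\mapsto -y_i-2\sum_{k=1}^d x_{ik}\partial_{y_k}$ (it is well defined). "Of exponential growth" means $|f(t)|\le C e^{c|t|}$ for some constants $C,c$; the integral converges when $-x$ is positive definite. A left ideal $I$ of a Weyl algebra $D$ is holonomic if $D/I$ is a holonomic left $D$-module. *)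

theory Defs
  imports "HOL-Analysis.Analysis" "HOL-Library.Uprod"
    "HOL-Computational_Algebra.Polynomial"
begin

section \<open>The Weyl algebra in variables indexed by a finite type\<close>

text \<open>
  An element \<open>P\<close> of the Weyl algebra is stored as the finitely supported family of coefficients
  of its normally ordered expansion \<open>P = (\<Sum>(\<alpha>, \<beta>). weyl_coeff P (\<alpha>, \<beta>) x\<^sup>\<alpha> \<partial>\<^sup>\<beta>)\<close>, where
  \<open>\<alpha>\<close> and \<open>\<beta>\<close> are exponent vectors.
\<close>

typedef 'v weyl = "{c :: ('v \<Rightarrow> nat) \<times> ('v \<Rightarrow> nat) \<Rightarrow> complex. finite {m. c m \<noteq> 0}}"
  morphisms weyl_coeff Abs_weyl
  by (rule exI[of _ "\<lambda>_. 0"]) simp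

setup_lifting type_definition_weyl

definition weyl_supp :: "'v weyl \<Rightarrow> (('v \<Rightarrow> nat) \<times> ('v \<Rightarrow> nat)) set" where
  "weyl_supp P = {m. weyl_coeff P m \<noteq> 0}"

lemma finite_weyl_supp [simp]: "finite (weyl_supp P)"
  using weyl_coeff[of P] by (simp add: weyl_supp_def)

lemma weyl_supp_iff: "m \<in> weyl_supp P \<longleftrightarrow> weyl_coeff P m \<noteq> 0"
  by (simp add: weyl_supp_def)

lemma weyl_eqI: "(\<And>m. weyl_coeff P m = weyl_coeff Q m) \<Longrightarrow> P = Q"
  by (simp add: weyl_coeff_inject[symmetric] fun_eq_iff)

instantiation weyl :: (type) ab_group_add
begin

lift_definition zero_weyl :: "'v weyl" is "\<lambda>_. 0"
  by simp

lift_definition plus_weyl :: "'v weyl \<Rightarrow> 'v weyl \<Rightarrow> 'v weyl" is "\<lambda>p q m. p m + q m"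
  subgoal for p q
    by (rule finite_subset[of _ "{m. p m \<noteq> 0} \<union> {m. q m \<noteq> 0}"]) auto
  done

lift_definition minus_weyl :: "'v weyl \<Rightarrow> 'v weyl \<Rightarrow> 'v weyl" is "\<lambda>p q m. p m - q m"
  subgoal for p q
    by (rule finite_subset[of _ "{m. p m \<noteq> 0} \<union> {m. q m \<noteq> 0}"]) auto
  done

lift_definition uminus_weyl :: "'v weyl \<Rightarrow> 'v weyl" is "\<lambda>p m. - p m"
  by simp

instance
  by standard (transfer; simp add: fun_eq_iff algebra_simps)+

end

lift_definition weyl_scale :: "complex \<Rightarrow> 'v weyl \<Rightarrow> 'v weyl" is "\<lambda>c p m. c * p m"
  subgoal for c p
    by (rule finite_subset[of _ "{m. p m \<noteq> 0}"]) auto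
  done

lift_definition weyl_monom :: "('v \<Rightarrow> nat) \<Rightarrow> ('v \<Rightarrow> nat) \<Rightarrow> 'v weyl"
  is "\<lambda>\<alpha> \<beta> m. if m = (\<alpha>, \<beta>) then 1 else 0"
  by simp

lemma weyl_coeff_simps [simp]:
  "weyl_coeff 0 m = 0"
  "weyl_coeff (P + Q) m = weyl_coeff P m + weyl_coeff Q m"
  "weyl_coeff (P - Q) m = weyl_coeff P m - weyl_coeff Q m"
  "weyl_coeff (- P) m = - weyl_coeff P m"
  "weyl_coeff (weyl_scale c P) m = c * weyl_coeff P m"
  "weyl_coeff (weyl_monom \<alpha> \<beta>) m = (if m = (\<alpha>, \<beta>) then 1 else 0)"
  by (transfer; simp)+

lemma weyl_coeff_sum [simp]: "weyl_coeff (sum P A) m = (\<Sum>i\<in>A. weyl_coeff (P i) m)"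
  by (induction A rule: infinite_finite_induct) auto

interpretation weyl_vs: vector_space weyl_scale
  by unfold_locales (auto intro!: weyl_eqI simp: algebra_simps)

text \<open>
  Leibniz rule:
  \<open>x\<^sup>\<alpha> \<partial>\<^sup>\<beta> x\<^sup>\<gamma> \<partial>\<^sup>\<delta> = (\<Sum>\<kappa> \<le> \<beta>, \<gamma>. \<kappa>! (\<beta> choose \<kappa>) (\<gamma> choose \<kappa>) x\<^bsup>\<alpha>+\<gamma>-\<kappa>\<^esup> \<partial>\<^bsup>\<beta>+\<delta>-\<kappa>\<^esup>)\<close>.
  Below it is proved that this product makes the Weyl algebra act on polynomials by
  composition of differential operators (\<open>weyl_pact_times\<close>), and that this action is faithful
  (\<open>weyl_pact_inject\<close>).
\<close>

definition weyl_monom_times ::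
    "('v::finite \<Rightarrow> nat) \<times> ('v \<Rightarrow> nat) \<Rightarrow> ('v \<Rightarrow> nat) \<times> ('v \<Rightarrow> nat) \<Rightarrow> 'v weyl" where
  "weyl_monom_times = (\<lambda>(\<alpha>, \<beta>) (\<gamma>, \<delta>). \<Sum>\<kappa> | \<kappa> \<le> \<beta> \<and> \<kappa> \<le> \<gamma>.
     weyl_scale (\<Prod>v\<in>UNIV. fact (\<kappa> v) * of_nat (\<beta> v choose \<kappa> v) * of_nat (\<gamma> v choose \<kappa> v))
       (weyl_monom (\<lambda>v. \<alpha> v + \<gamma> v - \<kappa> v) (\<lambda>v. \<beta> v + \<delta> v - \<kappa> v)))"

instantiation weyl :: (finite) "{one, times}"
begin

definition one_weyl :: "'a weyl" where
  "1 = weyl_monom (\<lambda>_. 0) (\<lambda>_. 0)"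

definition times_weyl :: "'a weyl \<Rightarrow> 'a weyl \<Rightarrow> 'a weyl" where
  "P * Q = (\<Sum>m\<in>weyl_supp P. \<Sum>n\<in>weyl_supp Q.
     weyl_scale (weyl_coeff P m * weyl_coeff Q n) (weyl_monom_times m n))"

instance ..

end

text \<open>
  The action on polynomials (more generally formal power series), given as coefficient
  families \<open>p\<close>: the coefficient of \<open>x\<^sup>\<gamma>\<close> in \<open>x\<^sup>\<alpha> \<partial>\<^sup>\<beta> p\<close>.
\<close>

definition weyl_pact_monom ::
    "('v::finite \<Rightarrow> nat) \<times> ('v \<Rightarrow> nat) \<Rightarrow> (('v \<Rightarrow> nat) \<Rightarrow> complex) \<Rightarrow> ('v \<Rightarrow> nat) \<Rightarrow> complex" where
  "weyl_pact_monom = (\<lambda>(\<alpha>, \<beta>) p \<gamma>. if \<alpha> \<le> \<gamma>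
     then (\<Prod>v\<in>UNIV. fact (\<gamma> v - \<alpha> v + \<beta> v) / fact (\<gamma> v - \<alpha> v)) * p (\<lambda>v. \<gamma> v - \<alpha> v + \<beta> v)
     else 0)"

definition weyl_pact :: "'v::finite weyl \<Rightarrow> (('v \<Rightarrow> nat) \<Rightarrow> complex) \<Rightarrow> ('v \<Rightarrow> nat) \<Rightarrow> complex" where
  "weyl_pact P p \<gamma> = (\<Sum>m\<in>weyl_supp P. weyl_coeff P m * weyl_pact_monom m p \<gamma>)"

lemma weyl_pact_superset:
  assumes "finite A" "weyl_supp P \<subseteq> A"
  shows "weyl_pact P p \<gamma> = (\<Sum>m\<in>A. weyl_coeff P m * weyl_pact_monom m p \<gamma>)"
  unfolding weyl_pact_def
  by (rule sum.mono_neutral_left) (use assms in \<open>auto simp: weyl_supp_def\<close>)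

lemma weyl_pact_zero [simp]: "weyl_pact 0 p \<gamma> = 0"
  by (simp add: weyl_pact_def)

lemma weyl_pact_add: "weyl_pact (P + Q) p \<gamma> = weyl_pact P p \<gamma> + weyl_pact Q p \<gamma>"
proof -
  let ?A = "weyl_supp P \<union> weyl_supp Q \<union> weyl_supp (P + Q)"
  show ?thesis
    by (subst (1 2 3) weyl_pact_superset[of ?A])
       (auto simp: sum.distrib algebra_simps)
qed

lemma weyl_pact_scale: "weyl_pact (weyl_scale c P) p \<gamma> = c * weyl_pact P p \<gamma>"
proof -
  let ?A = "weyl_supp P \<union> weyl_supp (weyl_scale c P)"
  show ?thesis
    by (subst (1 2) weyl_pact_superset[of ?A])
       (auto simp: sum_distrib_left algebra_simps)
qed

lemma weyl_pact_sum: "weyl_pact (sum P A) p \<gamma> = (\<Sum>i\<in>A. weyl_pact (P i) p \<gamma>)"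
  by (induction A rule: infinite_finite_induct) (auto simp: weyl_pact_add)

lemma weyl_supp_monom [simp]: "weyl_supp (weyl_monom \<alpha> \<beta>) = {(\<alpha>, \<beta>)}"
  by (auto simp: weyl_supp_def)

lemma weyl_pact_weyl_monom [simp]: "weyl_pact (weyl_monom \<alpha> \<beta>) p \<gamma> = weyl_pact_monom (\<alpha>, \<beta>) p \<gamma>"
  by (simp add: weyl_pact_def)

lemma weyl_pact_monom_sum:
  "weyl_pact_monom m (\<lambda>\<gamma>. \<Sum>i\<in>A. c i * p i \<gamma>) \<gamma> = (\<Sum>i\<in>A. c i * weyl_pact_monom m (p i) \<gamma>)"
  by (cases m)
     (auto simp: weyl_pact_monom_def sum_distrib_left sum_distrib_right mult_ac intro!: sum.cong)

lemma weyl_leibniz_coeff: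
  fixes n \<beta> c :: nat
  shows "(\<Sum>k | k \<le> \<beta> \<and> k \<le> c.
      if c - k \<le> n then fact k * of_nat (\<beta> choose k) * of_nat (c choose k) *
        (1 / fact (n - (c - k))) else (0::complex)) =
    (if c \<le> n + \<beta> then fact (n + \<beta>) / fact n / fact (n + \<beta> - c) else 0)"
proof -
  have set_eq: "(\<Sum>k | k \<le> \<beta> \<and> k \<le> c. h k) = (\<Sum>k\<le>c. if k \<le> \<beta> then h k else 0)"
    for h :: "nat \<Rightarrow> complex"
    by (rule sum.mono_neutral_cong_left) auto
  have "(if k \<le> \<beta> then if c - k \<le> n then fact k * of_nat (\<beta> choose k) * of_nat (c choose k) *
        (1 / fact (n - (c - k))) else (0::complex) else 0)
      = fact c / fact n * of_nat ((\<beta> choose k) * (n choose (c - k)))" if "k \<le> c" for k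
  proof -
    have e1: "of_nat (c choose k) = fact c / (fact k * fact (c - k) :: complex)"
      using that by (rule binomial_fact)
    have e2: "of_nat (n choose (c - k)) = fact n / (fact (c - k) * fact (n - (c - k)) :: complex)"
      if "c - k \<le> n"
      using that by (rule binomial_fact)
    show ?thesis
      by (cases "c - k \<le> n") (simp_all add: e1 e2)
  qed
  then have "(\<Sum>k | k \<le> \<beta> \<and> k \<le> c.
      if c - k \<le> n then fact k * of_nat (\<beta> choose k) * of_nat (c choose k) *
        (1 / fact (n - (c - k))) else (0::complex))
    = (\<Sum>k\<le>c. fact c / fact n * of_nat ((\<beta> choose k) * (n choose (c - k))))"
    unfolding set_eq by (intro sum.cong) auto
  also have "\<dots> = fact c / fact n * of_nat ((\<beta> + n) choose c)"
    by (simp only: vandermonde[symmetric] sum_distrib_left of_nat_sum)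
  also have "\<dots> = (if c \<le> n + \<beta> then fact (n + \<beta>) / fact n / fact (n + \<beta> - c) else 0)"
    by (auto simp: binomial_fact add.commute field_simps)
  finally show ?thesis .
qed

lemma weyl_pact_monom_times:
  fixes m n :: "('v::finite \<Rightarrow> nat) \<times> ('v \<Rightarrow> nat)"
  shows "weyl_pact (weyl_monom_times m n) p \<gamma> = weyl_pact_monom m (weyl_pact_monom n p) \<gamma>"
proof -
  obtain a b c d where mn: "m = (a, b)" "n = (c, d)" by (cases m, cases n)
  show ?thesis
  proof (cases "a \<le> \<gamma>")
    case False
    have "\<not> (\<lambda>v. a v + c v - k v) \<le> \<gamma>" if "k \<le> c" for k
    proof
      assume "(\<lambda>v. a v + c v - k v) \<le> \<gamma>"
      then have "a v \<le> \<gamma> v" for v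
        using le_funD[of _ \<gamma> v] le_funD[OF that, of v] by fastforce
      with False show False by (simp add: le_fun_def)
    qed
    with False show ?thesis
      by (simp add: mn weyl_monom_times_def weyl_pact_sum weyl_pact_scale weyl_pact_monom_def)
  next
    case True
    define N where "N v = \<gamma> v - a v" for v
    define w where "w = (\<lambda>v. N v + b v - c v + d v)"
    have av: "a v \<le> \<gamma> v" for v using True by (simp add: le_fun_def)
    define F where "F v k = (if c v - k \<le> N v then
        fact k * of_nat (b v choose k) * of_nat (c v choose k) * (1 / fact (N v - (c v - k)))
        else (0::complex))" for v k
    have term_eq: "(\<Prod>v\<in>UNIV. fact (k v) * of_nat (b v choose k v) * of_nat (c v choose k v)) *
        weyl_pact_monom (\<lambda>v. a v + c v - k v, \<lambda>v. b v + d v - k v) p \<gamma>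
      = (\<Prod>v\<in>UNIV. F v (k v)) * ((\<Prod>v\<in>UNIV. fact (w v)) * p w)"
      if k: "k \<le> b" "k \<le> c" for k
    proof (cases "\<forall>v. c v - k v \<le> N v")
      case ok: True
      have kv: "k v \<le> b v" "k v \<le> c v" for v using k by (auto simp: le_fun_def)
      have le: "(\<lambda>v. a v + c v - k v) \<le> \<gamma>"
        unfolding le_fun_def
      proof
        fix v show "a v + c v - k v \<le> \<gamma> v"
          using spec[OF ok, of v] av[of v] kv[of v] by (simp add: N_def)
      qed
      have e1: "\<gamma> v - (a v + c v - k v) = N v - (c v - k v)" for v
        using kv[of v] by (simp add: N_def)
      have e2: "\<gamma> v - (a v + c v - k v) + (b v + d v - k v) = w v" for v
        using kv[of v] spec[OF ok, of v] by (simp add: w_def e1)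
      show ?thesis
        using le ok
        by (simp add: weyl_pact_monom_def e2)
           (simp add: e1 F_def prod.distrib[symmetric] prod_dividef)
    next
      case False
      then obtain v where v: "\<not> c v - k v \<le> N v" by blast
      have kv: "k v \<le> c v" using k by (auto simp: le_fun_def)
      have "\<not> a v + c v - k v \<le> \<gamma> v"
        using v av[of v] kv by (simp add: N_def)
      then have "\<not> (\<lambda>v. a v + c v - k v) \<le> \<gamma>" by (auto simp: le_fun_def)
      moreover have "(\<Prod>v\<in>UNIV. F v (k v)) = 0"
        by (rule prod_zero) (use v in \<open>auto simp: F_def\<close>)
      ultimately show ?thesis by (simp add: weyl_pact_monom_def)
    qed
    have "weyl_pact (weyl_monom_times m n) p \<gamma>
      = (\<Sum>k | k \<le> b \<and> k \<le> c. (\<Prod>v\<in>UNIV. F v (k v)) * ((\<Prod>v\<in>UNIV. fact (w v)) * p w))"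
      by (simp add: mn weyl_monom_times_def weyl_pact_sum weyl_pact_scale term_eq)
    also have "\<dots> = (\<Sum>k | k \<le> b \<and> k \<le> c. \<Prod>v\<in>UNIV. F v (k v)) * ((\<Prod>v\<in>UNIV. fact (w v)) * p w)"
      by (simp add: sum_distrib_right)
    also have "{k. k \<le> b \<and> k \<le> c} = (\<Pi>\<^sub>E v\<in>UNIV. {k. k \<le> b v \<and> k \<le> c v})"
      by (auto simp: le_fun_def PiE_def Pi_def)
    also have "(\<Sum>k\<in>(\<Pi>\<^sub>E v\<in>UNIV. {k. k \<le> b v \<and> k \<le> c v}). \<Prod>v\<in>UNIV. F v (k v))
      = (\<Prod>v\<in>UNIV. \<Sum>k | k \<le> b v \<and> k \<le> c v. F v k)"
      by (rule prod_sum_PiE[symmetric]) auto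
    also have "\<dots> = (\<Prod>v\<in>UNIV. if c v \<le> N v + b v
        then fact (N v + b v) / fact (N v) / fact (N v + b v - c v) else 0)"
      by (simp add: F_def weyl_leibniz_coeff)
    also have "\<dots> * ((\<Prod>v\<in>UNIV. fact (w v)) * p w) = weyl_pact_monom m (weyl_pact_monom n p) \<gamma>"
    proof (cases "\<forall>v. c v \<le> N v + b v")
      case ok: True
      then show ?thesis
        using True
        by (simp add: mn weyl_pact_monom_def le_fun_def N_def[symmetric])
           (simp add: w_def prod.distrib[symmetric] prod_dividef)
    next
      case False
      then obtain v where "\<not> c v \<le> N v + b v" by blast
      then have "(\<Prod>v\<in>UNIV. if c v \<le> N v + b v
        then fact (N v + b v) / fact (N v) / fact (N v + b v - c v) else (0::complex)) = 0"
        by (intro prod_zero) auto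
      moreover have "weyl_pact_monom m (weyl_pact_monom n p) \<gamma> = 0"
        using False True by (auto simp: mn weyl_pact_monom_def le_fun_def N_def[symmetric])
      ultimately show ?thesis by (simp only: mult_zero_left)
    qed
    finally show ?thesis .
  qed
qed

lemma weyl_pact_times: "weyl_pact (P * Q) p = weyl_pact P (weyl_pact Q p)"
proof
  fix \<gamma>
  have "weyl_pact P (weyl_pact Q p) \<gamma> = (\<Sum>m\<in>weyl_supp P. weyl_coeff P m *
     weyl_pact_monom m (\<lambda>\<gamma>. \<Sum>n\<in>weyl_supp Q. weyl_coeff Q n * weyl_pact_monom n p \<gamma>) \<gamma>)"
    by (simp add: weyl_pact_def[of P] weyl_pact_def[of Q, abs_def])
  also have "\<dots> = weyl_pact (P * Q) p \<gamma>"
    by (simp add: weyl_pact_monom_sum times_weyl_def weyl_pact_sum weyl_pact_scale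
        weyl_pact_monom_times sum_distrib_left mult.assoc)
  finally show "weyl_pact (P * Q) p \<gamma> = weyl_pact P (weyl_pact Q p) \<gamma>" ..
qed

lemma weyl_pact_inject:
  assumes "\<And>p \<gamma>. weyl_pact P p \<gamma> = weyl_pact Q p \<gamma>"
  shows "P = Q"
proof -
  define R where "R = P - Q"
  have "P = R + Q" by (simp add: R_def)
  then have R0: "weyl_pact R p \<gamma> = 0" for p \<gamma>
    using assms[of p \<gamma>] by (simp add: weyl_pact_add)
  have "weyl_coeff R (a, b) = 0" for a b
  proof (induction "\<Sum>v\<in>UNIV. b v" arbitrary: a b rule: less_induct)
    case less
    have "0 = weyl_pact R (\<lambda>\<gamma>. if \<gamma> = b then 1 else 0) a"
      by (simp add: R0)
    also have "\<dots> = (\<Sum>m\<in>weyl_supp R. if m = (a, b) then weyl_coeff R (a, b) * (\<Prod>v\<in>UNIV. fact (b v)) else 0)"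
      unfolding weyl_pact_def
    proof (rule sum.cong)
      fix m assume m: "m \<in> weyl_supp R"
      obtain a' b' where m_eq: "m = (a', b')" by (cases m)
      show "weyl_coeff R m * weyl_pact_monom m (\<lambda>\<gamma>. if \<gamma> = b then 1 else 0) a =
        (if m = (a, b) then weyl_coeff R (a, b) * (\<Prod>v\<in>UNIV. fact (b v)) else 0)"
      proof (cases "a' \<le> a \<and> (\<lambda>v. a v - a' v + b' v) = b")
        case True
        then have le: "a' v \<le> a v" "b v = a v - a' v + b' v" for v
          by (auto simp: le_fun_def)
        have "b' = b"
        proof (rule ccontr)
          assume "b' \<noteq> b"
          then obtain v where "b' v \<noteq> b v" by blast
          with le[of v] have "b' v < b v" by simp
          then have "(\<Sum>v\<in>UNIV. b' v) < (\<Sum>v\<in>UNIV. b v)"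
            by (intro sum_strict_mono_ex1) (auto simp: le(2))
          then have "weyl_coeff R (a', b') = 0" by (rule less)
          with m show False by (simp add: m_eq weyl_supp_def)
        qed
        moreover have "a' = a"
        proof
          fix v show "a' v = a v" using le[of v] \<open>b' = b\<close> by simp
        qed
        ultimately show ?thesis by (simp add: m_eq weyl_pact_monom_def)
      next
        case False
        then have "m \<noteq> (a, b)" by (auto simp: m_eq)
        with False show ?thesis by (auto simp: m_eq weyl_pact_monom_def)
      qed
    qed simp
    also have "\<dots> = weyl_coeff R (a, b) * (\<Prod>v\<in>UNIV. fact (b v))"
      by (subst sum.delta) (auto simp: weyl_supp_iff)
    finally show ?case by simp
  qed
  then have "R = 0" by (intro weyl_eqI) auto
  then show ?thesis by (simp add: R_def)
qed

lemma weyl_pact_one [simp]: "weyl_pact 1 p = p"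
  by (rule ext) (simp add: one_weyl_def weyl_pact_monom_def le_fun_def)

lemma weyl_pact_add_right: "weyl_pact P (\<lambda>\<gamma>. p \<gamma> + q \<gamma>) \<gamma> = weyl_pact P p \<gamma> + weyl_pact P q \<gamma>"
  unfolding weyl_pact_def sum.distrib[symmetric]
  by (intro sum.cong) (auto simp: weyl_pact_monom_def algebra_simps split: prod.splits)

lemma weyl_pact_scale_right: "weyl_pact P (\<lambda>\<gamma>. c * p \<gamma>) \<gamma> = c * weyl_pact P p \<gamma>"
  unfolding weyl_pact_def sum_distrib_left
  by (intro sum.cong) (auto simp: weyl_pact_monom_def algebra_simps split: prod.splits)

instance weyl :: (finite) ring_1
proof
  fix a b c :: "'a weyl"
  show "a * b * c = a * (b * c)"
    by (rule weyl_pact_inject) (simp add: weyl_pact_times)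
  show "1 * a = a" "a * 1 = a"
    by (rule weyl_pact_inject; simp add: weyl_pact_times)+
  show "(a + b) * c = a * c + b * c"
    by (rule weyl_pact_inject) (simp add: weyl_pact_times weyl_pact_add)
  have "weyl_pact (b + c) p = (\<lambda>\<gamma>. weyl_pact b p \<gamma> + weyl_pact c p \<gamma>)" for p
    by (rule ext) (rule weyl_pact_add)
  then show "a * (b + c) = a * b + a * c"
    by (intro weyl_pact_inject)
       (simp add: weyl_pact_times weyl_pact_add weyl_pact_add_right)
  have "weyl_coeff (0 :: 'a weyl) (\<lambda>_. 0, \<lambda>_. 0) \<noteq> weyl_coeff (1 :: 'a weyl) (\<lambda>_. 0, \<lambda>_. 0)"
    by (simp add: one_weyl_def)
  then show "(0 :: 'a weyl) \<noteq> 1" by metis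
qed

lemma weyl_scale_times_left: "weyl_scale c P * Q = weyl_scale c (P * Q)"
  by (rule weyl_pact_inject) (simp add: weyl_pact_times weyl_pact_scale)

lemma weyl_scale_times_right: "P * weyl_scale c Q = weyl_scale c (P * Q)"
proof (rule weyl_pact_inject)
  fix p \<gamma>
  have "weyl_pact (weyl_scale c Q) p = (\<lambda>\<gamma>. c * weyl_pact Q p \<gamma>)"
    by (rule ext) (rule weyl_pact_scale)
  then show "weyl_pact (P * weyl_scale c Q) p \<gamma> = weyl_pact (weyl_scale c (P * Q)) p \<gamma>"
    by (simp add: weyl_pact_times weyl_pact_scale weyl_pact_scale_right)
qed

lemma weyl_scale_of_nat: "of_nat n * P = weyl_scale (of_nat n) P"
  by (induction n) (simp_all add: algebra_simps weyl_vs.scale_left_distrib)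

definition weyl_x :: "'v::finite \<Rightarrow> 'v weyl" where
  "weyl_x i = weyl_monom (\<lambda>v. if v = i then 1 else 0) (\<lambda>_. 0)"

definition weyl_d :: "'v::finite \<Rightarrow> 'v weyl" where
  "weyl_d i = weyl_monom (\<lambda>_. 0) (\<lambda>v. if v = i then 1 else 0)"

lemma weyl_monom_mult: "weyl_monom a b * weyl_monom c d = weyl_monom_times (a, b) (c, d)"
  by (simp add: times_weyl_def)

lemma weyl_x_monom: "weyl_x i * weyl_monom a b = weyl_monom (a(i := Suc (a i))) b"
proof -
  have "{k :: 'a \<Rightarrow> nat. k \<le> (\<lambda>_. 0) \<and> k \<le> a} = {\<lambda>_. 0}"
    by (auto simp: le_fun_def)
  moreover have "(\<lambda>v. (if v = i then 1 else 0) + a v - 0) = a(i := Suc (a i))" by auto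
  ultimately show ?thesis
    by (simp add: weyl_x_def weyl_monom_mult weyl_monom_times_def)
qed

lemma weyl_d_monom:
  "weyl_d i * weyl_monom a b =
     weyl_monom a (b(i := Suc (b i))) + weyl_scale (of_nat (a i)) (weyl_monom (a(i := a i - 1)) b)"
proof -
  let ?e = "\<lambda>v. if v = i then 1 else 0 :: nat"
  let ?z = "\<lambda>_ :: 'a. 0 :: nat"
  define T where "T k = weyl_scale (\<Prod>v\<in>UNIV. fact (k v) * of_nat (?e v choose k v) * of_nat (a v choose k v))
       (weyl_monom (\<lambda>v. 0 + a v - k v) (\<lambda>v. ?e v + b v - k v))" for k
  have prod_i: "(\<Prod>v\<in>UNIV. if v = i then h else (1::complex)) = h" for h
    by (subst prod.delta) auto
  have "weyl_d i * weyl_monom a b = (\<Sum>k | k \<le> ?e \<and> k \<le> a. T k)"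
    by (simp add: weyl_d_def weyl_monom_mult weyl_monom_times_def T_def)
  also have "\<dots> = (\<Sum>k\<in>{?z, ?e}. T k)"
  proof (rule sum.mono_neutral_left)
    show "{k. k \<le> ?e \<and> k \<le> a} \<subseteq> {?z, ?e}"
    proof
      fix k assume "k \<in> {k. k \<le> ?e \<and> k \<le> a}"
      then have le: "k v \<le> ?e v" for v by (simp add: le_fun_def)
      have k: "k v = (if v = i then k i else 0)" for v
        using le[of v] by (cases "v = i") auto
      have "k i = 0 \<or> k i = 1" using le[of i] by auto
      then show "k \<in> {?z, ?e}"
      proof
        assume "k i = 0"
        have "k = ?z"
        proof
          fix v show "k v = ?z v" using k[of v] \<open>k i = 0\<close> by simp
        qed
        then show ?thesis by simp
      next
        assume "k i = 1"
        have "k = ?e"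
        proof
          fix v show "k v = ?e v" using k[of v] \<open>k i = 1\<close> by simp
        qed
        then show ?thesis by simp
      qed
    qed
    show "\<forall>k\<in>{?z, ?e} - {k. k \<le> ?e \<and> k \<le> a}. T k = 0"
    proof
      fix k assume k: "k \<in> {?z, ?e} - {k. k \<le> ?e \<and> k \<le> a}"
      then have "k = ?e" by (auto simp: le_fun_def)
      with k have "a i = 0" by (auto simp: le_fun_def split: if_splits)
      have "(\<Prod>v\<in>UNIV. fact (k v) * of_nat (?e v choose k v) * of_nat (a v choose k v)) = (0::complex)"
        by (rule prod_zero) (use \<open>k = ?e\<close> \<open>a i = 0\<close> in \<open>auto intro!: exI[of _ i]\<close>)
      then show "T k = 0" unfolding T_def by (simp only: weyl_vs.scale_zero_left)
    qed
  qed simp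
  also have "\<dots> = T ?z + T ?e"
  proof -
    have "?z \<noteq> ?e" by (auto simp: fun_eq_iff)
    then show ?thesis by simp
  qed
  also have "T ?z = weyl_monom a (b(i := Suc (b i)))"
  proof -
    have "(\<lambda>v. ?e v + b v - 0) = b(i := Suc (b i))" by auto
    then show ?thesis by (simp add: T_def)
  qed
  also have "T ?e = weyl_scale (of_nat (a i)) (weyl_monom (a(i := a i - 1)) b)"
  proof -
    have "(\<lambda>v. ?e v + b v - ?e v) = b" "(\<lambda>v. 0 + a v - ?e v) = a(i := a i - 1)" by auto
    moreover have "(\<Prod>v\<in>UNIV. fact (?e v) * of_nat (?e v choose ?e v) * of_nat (a v choose ?e v)) =
        (\<Prod>v\<in>UNIV. if v = i then of_nat (a i) else (1::complex))"
      by (rule prod.cong) auto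
    ultimately show ?thesis unfolding T_def by (simp only: prod_i)
  qed
  finally show ?thesis .
qed

lemma weyl_expand: "P = (\<Sum>m\<in>weyl_supp P. weyl_scale (weyl_coeff P m) (weyl_monom (fst m) (snd m)))"
proof (rule weyl_eqI)
  fix m
  have "weyl_coeff (\<Sum>m\<in>weyl_supp P. weyl_scale (weyl_coeff P m) (weyl_monom (fst m) (snd m))) m
    = (\<Sum>n\<in>weyl_supp P. if n = m then weyl_coeff P m else 0)"
    unfolding weyl_coeff_sum by (rule sum.cong) auto
  also have "\<dots> = weyl_coeff P m"
    by (subst sum.delta) (auto simp: weyl_supp_iff)
  finally show "weyl_coeff P m =
    weyl_coeff (\<Sum>m\<in>weyl_supp P. weyl_scale (weyl_coeff P m) (weyl_monom (fst m) (snd m))) m" ..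
qed

lemma weyl_linear_induct [case_names zero add scale monom]:
  assumes "H 0" "\<And>P Q. H P \<Longrightarrow> H Q \<Longrightarrow> H (P + Q)" "\<And>c P. H P \<Longrightarrow> H (weyl_scale c P)"
    and "\<And>a b. H (weyl_monom a b)"
  shows "H P"
proof -
  have "H (\<Sum>m\<in>A. weyl_scale (weyl_coeff P m) (weyl_monom (fst m) (snd m)))" for A
    by (induction A rule: infinite_finite_induct) (auto intro: assms)
  then show ?thesis using weyl_expand[of P] by metis
qed

lemma weyl_induct [case_names zero one add scale x d]:
  assumes "H 0" "H 1" "\<And>P Q. H P \<Longrightarrow> H Q \<Longrightarrow> H (P + Q)" "\<And>c P. H P \<Longrightarrow> H (weyl_scale c P)"
    and x: "\<And>i P. H P \<Longrightarrow> H (weyl_x i * P)" and d: "\<And>i P. H P \<Longrightarrow> H (weyl_d i * P)"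
  shows "H P"
proof (induction P rule: weyl_linear_induct)
  case (monom a b)
  show ?case
  proof (induction "(\<Sum>v\<in>UNIV. a v) + (\<Sum>v\<in>UNIV. b v)" arbitrary: a b rule: less_induct)
    case less
    have dec: "(\<Sum>v\<in>UNIV. (c(i := c i - 1)) v) < (\<Sum>v\<in>UNIV. c v)" if "c i \<noteq> 0" for c :: "'a \<Rightarrow> nat" and i
      by (rule sum_strict_mono_ex1) (use that in \<open>auto intro!: exI[of _ i]\<close>)
    show ?case
    proof (cases "\<exists>i. a i \<noteq> 0")
      case True
      then obtain i where i: "a i \<noteq> 0" by blast
      have "H (weyl_monom (a(i := a i - 1)) b)"
        by (rule less) (use dec[of a, OF i] in simp)
      from x[OF this, of i] show ?thesis using i by (simp add: weyl_x_monom)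
    next
      case False
      then have a: "a = (\<lambda>_. 0)" by auto
      show ?thesis
      proof (cases "\<exists>i. b i \<noteq> 0")
        case True
        then obtain i where i: "b i \<noteq> 0" by blast
        have "H (weyl_monom a (b(i := b i - 1)))"
          by (rule less) (use dec[of b, OF i] in simp)
        from d[OF this, of i] show ?thesis using i a by (simp add: weyl_d_monom)
      next
        case False
        then have "b = (\<lambda>_. 0)" by auto
        with a \<open>H 1\<close> show ?thesis by (simp add: one_weyl_def)
      qed
    qed
  qed
qed (use assms in auto)

lemma weyl_x_alt: "weyl_x i = weyl_monom ((\<lambda>_. 0)(i := Suc 0)) (\<lambda>_. 0)"
  unfolding weyl_x_def by (rule arg_cong2[where f = weyl_monom]) auto

lemma weyl_d_alt: "weyl_d i = weyl_monom (\<lambda>_. 0) ((\<lambda>_. 0)(i := Suc 0))"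
  unfolding weyl_d_def by (rule arg_cong2[where f = weyl_monom]) auto

lemma weyl_d_x: "weyl_d i * weyl_x j = weyl_x j * weyl_d i + (if i = j then 1 else 0)"
  unfolding weyl_x_alt[of j] weyl_d_monom
  unfolding weyl_x_alt[of j, symmetric] weyl_d_alt weyl_x_monom
  by (simp add: one_weyl_def fun_upd_idem)

lemma weyl_x_commute: "weyl_x i * weyl_x j = weyl_x j * weyl_x i"
proof (cases "i = j")
  case False
  have "weyl_x i * weyl_x j = weyl_monom ((\<lambda>_. 0)(j := Suc 0, i := Suc 0)) (\<lambda>_. 0)"
    unfolding weyl_x_alt[of j] weyl_x_monom using False by simp
  also have "\<dots> = weyl_x j * weyl_x i"
    unfolding weyl_x_alt[of i] weyl_x_monom using False by (simp add: fun_upd_twist)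
  finally show ?thesis .
qed simp

lemma weyl_d_commute: "weyl_d i * weyl_d j = weyl_d j * weyl_d i"
proof (cases "i = j")
  case False
  have "weyl_d i * weyl_d j = weyl_monom (\<lambda>_. 0) ((\<lambda>_. 0)(j := Suc 0, i := Suc 0))"
    unfolding weyl_d_alt[of j] weyl_d_monom using False by simp
  also have "\<dots> = weyl_d j * weyl_d i"
    unfolding weyl_d_alt[of i] weyl_d_monom using False by (simp add: fun_upd_twist)
  finally show ?thesis .
qed simp


subsection \<open>Algebra morphisms between Weyl algebras\<close>

definition weyl_hom :: "('v::finite weyl \<Rightarrow> 'w::finite weyl) \<Rightarrow> bool" where
  "weyl_hom h \<longleftrightarrow> h 1 = 1 \<and> (\<forall>P Q. h (P + Q) = h P + h Q) \<and> (\<forall>P Q. h (P * Q) = h P * h Q) \<and>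
     (\<forall>c P. h (weyl_scale c P) = weyl_scale c (h P))"

lemma prod_list_powers_commute:
  fixes A :: "'v \<Rightarrow> 'r::ring_1"
  assumes "\<And>v. C * A v = A v * C"
  shows "C * prod_list (map (\<lambda>v. A v ^ a v) l) = prod_list (map (\<lambda>v. A v ^ a v) l) * C"
proof (induction l)
  case (Cons v l)
  have "C * A v ^ n = A v ^ n * C" for n
    by (induction n) (simp_all add: assms mult.assoc, metis assms mult.assoc)
  then show ?case using Cons by simp (metis mult.assoc)
qed simp

lemma prod_list_powers_Suc:
  fixes A :: "'v \<Rightarrow> 'r::ring_1"
  assumes "\<And>v w. A v * A w = A w * A v" "distinct l" "i \<in> set l"
  shows "prod_list (map (\<lambda>v. A v ^ (a(i := Suc (a i))) v) l) = A i * prod_list (map (\<lambda>v. A v ^ a v) l)"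
  using assms(2,3)
proof (induction l)
  case (Cons v l)
  show ?case
  proof (cases "v = i")
    case True
    with Cons.prems have "prod_list (map (\<lambda>v. A v ^ (a(i := Suc (a i))) v) l) = prod_list (map (\<lambda>v. A v ^ a v) l)"
      by (intro arg_cong[where f = prod_list]) auto
    with True show ?thesis by (simp add: mult.assoc)
  next
    case False
    have "A v ^ n * (A i * R) = A i * (A v ^ n * R)" for n R
      using power_commuting_commutes[OF assms(1)[of v i], of n] by (simp flip: mult.assoc)
    moreover have "prod_list (map (\<lambda>v. A v ^ (a(i := Suc (a i))) v) l) =
        A i * prod_list (map (\<lambda>v. A v ^ a v) l)"
      using Cons False by auto
    ultimately show ?thesis using False by (simp del: fun_upd_apply add: fun_upd_other)
  qed
qed simp

lemma prod_list_powers_deriv: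
  fixes A :: "'v \<Rightarrow> 'r::ring_1"
  assumes comm: "\<And>v. B * A v = A v * B + (if v = i then 1 else 0)" and "distinct l"
  shows "B * prod_list (map (\<lambda>v. A v ^ a v) l) = prod_list (map (\<lambda>v. A v ^ a v) l) * B +
    (if i \<in> set l then of_nat (a i) * prod_list (map (\<lambda>v. A v ^ (a(i := a i - 1)) v) l) else 0)"
  using assms(2)
proof (induction l)
  case (Cons v l)
  let ?L = "prod_list (map (\<lambda>v. A v ^ a v) l)"
  have of_nat: "C * (of_nat k * R) = of_nat k * (C * R)" for k and C R :: 'r
    by (metis mult.assoc mult_of_nat_commute)
  have neq: "B * A v ^ n = A v ^ n * B" if "v \<noteq> i" for n
    using power_commuting_commutes[of "A v" B n] comm[of v] that by simp
  have eq: "B * A i ^ n = A i ^ n * B + of_nat n * A i ^ (n - 1)" for n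
  proof (induction n)
    case (Suc n)
    have "B * A i ^ Suc n = (A i * B + 1) * A i ^ n"
      using comm[of i] by (simp flip: mult.assoc)
    also have "\<dots> = A i * (B * A i ^ n) + A i ^ n"
      by (simp add: algebra_simps)
    also have "A i * (B * A i ^ n) = A i ^ Suc n * B + of_nat n * A i ^ n"
      unfolding Suc.IH distrib_left of_nat
      by (cases n) (simp_all add: mult.assoc)
    finally show ?case by (simp add: algebra_simps)
  qed simp
  show ?case
  proof (cases "v = i")
    case True
    then have "i \<notin> set l" using Cons.prems by auto
    then have L: "prod_list (map (\<lambda>v. A v ^ (a(i := a i - 1)) v) l) = ?L"
      by (intro arg_cong[where f = prod_list]) auto
    have "B * ?L = ?L * B" using Cons \<open>i \<notin> set l\<close> by simp
    moreover have "B * (A i ^ a i * ?L) = (A i ^ a i * B + of_nat (a i) * A i ^ (a i - 1)) * ?L"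
      by (simp only: eq[symmetric] mult.assoc)
    then have "B * (A i ^ a i * ?L) = A i ^ a i * (B * ?L) + of_nat (a i) * (A i ^ (a i - 1) * ?L)"
      by (simp only: distrib_right mult.assoc)
    ultimately show ?thesis
      using True L by (simp add: mult.assoc)
  next
    case False
    have "B * (A v ^ a v * ?L) = A v ^ a v * (B * ?L)"
      using neq[OF False] by (simp flip: mult.assoc)
    also have "B * ?L = ?L * B + (if i \<in> set l then of_nat (a i) *
        prod_list (map (\<lambda>v. A v ^ (a(i := a i - 1)) v) l) else 0)"
      using Cons by simp
    finally show ?thesis using False
      by (simp add: distrib_left mult.assoc of_nat)
  qed
qed simp

lemma weyl_universal:
  fixes A B :: "'v::finite \<Rightarrow> 'w::finite weyl"
  assumes AA: "\<And>i j. A i * A j = A j * A i" and BB: "\<And>i j. B i * B j = B j * B i"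
    and BA: "\<And>i j. B i * A j = A j * B i + (if i = j then 1 else 0)"
  shows "\<exists>!h. weyl_hom h \<and> (\<forall>i. h (weyl_x i) = A i) \<and> (\<forall>i. h (weyl_d i) = B i)"
proof (rule ex_ex1I)
  obtain l :: "'v list" where l: "set l = UNIV" "distinct l"
    using finite_distinct_list[of "UNIV :: 'v set"] by auto
  define pw :: "('v \<Rightarrow> 'w weyl) \<Rightarrow> ('v \<Rightarrow> nat) \<Rightarrow> 'w weyl"
    where "pw C a = prod_list (map (\<lambda>v. C v ^ a v) l)" for C a
  define h where "h P = (\<Sum>m\<in>weyl_supp P. weyl_scale (weyl_coeff P m) (pw A (fst m) * pw B (snd m)))" for P
  have h_super: "h P = (\<Sum>m\<in>S. weyl_scale (weyl_coeff P m) (pw A (fst m) * pw B (snd m)))"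
    if "finite S" "weyl_supp P \<subseteq> S" for S P
    unfolding h_def by (rule sum.mono_neutral_left) (use that in \<open>auto simp: weyl_supp_def\<close>)
  have h_add: "h (P + Q) = h P + h Q" for P Q
    by (subst (1 2 3) h_super[of "weyl_supp P \<union> weyl_supp Q \<union> weyl_supp (P + Q)"])
       (auto simp: sum.distrib weyl_vs.scale_left_distrib)
  have h_scale: "h (weyl_scale c P) = weyl_scale c (h P)" for c P
    by (subst (1 2) h_super[of "weyl_supp P \<union> weyl_supp (weyl_scale c P)"])
       (auto simp: weyl_vs.scale_sum_right)
  have h_0: "h 0 = 0" by (simp add: h_def weyl_supp_def)
  have h_monom: "h (weyl_monom a b) = pw A a * pw B b" for a b
    by (simp add: h_def)
  have pw_0: "pw C (\<lambda>_. 0) = 1" for C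
  proof -
    have "prod_list (map (\<lambda>v. 1) k) = (1 :: 'w weyl)" for k :: "'v list" by (induction k) auto
    then show ?thesis by (simp add: pw_def)
  qed
  have h_1: "h 1 = 1" by (simp add: one_weyl_def[where 'a='v] h_monom pw_0)
  have h_x: "h (weyl_x i * P) = A i * h P" for i P
  proof (induction P rule: weyl_linear_induct)
    case (monom a b)
    have "pw A (a(i := Suc (a i))) = A i * pw A a"
      unfolding pw_def by (rule prod_list_powers_Suc) (use AA l in auto)
    then show ?case by (simp add: weyl_x_monom h_monom mult.assoc)
  qed (simp_all add: h_0 h_add h_scale distrib_left weyl_scale_times_right)
  have h_d: "h (weyl_d i * P) = B i * h P" for i P
  proof (induction P rule: weyl_linear_induct)
    case (monom a b)
    have "pw B (b(i := Suc (b i))) = B i * pw B b"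
      unfolding pw_def by (rule prod_list_powers_Suc) (use BB l in auto)
    moreover have "B i * pw A a = pw A a * B i + of_nat (a i) * pw A (a(i := a i - 1))"
      unfolding pw_def
      by (subst prod_list_powers_deriv[where i = i]) (use BA l in auto)
    ultimately show ?case
      by (simp add: weyl_d_monom h_monom h_add h_scale distrib_right weyl_scale_of_nat
          weyl_scale_times_left flip: mult.assoc)
  qed (simp_all add: h_0 h_add h_scale distrib_left weyl_scale_times_right)
  have "h (P * Q) = h P * h Q" for P Q
    by (induction P rule: weyl_induct)
       (simp_all add: h_0 h_1 h_add h_scale h_x h_d distrib_right weyl_scale_times_left mult.assoc)
  moreover have "h (weyl_x i) = A i" "h (weyl_d i) = B i" for i
    using h_x[of i 1] h_d[of i 1] by (simp_all add: h_1)
  ultimately show "\<exists>h. weyl_hom h \<and> (\<forall>i. h (weyl_x i) = A i) \<and> (\<forall>i. h (weyl_d i) = B i)"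
    unfolding weyl_hom_def using h_1 h_add h_scale by blast
next
  fix h h'
  assume h: "weyl_hom h \<and> (\<forall>i. h (weyl_x i) = A i) \<and> (\<forall>i. h (weyl_d i) = B i)"
    and h': "weyl_hom h' \<and> (\<forall>i. h' (weyl_x i) = A i) \<and> (\<forall>i. h' (weyl_d i) = B i)"
  have z: "g 0 = 0" if "weyl_hom g" for g :: "'v weyl \<Rightarrow> 'w weyl"
    using that unfolding weyl_hom_def by (metis add_cancel_right_right)
  show "h = h'"
  proof
    fix P show "h P = h' P"
      by (induction P rule: weyl_induct) (use h h' z[of h] z[of h'] in \<open>auto simp: weyl_hom_def\<close>)
  qed
qed


section \<open>Action on smooth functions\<close>

definition partial :: "'v \<Rightarrow> (real ^ 'v \<Rightarrow> complex) \<Rightarrow> real ^ 'v \<Rightarrow> complex" where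
  "partial i f x = vector_derivative (\<lambda>h. f (x + h *\<^sub>R axis i 1)) (at 0)"

text \<open>
  \<open>C\<^sup>\<infinity>\<close> on an open set \<open>U\<close>: all iterated partial derivatives exist and are differentiable.
\<close>

definition smooth_on :: "(real ^ 'v) set \<Rightarrow> (real ^ 'v \<Rightarrow> complex) \<Rightarrow> bool" where
  "smooth_on U f \<longleftrightarrow> (\<forall>l. \<forall>x\<in>U. (foldr partial l f) differentiable (at x))"

text \<open>
  \<open>\<partial>\<^sup>\<beta> f\<close>; the order in which the partial derivatives are taken is immaterial for smooth \<open>f\<close>.
\<close>

definition multi_partial :: "('v \<Rightarrow> nat) \<Rightarrow> (real ^ 'v \<Rightarrow> complex) \<Rightarrow> real ^ 'v \<Rightarrow> complex" where
  "multi_partial \<beta> f = foldr partial (SOME l. \<forall>v. count_list l v = \<beta> v) f"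

definition weyl_act :: "'v::finite weyl \<Rightarrow> (real ^ 'v \<Rightarrow> complex) \<Rightarrow> real ^ 'v \<Rightarrow> complex" where
  "weyl_act P f x = (\<Sum>(\<alpha>, \<beta>)\<in>weyl_supp P.
     weyl_coeff P (\<alpha>, \<beta>) * of_real (\<Prod>v\<in>UNIV. (x $ v) ^ \<alpha> v) * multi_partial \<beta> f x)"

definition annihilates_on :: "(real ^ 'v) set \<Rightarrow> 'v::finite weyl \<Rightarrow> (real ^ 'v \<Rightarrow> complex) \<Rightarrow> bool" where
  "annihilates_on U P f \<longleftrightarrow> smooth_on U f \<and> (\<forall>x\<in>U. weyl_act P f x = 0)"


section \<open>Holonomic left ideals\<close>

definition left_ideal :: "'v::finite weyl set \<Rightarrow> bool" where
  "left_ideal I \<longleftrightarrow> 0 \<in> I \<and> (\<forall>P\<in>I. \<forall>Q\<in>I. P + Q \<in> I) \<and> (\<forall>R. \<forall>P\<in>I. R * P \<in> I)"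

definition left_ideal_gen :: "'v::finite weyl set \<Rightarrow> 'v weyl set" where
  "left_ideal_gen S = \<Inter>{I. left_ideal I \<and> S \<subseteq> I}"

definition bernstein :: "nat \<Rightarrow> 'v::finite weyl set" where
  "bernstein k = {P. \<forall>(\<alpha>, \<beta>)\<in>weyl_supp P. (\<Sum>v\<in>UNIV. \<alpha> v) + (\<Sum>v\<in>UNIV. \<beta> v) \<le> k}"

text \<open>
  With \<open>B\<^sub>k\<close> the Bernstein filtration of \<open>D\<close>, the images \<open>(B\<^sub>k + I) / I\<close> form a good filtration
  of \<open>D / I\<close>. The Hilbert function of \<open>D / I\<close> is the dimension
  of \<open>(B\<^sub>k + I) / I \<cong> B\<^sub>k / (B\<^sub>k \<inter> I)\<close>, where all \<open>B\<^sub>k\<close> are finite-dimensional.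
\<close>

definition hilbert_fun :: "'v::finite weyl set \<Rightarrow> nat \<Rightarrow> nat" where
  "hilbert_fun I k = weyl_vs.dim (bernstein k :: 'v weyl set) - weyl_vs.dim (bernstein k \<inter> I)"

text \<open>
  \<open>D / I\<close> is a holonomic left \<open>D\<close>-module iff it is zero or its dimension, that is the degree of
  its Hilbert polynomial, equals the number of variables.
\<close>

definition holonomic_ideal :: "'v::finite weyl set \<Rightarrow> bool" where
  "holonomic_ideal I \<longleftrightarrow> left_ideal I \<and> (I = UNIV \<or>
     (\<exists>p :: real poly. degree p = CARD('v) \<and>
        (\<forall>\<^sub>F k in sequentially. real (hilbert_fun I k) = poly p (real k))))"


section \<open>The integral transform\<close>

instance uprod :: (finite) finite
  by standard simp

text \<open>
  The variables of \<open>D\<^sub>x\<^sub>y\<close>: \<open>Inl (Upair i j)\<close> stands for \<open>x\<^sub>i\<^sub>j = x\<^sub>j\<^sub>i\<close> (one variable for each unordered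
  pair, including \<open>i = j\<close>) and \<open>Inr k\<close> for \<open>y\<^sub>k\<close>.
\<close>

type_synonym 'd xy = "'d uprod + 'd"

abbreviation xvar :: "'d \<Rightarrow> 'd \<Rightarrow> 'd::finite xy weyl" where "xvar i j \<equiv> weyl_x (Inl (Upair i j))"
abbreviation yvar :: "'d \<Rightarrow> 'd::finite xy weyl" where "yvar k \<equiv> weyl_x (Inr k)"
abbreviation dxvar :: "'d \<Rightarrow> 'd \<Rightarrow> 'd::finite xy weyl" where "dxvar i j \<equiv> weyl_d (Inl (Upair i j))"
abbreviation dyvar :: "'d \<Rightarrow> 'd::finite xy weyl" where "dyvar k \<equiv> weyl_d (Inr k)"

definition phi :: "'d::finite weyl \<Rightarrow> 'd xy weyl" where
  "phi = (THE h. weyl_hom h \<and> (\<forall>i. h (weyl_x i) = dyvar i) \<and>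
     (\<forall>i. h (weyl_d i) = - yvar i - 2 * (\<Sum>k\<in>UNIV. xvar i k * dyvar k)))"

lemma phi_well_defined:
  "\<exists>!h :: 'd::finite weyl \<Rightarrow> 'd xy weyl. weyl_hom h \<and> (\<forall>i. h (weyl_x i) = dyvar i) \<and>
     (\<forall>i. h (weyl_d i) = - yvar i - 2 * (\<Sum>k\<in>UNIV. xvar i k * dyvar k))"
proof (rule weyl_universal)
  fix i j :: 'd
  show "dyvar i * dyvar j = dyvar j * dyvar i" by (rule weyl_d_commute)
  define S where "S i = (\<Sum>k\<in>UNIV. xvar i k * dyvar k)" for i :: 'd
  have XdY: "dyvar j * xvar i k = xvar i k * dyvar j" for i j k :: 'd
    by (simp add: weyl_d_x)
  have dYY: "dyvar k * yvar j = yvar j * dyvar k + (if k = j then 1 else 0)" for j k :: 'd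
    by (simp add: weyl_d_x)
  have SdY: "S i * dyvar j = dyvar j * S i" for i j
    unfolding S_def sum_distrib_left sum_distrib_right
  proof (rule sum.cong)
    fix k :: 'd
    show "xvar i k * dyvar k * dyvar j = dyvar j * (xvar i k * dyvar k)"
      using XdY weyl_d_commute by (metis mult.assoc)
  qed simp
  have SY: "S i * yvar j = yvar j * S i + xvar i j" for i j
  proof -
    have "S i * yvar j = (\<Sum>k\<in>UNIV. yvar j * (xvar i k * dyvar k) + (if k = j then xvar i k else 0))"
      unfolding S_def sum_distrib_right
    proof (rule sum.cong)
      fix k :: 'd
      have "xvar i k * dyvar k * yvar j = xvar i k * yvar j * dyvar k + xvar i k * (if k = j then 1 else 0)"
        by (simp add: mult.assoc dYY distrib_left)
      then show "xvar i k * dyvar k * yvar j = yvar j * (xvar i k * dyvar k) + (if k = j then xvar i k else 0)"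
        by (simp add: weyl_x_commute[of _ "Inr j"] mult.assoc)
    qed simp
    then show ?thesis by (simp add: sum.distrib S_def sum_distrib_left)
  qed
  have SS: "S i * S j = S j * S i" for i j
  proof -
    have "S i * (xvar j k * dyvar k) = (xvar j k * dyvar k) * S i" for k
    proof -
      have "S i * xvar j k = xvar j k * S i"
        unfolding S_def sum_distrib_left sum_distrib_right
      proof (rule sum.cong)
        fix l :: 'd
        have "xvar i l * dyvar l * xvar j k = xvar i l * xvar j k * dyvar l"
          by (simp only: mult.assoc XdY)
        also have "\<dots> = xvar j k * xvar i l * dyvar l"
          by (subst weyl_x_commute) (rule refl)
        finally show "xvar i l * dyvar l * xvar j k = xvar j k * (xvar i l * dyvar l)"
          by (simp only: mult.assoc)
      qed simp
      then have "S i * (xvar j k * dyvar k) = xvar j k * (S i * dyvar k)"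
        by (simp flip: mult.assoc)
      then show ?thesis by (simp only: SdY mult.assoc)
    qed
    then show ?thesis by (simp add: S_def[of j] sum_distrib_left sum_distrib_right)
  qed
  have "Upair j i = Upair i j" by simp
  then have sym: "xvar j i = xvar i j" by (simp only:)
  have expand: "(- a - 2 * b) * (- c - 2 * e) =
      a * c + (a * e + a * e) + (b * c + b * c) + (b * e + b * e + (b * e + b * e))"
    for a b c e :: "'d xy weyl"
    by (simp add: mult_2 left_diff_distrib right_diff_distrib distrib_left distrib_right add_ac)
  have "(- yvar i - 2 * S i) * (- yvar j - 2 * S j) = (- yvar j - 2 * S j) * (- yvar i - 2 * S i)"
    unfolding expand SS[of i j] SY weyl_x_commute[of "Inr i" "Inr j"] sym
    by (simp only: add_ac)
  then show "(- yvar i - 2 * (\<Sum>k\<in>UNIV. xvar i k * dyvar k)) * (- yvar j - 2 * (\<Sum>k\<in>UNIV. xvar j k * dyvar k)) =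
    (- yvar j - 2 * (\<Sum>k\<in>UNIV. xvar j k * dyvar k)) * (- yvar i - 2 * (\<Sum>k\<in>UNIV. xvar i k * dyvar k))"
    by (simp only: S_def)
  have "(- yvar i - 2 * S i) * dyvar j = dyvar j * (- yvar i - 2 * S i) + (if i = j then 1 else 0)"
    using SdY[of i j] dYY[of j i]
    by (simp add: mult_2 left_diff_distrib right_diff_distrib distrib_left distrib_right)
  then show "(- yvar i - 2 * (\<Sum>k\<in>UNIV. xvar i k * dyvar k)) * dyvar j =
    dyvar j * (- yvar i - 2 * (\<Sum>k\<in>UNIV. xvar i k * dyvar k)) + (if i = j then 1 else 0)"
    by (simp only: S_def)
qed

lemma phi_props:
  shows "weyl_hom phi" and "phi (weyl_x i) = dyvar i"
    and "phi (weyl_d i) = - yvar i - 2 * (\<Sum>k\<in>UNIV. xvar i k * dyvar k)"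
  using theI'[OF phi_well_defined, folded phi_def] by blast+

definition exponential_growth :: "(real ^ 'd \<Rightarrow> complex) \<Rightarrow> bool" where
  "exponential_growth f \<longleftrightarrow> (\<exists>C c. \<forall>t. norm (f t) \<le> C * exp (c * norm t))"

definition x_matrix :: "real ^ 'd::finite xy \<Rightarrow> real ^ 'd ^ 'd" where
  "x_matrix z = (\<chi> i j. z $ Inl (Upair i j))"

definition y_vector :: "real ^ 'd::finite xy \<Rightarrow> real ^ 'd" where
  "y_vector z = (\<chi> i. z $ Inr i)"

definition positive_definite :: "real ^ 'd ^ 'd \<Rightarrow> bool" where
  "positive_definite A \<longleftrightarrow> transpose A = A \<and> (\<forall>t. t \<noteq> 0 \<longrightarrow> t \<bullet> (A *v t) > 0)"

definition xy_domain :: "(real ^ 'd::finite xy) set" where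
  "xy_domain = {z. positive_definite (- x_matrix z)}"

definition integral_transform :: "(real ^ 'd::finite \<Rightarrow> complex) \<Rightarrow> real ^ 'd xy \<Rightarrow> complex" where
  "integral_transform f z = (LINT t|lborel. f t *
     of_real (exp ((\<Sum>i\<in>UNIV. \<Sum>j\<in>UNIV. x_matrix z $ i $ j * t $ i * t $ j) +
       (\<Sum>i\<in>UNIV. y_vector z $ i * t $ i))))"

end

theory Submission
  imports Defs "HOL-Probability.Distributions"
begin

text \<open>
  Write \<open>g\<close> as a Laplace transform \<open>\<integral> f(t) e\<^bsup>q(x, y, t)\<^esup> dt\<close> with \<open>q\<close> linear in \<open>(x, y)\<close>; the exponential
  growth of \<open>f\<close> allows differentiation under the integral sign, which yields the heat equations
  \<open>\<partial>\<^sub>x\<^sub>i\<^sub>j g = 2 \<partial>\<^sub>y\<^sub>i \<partial>\<^sub>y\<^sub>j g\<close>. The derivatives of \<open>f\<close> may grow arbitrarily fast, so \<open>phi P\<close> is transferred to \<open>g\<close>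
  by integrating \<open>P f = 0\<close> against the kernel times a compactly supported cutoff, moving all
  derivatives to the kernel, and only then removing the cutoff.

  For holonomicity let \<open>J\<close> be the ideal generated in \<open>D\<^sub>x\<^sub>y\<close> and \<open>I\<close> the one generated by the \<open>P\<^sub>k\<close>. Leading
  exponents for a degree-compatible order show that every Hilbert function is eventually a
  polynomial. Since the heat operators commute with \<open>phi P\<close>, the elements of \<open>B\<^sub>k\<close> are modulo \<open>J\<close> combinations of
  \<open>x\<^sup>a phi P\<close> with \<open>a\<close> and \<open>P\<close> of degree \<open>O(k)\<close>, and \<open>P\<close> matters only modulo \<open>I\<close>; this bounds the degree of the
  Hilbert polynomial of \<open>J\<close> by the number of variables. If \<open>J\<close> is proper, Bernstein's inequality is the
  reverse bound.
\<close>

section \<open>Counting points of lower sets\<close>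

text \<open>The count behind the upper bound: exponents a with entries at most 2k give (2k+1)^m
  choices for the m variables x_ij, and P modulo I contributes \<open>hilbert_fun I (2 * k)\<close>,
  eventually a polynomial of degree d if I is holonomic and proper; m + d is exactly the number of
  variables of D_xy. The factor 2 arises because, modulo J, the derivative in x_ij acts as
  \<open>phi\<close> of a multiple of the quadratic t_i t_j, so one generator of D_xy may cost two
  degrees in t. Quotient modules are never formed. Dimensions of quotients are counted by exponents
  that are not leading, or by a basis of a complement together with its coordinate functionals. On
  the analytic side the cutoffs are not smooth bumps but powers of max(0, 1 - |t|^2/(n+1)^2).
  Differentiating such a power lowers it by one and produces a factor of order 1/(n+1)^2. Thus the
  test functions stay in one explicit family, the corrections vanish as n grows, and a power
  slightly above the order of the operator suffices.\<close>

lemma nat_seq_incseq_subseq: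
  fixes s :: "nat \<Rightarrow> nat"
  shows "\<exists>r. strict_mono r \<and> incseq (\<lambda>n. s (r n))"
proof -
  obtain r :: "nat \<Rightarrow> nat" where r: "strict_mono r" "monoseq (\<lambda>n. s (r n))"
    using seq_monosub by blast
  show ?thesis
  proof (cases "incseq (\<lambda>n. s (r n))")
    case False
    then have dec: "decseq (\<lambda>n. s (r n))" using r(2) by (simp add: monoseq_iff)
    \<comment> \<open>A decreasing sequence of naturals is constant once it has attained its least
      value.\<close>
    define c where "c = (LEAST c. \<exists>n. s (r n) = c)"
    have "\<exists>n. s (r n) = c" unfolding c_def by (rule LeastI_ex) auto
    then obtain N where N: "s (r N) = c" by blast
    have "s (r (n + N)) = c" for n
    proof (rule antisym)
      show "s (r (n + N)) \<le> c" using decseqD[OF dec, of N "n + N"] N by simp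
      show "c \<le> s (r (n + N))" unfolding c_def by (rule Least_le) auto
    qed
    moreover have "strict_mono (\<lambda>n. r (n + N))" using r(1) by (simp add: strict_mono_def)
    ultimately show ?thesis by (intro exI[of _ "\<lambda>n. r (n + N)"]) (simp add: incseq_def)
  qed (use r in blast)
qed

text \<open>Dickson's lemma. Thinning out the sequence once for each coordinate in \<open>S\<close>
  leaves a subsequence that increases in all of them, and its first two terms are
  comparable.\<close>

lemma dickson:
  fixes s :: "nat \<Rightarrow> 'a \<Rightarrow> nat"
  assumes "finite S" and "\<And>n v. v \<notin> S \<Longrightarrow> s n v = 0"
  shows "\<exists>i j. i < j \<and> s i \<le> s j"
proof -
  from assms(1) have "\<exists>r. strict_mono r \<and> (\<forall>v\<in>S. incseq (\<lambda>n. s (r n) v))"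
  proof induction
    case empty show ?case by (auto intro: exI[of _ id] simp: strict_mono_id)
  next
    case (insert v S)
    then obtain r where r: "strict_mono r" "\<And>v. v \<in> S \<Longrightarrow> incseq (\<lambda>n. s (r n) v)" by blast
    obtain q where q: "strict_mono q" "incseq (\<lambda>n. s (r (q n)) v)"
      using nat_seq_incseq_subseq[of "\<lambda>n. s (r n) v"] by blast
    have "incseq (\<lambda>n. s (r (q n)) w)" if "w \<in> S" for w
      using r(2)[OF that] q(1) by (auto simp: incseq_def strict_mono_less_eq)
    moreover have "strict_mono (\<lambda>n. r (q n))" using r(1) q(1) by (simp add: strict_mono_def)
    ultimately show ?case using q(2) by (intro exI[of _ "\<lambda>n. r (q n)"]) auto
  qed
  then obtain r where r: "strict_mono r" "\<And>v. v \<in> S \<Longrightarrow> incseq (\<lambda>n. s (r n) v)" by blast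
  have "s (r 0) v \<le> s (r 1) v" for v
    using incseqD[OF r(2), of v 0 1] assms(2)[of v] by (cases "v \<in> S") auto
  moreover have "r 0 < r 1" using r(1) by (simp add: strict_mono_def)
  ultimately show ?thesis by (auto simp: le_fun_def)
qed

definition lower_set :: "('a \<Rightarrow> nat) set \<Rightarrow> bool" where
  "lower_set D \<longleftrightarrow> (\<forall>b\<in>D. \<forall>a\<le>b. a \<in> D)"

text \<open>If the chain kept shrinking, every drop would lose a point. By Dickson's lemma some lost
  point lies below a point that is still present later, so a lower set would have to contain it
  again.\<close>

lemma lower_sets_stabilise:
  fixes D :: "nat \<Rightarrow> ('a \<Rightarrow> nat) set"
  assumes "finite S" and supp: "\<And>n a v. a \<in> D n \<Longrightarrow> v \<notin> S \<Longrightarrow> a v = 0"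
    and lower: "\<And>n. lower_set (D n)" and anti: "\<And>m n. m \<le> n \<Longrightarrow> D n \<subseteq> D m"
  shows "\<exists>n0. \<forall>n\<ge>n0. D n = D n0"
proof (rule ccontr)
  assume "\<not> ?thesis"
  then have "\<exists>m\<ge>n. \<exists>b. b \<in> D n - D m" for n
    using anti by (metis DiffI subsetI subset_antisym)
  then obtain g b where g: "\<And>n. g n \<ge> n" "\<And>n. b n \<in> D n - D (g n)" by metis
  \<comment> \<open>Iterating \<open>g\<close> yields indices such that \<open>b (j m)\<close> is
    missing from \<open>D (j (Suc m))\<close>, hence from all later sets.\<close>
  define j where "j n = (g ^^ n) 0" for n
  have j: "j (Suc n) = g (j n)" for n by (simp add: j_def)
  have mono: "incseq j" by (rule incseq_SucI) (simp add: j g)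
  obtain m n where mn: "m < n" "b (j m) \<le> b (j n)"
    using dickson[OF assms(1), of "\<lambda>n. b (j n)"] supp g(2) by blast
  have "b (j n) \<in> D (j n)" using g(2) by blast
  also have "\<dots> \<subseteq> D (j (Suc m))" using mn mono by (intro anti) (auto simp: incseq_def)
  finally have "b (j m) \<in> D (j (Suc m))" using mn(2) lower unfolding lower_set_def by blast
  then show False using g(2)[of "j m"] by (simp add: j)
qed

section \<open>Functions that are eventually polynomial\<close>

definition eventually_poly :: "(nat \<Rightarrow> nat) \<Rightarrow> bool" where
  "eventually_poly h \<longleftrightarrow> (\<exists>p :: real poly. \<forall>\<^sub>F k in sequentially. real (h k) = poly p (real k))"

lemma eventually_polyI:
  "(\<And>k. k \<ge> N \<Longrightarrow> real (h k) = poly p (real k)) \<Longrightarrow> eventually_poly h"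
  unfolding eventually_poly_def eventually_sequentially by blast

lemma eventually_poly_cong:
  assumes "eventually_poly h" and "\<And>k. k \<ge> N \<Longrightarrow> h k = h' k"
  shows "eventually_poly h'"
proof -
  obtain p :: "real poly" and M where "\<And>k. k \<ge> M \<Longrightarrow> real (h k) = poly p (real k)"
    using assms(1) unfolding eventually_poly_def eventually_sequentially by blast
  then show ?thesis
    by (intro eventually_polyI[of "max M N" _ p]) (simp add: assms(2)[symmetric])
qed

lemma eventually_poly_const: "eventually_poly (\<lambda>_. c)"
  by (rule eventually_polyI[of 0 _ "[:real c:]"]) simp

lemma eventually_poly_add:
  assumes "eventually_poly h" "eventually_poly h'"
  shows "eventually_poly (\<lambda>k. h k + h' k)"
proof -
  obtain p q :: "real poly" and M N where "\<And>k. k \<ge> M \<Longrightarrow> real (h k) = poly p (real k)"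
    "\<And>k. k \<ge> N \<Longrightarrow> real (h' k) = poly q (real k)"
    using assms unfolding eventually_poly_def eventually_sequentially by blast
  then show ?thesis by (intro eventually_polyI[of "max M N" _ "p + q"]) auto
qed

lemma eventually_poly_sum:
  "(\<And>i. i \<in> A \<Longrightarrow> eventually_poly (h i)) \<Longrightarrow> eventually_poly (\<lambda>k. \<Sum>i\<in>A. h i k)"
  by (induction A rule: infinite_finite_induct)
     (auto intro: eventually_poly_const eventually_poly_add)

lemma eventually_poly_shift:
  assumes "eventually_poly h"
  shows "eventually_poly (\<lambda>k. h (k - j))"
proof -
  obtain p :: "real poly" and M where p: "\<And>k. k \<ge> M \<Longrightarrow> real (h k) = poly p (real k)"
    using assms unfolding eventually_poly_def eventually_sequentially by blast
  show ?thesis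
  proof (rule eventually_polyI[of "M + j" _ "pcompose p [:- real j, 1:]"])
    fix k assume "k \<ge> M + j"
    then show "real (h (k - j)) = poly (pcompose p [:- real j, 1:]) (real k)"
      by (simp add: p poly_pcompose of_nat_diff)
  qed
qed

text \<open>Telescoping (1 + i)^(n+1) - i^(n+1) and expanding by the binomial theorem gives a linear
  equation between the power sums up to order n; \<open>r\<close> solves it for the n-th
  one.\<close>

lemma power_sum_poly: "\<exists>q :: real poly. \<forall>k. (\<Sum>i\<le>k. real i ^ n) = poly q (real k)"
proof (induction n rule: less_induct)
  case (less n)
  then obtain q :: "nat \<Rightarrow> real poly"
    where q: "\<And>m k. m < n \<Longrightarrow> (\<Sum>i\<le>k. real i ^ m) = poly (q m) (real k)" by metis
  define r where "r = smult (1 / real (Suc n)) ([:1, 1:] ^ Suc n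
    - (\<Sum>m<n. smult (real (Suc n choose m)) (q m)))"
  have "(\<Sum>i\<le>k. real i ^ n) = poly r (real k)" for k
  proof -
    have "(1 + real k) ^ Suc n = (\<Sum>i\<le>k. (1 + real i) ^ Suc n - real i ^ Suc n)"
      by (induction k) auto
    also have "\<dots> = (\<Sum>i\<le>k. \<Sum>m\<le>n. real (Suc n choose m) * real i ^ m)"
    proof (rule sum.cong)
      fix i
      have "(1 + real i) ^ Suc n = (\<Sum>m\<le>Suc n. real (Suc n choose m) * real i ^ m)"
        using binomial_ring[of "real i" 1 "Suc n"] by (simp add: add.commute)
      then show "(1 + real i) ^ Suc n - real i ^ Suc n
          = (\<Sum>m\<le>n. real (Suc n choose m) * real i ^ m)" by simp
    qed simp
    also have "\<dots> = (\<Sum>m\<le>n. real (Suc n choose m) * (\<Sum>i\<le>k. real i ^ m))"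
      by (subst sum.swap) (simp add: sum_distrib_left)
    also have "\<dots> = (\<Sum>m<n. real (Suc n choose m) * poly (q m) (real k))
        + real (Suc n) * (\<Sum>i\<le>k. real i ^ n)"
      by (simp add: lessThan_Suc_atMost[symmetric] q[symmetric] del: sum.lessThan_Suc) simp
    finally have "real (Suc n) * (\<Sum>i\<le>k. real i ^ n)
        = (1 + real k) ^ Suc n - (\<Sum>m<n. real (Suc n choose m) * poly (q m) (real k))"
      by simp
    then show ?thesis
      by (simp add: r_def poly_sum field_simps del: of_nat_Suc power_Suc)
  qed
  then show ?case by blast
qed

lemma poly_sum_poly: "\<exists>q :: real poly. \<forall>k. (\<Sum>i\<le>k. poly p (real i)) = poly q (real k)"
proof -
  obtain q :: "nat \<Rightarrow> real poly"
    where q: "\<And>m k. (\<Sum>i\<le>k. real i ^ m) = poly (q m) (real k)" using power_sum_poly by metis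
  have "(\<Sum>i\<le>k. poly p (real i)) = poly (\<Sum>m\<le>degree p. smult (coeff p m) (q m)) (real k)" for k
    unfolding poly_altdef[of p] poly_sum
    by (subst sum.swap) (simp add: q[symmetric] sum_distrib_left)
  then show ?thesis by blast
qed

lemma eventually_poly_partial_sum:
  assumes "eventually_poly h"
  shows "eventually_poly (\<lambda>k. \<Sum>i\<le>k. h i)"
proof -
  obtain p :: "real poly" and M where p: "\<And>k. k \<ge> M \<Longrightarrow> real (h k) = poly p (real k)"
    using assms unfolding eventually_poly_def eventually_sequentially by blast
  obtain q :: "real poly" where q: "\<And>k. (\<Sum>i\<le>k. poly p (real i)) = poly q (real k)"
    using poly_sum_poly by blast
  \<comment> \<open>The finitely many values where \<open>h\<close> and \<open>p\<close> may
    disagree contribute a constant to all later partial sums.\<close>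
  define c where "c = (\<Sum>i<M. real (h i) - poly p (real i))"
  show ?thesis
  proof (rule eventually_polyI[of M _ "q + [:c:]"])
    fix k assume "k \<ge> M"
    have "(\<Sum>i\<le>k. real (h i) - poly p (real i)) = c" unfolding c_def
      by (rule sum.mono_neutral_right) (use \<open>k \<ge> M\<close> p in auto)
    then show "real (\<Sum>i\<le>k. h i) = poly (q + [:c:]) (real k)"
      by (simp add: sum_subtractf q[symmetric])
  qed
qed

lemma finite_bounded_exponents:
  assumes "finite S" shows "finite {a :: 'a \<Rightarrow> nat. (\<forall>v. v \<notin> S \<longrightarrow> a v = 0) \<and> sum a S \<le> k}"
proof (rule finite_subset)
  show "{a :: 'a \<Rightarrow> nat. (\<forall>v. v \<notin> S \<longrightarrow> a v = 0) \<and> sum a S \<le> k}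
      \<subseteq> {a. \<forall>v. (v \<in> S \<longrightarrow> a v \<in> {..k}) \<and> (v \<notin> S \<longrightarrow> a v = 0)}"
  proof clarsimp
    fix a :: "'a \<Rightarrow> nat" and v assume "sum a S \<le> k" "v \<in> S"
    then show "a v \<le> k" using member_le_sum[of v S a] assms by simp
  qed
  show "finite {a :: 'a \<Rightarrow> nat. \<forall>v. (v \<in> S \<longrightarrow> a v \<in> {..k}) \<and> (v \<notin> S \<longrightarrow> a v = 0)}"
    using finite_set_of_finite_funs[OF assms, of "{..k}" 0] by simp
qed

text \<open>
  Slicing along a variable gives a decreasing sequence of lower sets in one variable less, which
  stabilises.
\<close>

lemma lower_set_card_eventually_poly:
  fixes D :: "('a \<Rightarrow> nat) set"
  assumes "finite S" and "\<And>a v. a \<in> D \<Longrightarrow> v \<notin> S \<Longrightarrow> a v = 0" and "lower_set D"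
  shows "eventually_poly (\<lambda>k. card {a \<in> D. sum a S \<le> k})"
  using assms
proof (induction S arbitrary: D)
  case empty
  then show ?case using eventually_poly_const by simp
next
  case (insert v S)
  \<comment> \<open>The slice of \<open>D\<close> at a v = j, with the coordinate v reset to 0 so
    that its points are supported in \<open>S\<close>.\<close>
  define E where "E j = {a. a v = 0 \<and> a(v := j) \<in> D}" for j
  have suppE: "w \<notin> S \<Longrightarrow> a w = 0" if "a \<in> E j" for a w j
    using that insert.prems(1)[of "a(v := j)" w] by (cases "w = v") (auto simp: E_def simp del: fun_upd_apply simp: fun_upd_other)
  have lowerE: "lower_set (E j)" for j
    unfolding lower_set_def E_def
  proof safe
    fix b a :: "'a \<Rightarrow> nat" assume b: "b v = 0" "b(v := j) \<in> D" "a \<le> b"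
    show "a v = 0" using b le_funD[of a b v] by simp
    have "a(v := j) \<le> b(v := j)" using b(3) by (simp add: le_fun_def)
    then show "a(v := j) \<in> D" using b(2) insert.prems(2) unfolding lower_set_def by blast
  qed
  have antiE: "E n \<subseteq> E m" if "m \<le> n" for m n
  proof
    fix a assume a: "a \<in> E n"
    have "a(v := m) \<le> a(v := n)" using that by (simp add: le_fun_def)
    then show "a \<in> E m" using a insert.prems(2) unfolding lower_set_def E_def by blast
  qed
  obtain n0 where n0: "\<And>n. n \<ge> n0 \<Longrightarrow> E n = E n0"
    using lower_sets_stabilise[OF insert.hyps(1), of E] suppE lowerE antiE by blast
  define h where "h j k = card {a \<in> E j. sum a S \<le> k}" for j k
  have h: "eventually_poly (h j)" for j
    unfolding h_def by (rule insert.IH) (use suppE lowerE in blast)+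
  have fin: "finite {a \<in> E j. sum a S \<le> k}" for j k
    by (rule finite_subset[OF _ finite_bounded_exponents[OF insert.hyps(1), of k]]) (auto simp: suppE)
  have count: "card {a \<in> D. sum a (insert v S) \<le> k} = (\<Sum>j\<le>k. h j (k - j))" for k
  proof -
    have sumv: "sum (a(v := j)) (insert v S) = j + sum a S" for a :: "'a \<Rightarrow> nat" and j
    proof -
      have "sum (a(v := j)) S = sum a S" using insert.hyps by (intro sum.cong) auto
      then show ?thesis using insert.hyps by simp
    qed
    have sumv': "sum a (insert v S) = a v + sum (a(v := 0)) S" for a :: "'a \<Rightarrow> nat"
    proof -
      have "sum (a(v := 0)) S = sum a S" using insert.hyps by (intro sum.cong) auto
      then show ?thesis using insert.hyps by simp
    qed
    have "(\<Sum>j\<le>k. h j (k - j)) = card (SIGMA j:{..k}. {a \<in> E j. sum a S \<le> k - j})"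
      unfolding h_def by (rule card_SigmaI[symmetric]) (use fin in auto)
    also have "\<dots> = card {a \<in> D. sum a (insert v S) \<le> k}"
    proof (rule bij_betw_same_card, rule bij_betw_byWitness)
      let ?f = "\<lambda>(j, a). a(v := j)" and ?g = "\<lambda>a. (a v, a(v := 0 :: nat))"
      show "\<forall>p\<in>SIGMA j:{..k}. {a \<in> E j. sum a S \<le> k - j}. ?g (?f p) = p"
        by (auto simp: E_def)
      show "\<forall>a\<in>{a \<in> D. sum a (insert v S) \<le> k}. ?f (?g a) = a" by auto
      show "?f ` (SIGMA j:{..k}. {a \<in> E j. sum a S \<le> k - j}) \<subseteq> {a \<in> D. sum a (insert v S) \<le> k}"
        by (auto simp: E_def sumv simp del: sum.insert fun_upd_apply)
      show "?g ` {a \<in> D. sum a (insert v S) \<le> k} \<subseteq> (SIGMA j:{..k}. {a \<in> E j. sum a S \<le> k - j})"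
        by (auto simp: E_def sumv' simp del: sum.insert)
    qed
    finally show ?thesis by simp
  qed
  \<comment> \<open>The slices below \<open>n0\<close> are finitely many shifted terms; from
    \<open>n0\<close> on all slices agree, and their contributions form a partial sum of
    \<open>h n0\<close>.\<close>
  have "eventually_poly (\<lambda>k. (\<Sum>j<n0. h j (k - j)) + (\<Sum>i\<le>k - n0. h n0 i))"
    by (intro eventually_poly_add eventually_poly_sum eventually_poly_shift
        eventually_poly_shift[of "\<lambda>k. \<Sum>i\<le>k. h n0 i"] eventually_poly_partial_sum h)
  then show ?case
  proof (rule eventually_poly_cong[of _ n0])
    fix k assume k: "k \<ge> n0"
    have "(\<Sum>j\<le>k. h j (k - j)) = (\<Sum>j<n0. h j (k - j)) + (\<Sum>j\<in>{n0..k}. h j (k - j))"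
      using k by (subst sum.union_disjoint[symmetric]) (auto intro!: sum.cong)
    also have "(\<Sum>j\<in>{n0..k}. h j (k - j)) = (\<Sum>j\<in>{n0..k}. h n0 (k - j))"
    proof (rule sum.cong)
      fix j assume "j \<in> {n0..k}"
      then have "E j = E n0" by (intro n0) simp
      then show "h j (k - j) = h n0 (k - j)" by (simp add: h_def)
    qed simp
    also have "\<dots> = (\<Sum>i\<le>k - n0. h n0 i)"
      using k by (intro sum.reindex_bij_witness[of _ "\<lambda>i. k - i" "\<lambda>j. k - j"]) auto
    finally show "(\<Sum>j<n0. h j (k - j)) + (\<Sum>i\<le>k - n0. h n0 i)
        = card {a \<in> D. sum a (insert v S) \<le> k}" by (simp add: count)
  qed
qed

section \<open>Leading exponents and the Hilbert polynomial\<close>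

lemma finite_inj_nat: "\<exists>f :: 'a::finite \<Rightarrow> nat. inj f"
  using finite_imp_inj_to_nat_seg[OF finite_class.finite_UNIV] by blast

text \<open>Joins the exponents of the variables and of the derivations into one vector, so that
  both kinds of generators are handled by the same shift.\<close>

definition expo :: "('v \<Rightarrow> nat) \<times> ('v \<Rightarrow> nat) \<Rightarrow> 'v + 'v \<Rightarrow> nat" where
  "expo m = case_sum (fst m) (snd m)"

lemma expo_simps [simp]: "expo (a, b) (Inl v) = a v" "expo (a, b) (Inr v) = b v"
  by (simp_all add: expo_def)

lemma expo_inject: "expo m = expo n \<longleftrightarrow> m = n"
proof
  assume "expo m = expo n"
  then have "fst m v = fst n v" "snd m v = snd n v" for v
    by (metis expo_simps(1) prod.collapse, metis expo_simps(2) prod.collapse)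
  then show "m = n" by (simp add: prod_eq_iff fun_eq_iff)
qed simp

lemma sum_expo:
  fixes m :: "('v::finite \<Rightarrow> nat) \<times> ('v \<Rightarrow> nat)"
  shows "(\<Sum>u\<in>UNIV. expo m u) = (\<Sum>v\<in>UNIV. fst m v) + (\<Sum>v\<in>UNIV. snd m v)"
proof -
  have "(\<Sum>u\<in>UNIV <+> UNIV. expo m u) = (\<Sum>v\<in>UNIV. fst m v) + (\<Sum>v\<in>UNIV. snd m v)"
    by (subst sum.Plus) (simp_all add: expo_def)
  then show ?thesis by (simp only: UNIV_Plus_UNIV)
qed

definition mdeg :: "('v::finite \<Rightarrow> nat) \<times> ('v \<Rightarrow> nat) \<Rightarrow> nat" where
  "mdeg m = (\<Sum>u\<in>UNIV. expo m u)"

text \<open>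
  The degree-lexicographic order on exponents is read off from the leading coefficient order of
  \<open>int poly\<close>, so that additivity and totality come for free.
\<close>

definition var_index :: "'a::finite \<Rightarrow> nat" where
  "var_index = (SOME f. inj f)"

lemma var_index_eq_iff [simp]: "var_index u = var_index v \<longleftrightarrow> u = v"
  using someI_ex[OF finite_inj_nat] unfolding var_index_def[symmetric] by (auto dest: injD)

definition var_bound :: "'a::finite itself \<Rightarrow> nat" where
  "var_bound _ = Suc (Max (range (var_index :: 'a \<Rightarrow> nat)))"

lemma var_index_bound: "var_index (u :: 'a::finite) < var_bound TYPE('a)"
  by (simp add: var_bound_def less_Suc_eq_le)

text \<open>The total degree is placed above every variable index, so that it decides first. The
  coefficients below it record the single exponents, which makes the key injective.\<close>

definition exp_key :: "('a::finite \<Rightarrow> nat) \<Rightarrow> int poly" where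
  "exp_key e = monom (int (\<Sum>u\<in>UNIV. e u)) (var_bound TYPE('a))
     + (\<Sum>u\<in>UNIV. monom (int (e u)) (var_index u))"

lemma coeff_exp_key_index: "coeff (exp_key e) (var_index u) = int (e u)"
proof -
  have "coeff (exp_key e) (var_index u) = (\<Sum>w\<in>UNIV. if w = u then int (e w) else 0)"
    using var_index_bound[of u]
    by (simp add: exp_key_def coeff_sum)
  then show ?thesis by simp
qed

lemma coeff_exp_key_bound:
  fixes e :: "'a::finite \<Rightarrow> nat"
  assumes "n \<ge> var_bound TYPE('a)"
  shows "coeff (exp_key e) n = (if n = var_bound TYPE('a) then int (\<Sum>u\<in>UNIV. e u) else 0)"
proof -
  have "var_index (u :: 'a) \<noteq> n" for u using var_index_bound[of u] assms by simp
  then show ?thesis by (simp add: exp_key_def coeff_sum)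
qed

lemma exp_key_inject: "exp_key e = exp_key e' \<longleftrightarrow> e = e'"
proof
  assume "exp_key e = exp_key e'"
  then have "int (e u) = int (e' u)" for u by (metis coeff_exp_key_index)
  then show "e = e'" by auto
qed simp

lemma exp_key_add: "exp_key (\<lambda>u. e u + e' u) = exp_key e + exp_key e'"
  by (simp add: exp_key_def add_monom[symmetric] sum.distrib)

lemma exp_key_less:
  fixes e e' :: "'a::finite \<Rightarrow> nat"
  assumes "(\<Sum>u\<in>UNIV. e u) < (\<Sum>u\<in>UNIV. e' u)"
  shows "exp_key e < exp_key e'"
proof -
  let ?p = "exp_key e' - exp_key e" and ?N = "var_bound TYPE('a)"
  have pos: "coeff ?p ?N > 0" using assms by (simp add: coeff_exp_key_bound del: of_nat_sum)
  have "degree ?p \<le> ?N"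
    by (rule degree_le) (auto simp: coeff_exp_key_bound)
  moreover have "degree ?p \<ge> ?N" by (rule le_degree) (use pos in simp)
  ultimately have "degree ?p = ?N" by simp
  with pos have "pos_poly ?p" by (auto simp: pos_poly_def)
  then show ?thesis by (simp add: less_poly_def)
qed

abbreviation wkey :: "('v::finite \<Rightarrow> nat) \<times> ('v \<Rightarrow> nat) \<Rightarrow> int poly" where
  "wkey m \<equiv> exp_key (expo m)"

lemma wkey_inject:
  fixes m n :: "('v::finite \<Rightarrow> nat) \<times> ('v \<Rightarrow> nat)"
  shows "wkey m = wkey n \<longleftrightarrow> m = n"
  by (simp add: exp_key_inject expo_inject)

lemma wkey_less:
  fixes m n :: "('v::finite \<Rightarrow> nat) \<times> ('v \<Rightarrow> nat)"
  shows "mdeg m < mdeg n \<Longrightarrow> wkey m < wkey n"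
  unfolding mdeg_def by (rule exp_key_less)

lemma mdeg_mono:
  fixes m n :: "('v::finite \<Rightarrow> nat) \<times> ('v \<Rightarrow> nat)"
  shows "wkey m \<le> wkey n \<Longrightarrow> mdeg m \<le> mdeg n"
  unfolding not_less[symmetric] using wkey_less[of n m] by blast

definition lead_exp :: "'v::finite weyl \<Rightarrow> ('v \<Rightarrow> nat) \<times> ('v \<Rightarrow> nat)" where
  "lead_exp P = (SOME m. m \<in> weyl_supp P \<and> (\<forall>n\<in>weyl_supp P. wkey n \<le> wkey m))"

lemma weyl_supp_empty_iff: "weyl_supp P = {} \<longleftrightarrow> P = 0"
proof
  assume "weyl_supp P = {}"
  then show "P = 0" by (intro weyl_eqI) (auto simp: weyl_supp_def)
qed (simp add: weyl_supp_def)

lemma lead_exp: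
  assumes "P \<noteq> 0"
  shows "weyl_coeff P (lead_exp P) \<noteq> 0"
    and "weyl_coeff P n \<noteq> 0 \<Longrightarrow> wkey n \<le> wkey (lead_exp P)"
proof -
  have "\<exists>m. m \<in> weyl_supp P \<and> (\<forall>n\<in>weyl_supp P. wkey n \<le> wkey m)"
  proof -
    let ?K = "wkey ` weyl_supp P"
    have "finite ?K" "?K \<noteq> {}" using assms by (auto simp: weyl_supp_empty_iff)
    then have K: "Max ?K \<in> ?K" "\<And>k. k \<in> ?K \<Longrightarrow> k \<le> Max ?K" by simp_all
    from K(1) obtain m where "m \<in> weyl_supp P" "wkey m = Max ?K" by (rule imageE) simp
    then show ?thesis using K(2) by (intro exI[of _ m]) auto
  qed
  from someI_ex[OF this]
  have "lead_exp P \<in> weyl_supp P" "\<And>n. n \<in> weyl_supp P \<Longrightarrow> wkey n \<le> wkey (lead_exp P)"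
    unfolding lead_exp_def by blast+
  then show "weyl_coeff P (lead_exp P) \<noteq> 0"
    and "weyl_coeff P n \<noteq> 0 \<Longrightarrow> wkey n \<le> wkey (lead_exp P)"
    by (auto simp: weyl_supp_iff)
qed

lemma lead_expI:
  assumes "weyl_coeff P m \<noteq> 0" "\<And>n. weyl_coeff P n \<noteq> 0 \<Longrightarrow> wkey n \<le> wkey m"
  shows "lead_exp P = m"
proof -
  have "P \<noteq> 0" using assms(1) by auto
  then have "wkey (lead_exp P) = wkey m" using assms lead_exp[of P] by (intro antisym) auto
  then show ?thesis by (simp add: wkey_inject)
qed

lemma lead_exp_monom [simp]: "lead_exp (weyl_monom a b) = (a, b)"
proof (rule lead_expI)
  fix n assume "weyl_coeff (weyl_monom a b) n \<noteq> 0"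
  then have "n = (a, b)" by (simp split: if_splits)
  then show "wkey n \<le> wkey (a, b)" by simp
qed simp

section \<open>The Bernstein filtration and bases adapted to leading exponents\<close>

lemma bernstein_iff: "P \<in> bernstein k \<longleftrightarrow> (\<forall>m. weyl_coeff P m \<noteq> 0 \<longrightarrow> mdeg m \<le> k)"
  unfolding bernstein_def mdeg_def sum_expo weyl_supp_def Ball_def mem_Collect_eq case_prod_beta ..

lemma bernstein_lead_exp:
  assumes "P \<noteq> 0"
  shows "P \<in> bernstein k \<longleftrightarrow> mdeg (lead_exp P) \<le> k"
proof
  assume "P \<in> bernstein k"
  then show "mdeg (lead_exp P) \<le> k" using lead_exp(1)[OF assms] unfolding bernstein_iff by blast
next
  assume k: "mdeg (lead_exp P) \<le> k"
  show "P \<in> bernstein k" unfolding bernstein_iff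
  proof (intro allI impI)
    fix m assume "weyl_coeff P m \<noteq> 0"
    then have "mdeg m \<le> mdeg (lead_exp P)" by (intro mdeg_mono lead_exp(2)[OF assms])
    with k show "mdeg m \<le> k" by simp
  qed
qed

lemma subspace_bernstein: "weyl_vs.subspace (bernstein k)"
proof (rule weyl_vs.subspaceI)
  fix P Q :: "'a weyl" assume PQ: "P \<in> bernstein k" "Q \<in> bernstein k"
  show "P + Q \<in> bernstein k" unfolding bernstein_iff
  proof (intro allI impI)
    fix m assume "weyl_coeff (P + Q) m \<noteq> 0"
    then have "weyl_coeff P m \<noteq> 0 \<or> weyl_coeff Q m \<noteq> 0" by auto
    then show "mdeg m \<le> k" using PQ unfolding bernstein_iff by blast
  qed
qed (auto simp: bernstein_iff)

lemma finite_mdeg_le: "finite {m :: ('v::finite \<Rightarrow> nat) \<times> ('v \<Rightarrow> nat). mdeg m \<le> k}"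
proof (rule finite_imageD[of expo])
  show "finite (expo ` {m :: ('v \<Rightarrow> nat) \<times> ('v \<Rightarrow> nat). mdeg m \<le> k})"
    by (rule finite_subset[OF _ finite_bounded_exponents[of UNIV k]]) (auto simp: mdeg_def)
qed (simp add: inj_on_def expo_inject)

text \<open>Division with remainder: subtracting a multiple of \<open>b e\<close> removes the
  leading term of v without leaving \<open>V\<close>, and the process stops because \<open>V\<close>
  has only finitely many leading exponents.\<close>

lemma reduction_spans:
  assumes V: "weyl_vs.subspace V" and fin: "finite (lead_exp ` (V - {0}))"
    and b: "\<And>e. e \<in> lead_exp ` (V - {0}) \<Longrightarrow> b e \<in> V \<and> b e \<noteq> 0 \<and> lead_exp (b e) = e"
    and "v \<in> V"
  shows "v \<in> weyl_vs.span (b ` (lead_exp ` (V - {0})))"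
proof -
  define E where "E = lead_exp ` (V - {0})"
  note b = b[folded E_def] and fin = fin[folded E_def]
  have "v \<in> weyl_vs.span (b ` E)" using \<open>v \<in> V\<close>
  proof (induction "card {e \<in> E. wkey e < wkey (lead_exp v)}" arbitrary: v rule: less_induct)
    case (less v)
    show ?case
    proof (cases "v = 0")
      case False
      define e where "e = lead_exp v"
      have e: "e \<in> E" using False less.prems by (auto simp: e_def E_def)
      define c where "c = weyl_coeff v e / weyl_coeff (b e) e"
      define w where "w = v - weyl_scale c (b e)"
      have be: "weyl_coeff (b e) e \<noteq> 0" using lead_exp(1)[of "b e"] b[OF e] by auto
      have wV: "w \<in> V" unfolding w_def using less.prems b[OF e] V
        by (intro weyl_vs.subspace_diff weyl_vs.subspace_scale) auto
      have "w \<in> weyl_vs.span (b ` E)"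
      proof (cases "w = 0")
        case w: False
        have "wkey (lead_exp w) \<le> wkey e"
        proof (cases "weyl_coeff v (lead_exp w) = 0")
          case True
          then have "weyl_coeff (b e) (lead_exp w) \<noteq> 0" using lead_exp(1)[OF w] by (auto simp: w_def)
          then show ?thesis using lead_exp(2)[of "b e" "lead_exp w"] b[OF e] by auto
        qed (use lead_exp(2)[OF False] in \<open>auto simp: e_def\<close>)
        moreover have "lead_exp w \<noteq> e"
          using lead_exp(1)[OF w] be by (auto simp: w_def c_def)
        ultimately have lt: "wkey (lead_exp w) < wkey e"
          by (metis le_neq_trans wkey_inject)
        have "lead_exp w \<in> E" using w wV by (auto simp: E_def)
        then have "{e' \<in> E. wkey e' < wkey (lead_exp w)} \<subset> {e' \<in> E. wkey e' < wkey e}"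
        proof (intro psubsetI subsetI)
          show "{e' \<in> E. wkey e' < wkey (lead_exp w)} \<noteq> {e' \<in> E. wkey e' < wkey e}"
            using \<open>lead_exp w \<in> E\<close> lt by blast
        qed (use lt in auto)
        then have "card {e' \<in> E. wkey e' < wkey (lead_exp w)} < card {e' \<in> E. wkey e' < wkey e}"
          by (rule psubset_card_mono[rotated]) (use fin in simp)
        then show ?thesis using less.hyps wV by (simp add: e_def)
      qed (simp add: weyl_vs.span_zero)
      moreover have "weyl_scale c (b e) \<in> weyl_vs.span (b ` E)"
        using e by (intro weyl_vs.span_scale weyl_vs.span_base) auto
      ultimately have "w + weyl_scale c (b e) \<in> weyl_vs.span (b ` E)" by (rule weyl_vs.span_add)
      then show ?thesis by (simp add: w_def)
    qed (simp add: weyl_vs.span_zero)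
  qed
  then show ?thesis by (simp add: E_def)
qed

text \<open>Elements with distinct leading exponents are independent, and reduction shows that they span.\<close>

lemma dim_eq_card_lead_exp:
  assumes V: "weyl_vs.subspace V" and fin: "finite (lead_exp ` (V - {0}))"
  shows "weyl_vs.dim V = card (lead_exp ` (V - {0}))"
    and "\<exists>B. finite B \<and> B \<subseteq> V \<and> weyl_vs.independent B \<and> weyl_vs.span B = V"
proof -
  let ?E = "lead_exp ` (V - {0})"
  obtain b where b: "\<And>e. e \<in> ?E \<Longrightarrow> b e \<in> V \<and> b e \<noteq> 0 \<and> lead_exp (b e) = e"
    using bchoice[of ?E "\<lambda>e P. P \<in> V \<and> P \<noteq> 0 \<and> lead_exp P = e"] by fastforce
  have inj: "inj_on b ?E" by (rule inj_onI) (metis b)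
  have "weyl_vs.independent (b ` ?E)"
  proof
    assume "weyl_vs.dependent (b ` ?E)"
    then obtain u v where v: "v \<in> b ` ?E" "u v \<noteq> 0"
      and zero: "(\<Sum>v\<in>b ` ?E. weyl_scale (u v) v) = 0"
      using weyl_vs.dependent_finite[of "b ` ?E"] fin by blast
    \<comment> \<open>At the largest exponent that takes part in the relation only one summand has a
      nonzero coefficient, so the relation cannot vanish there.\<close>
    let ?A = "{e \<in> ?E. u (b e) \<noteq> 0}"
    have "finite (wkey ` ?A)" "wkey ` ?A \<noteq> {}" using fin v by auto
    then have A: "Max (wkey ` ?A) \<in> wkey ` ?A" "\<And>k. k \<in> wkey ` ?A \<Longrightarrow> k \<le> Max (wkey ` ?A)" by simp_all
    from A(1) obtain e where "e \<in> ?A" "wkey e = Max (wkey ` ?A)" by (rule imageE) simp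
    then have e: "e \<in> ?A" "\<And>e'. e' \<in> ?A \<Longrightarrow> wkey e' \<le> wkey e" using A(2) by auto
    have "0 = weyl_coeff (\<Sum>e\<in>?E. weyl_scale (u (b e)) (b e)) e"
      using zero by (simp add: sum.reindex[OF inj] del: weyl_coeff_sum)
    also have "\<dots> = (\<Sum>e'\<in>?E. if e' = e then u (b e) * weyl_coeff (b e) e else 0)"
      unfolding weyl_coeff_sum
    proof (rule sum.cong)
      fix e' assume e': "e' \<in> ?E"
      show "weyl_coeff (weyl_scale (u (b e')) (b e')) e
        = (if e' = e then u (b e) * weyl_coeff (b e) e else 0)"
      proof (cases "e' = e \<or> u (b e') = 0")
        case False
        then have "wkey e' \<le> wkey e" using e' e by auto
        with False have "\<not> wkey e \<le> wkey e'" by (metis antisym wkey_inject)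
        then have "weyl_coeff (b e') e = 0" using lead_exp(2)[of "b e'" e] b[OF e'] by auto
        then show ?thesis using False by simp
      qed auto
    qed simp
    also have "\<dots> = u (b e) * weyl_coeff (b e) e" using fin e by simp
    finally show False using e(1) b[of e] lead_exp(1)[of "b e"] by auto
  qed
  moreover have "v \<in> V \<Longrightarrow> v \<in> weyl_vs.span (b ` ?E)" for v
    using reduction_spans[OF V fin, of b v] b by blast
  moreover have bV: "b ` ?E \<subseteq> V" using b by blast
  moreover have "weyl_vs.span (b ` ?E) \<subseteq> V" using bV V by (rule weyl_vs.span_minimal)
  ultimately have B: "weyl_vs.independent (b ` ?E)" "weyl_vs.span (b ` ?E) = V" by auto
  then show "\<exists>B. finite B \<and> B \<subseteq> V \<and> weyl_vs.independent B \<and> weyl_vs.span B = V"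
    using fin bV by blast
  have "weyl_vs.dim V = card (b ` ?E)" using B weyl_vs.dim_span_eq_card_independent by metis
  then show "weyl_vs.dim V = card ?E" using card_image[OF inj] by simp
qed

lemma lead_exp_bernstein_Int:
  "lead_exp ` (bernstein k \<inter> V - {0}) = {m \<in> lead_exp ` (V - {0}). mdeg m \<le> k}"
proof (intro equalityI subsetI)
  fix m assume "m \<in> lead_exp ` (bernstein k \<inter> V - {0})"
  then obtain P where "P \<in> bernstein k" "P \<in> V" "P \<noteq> 0" "m = lead_exp P" by blast
  then show "m \<in> {m \<in> lead_exp ` (V - {0}). mdeg m \<le> k}" using bernstein_lead_exp[of P k] by simp
next
  fix m assume "m \<in> {m \<in> lead_exp ` (V - {0}). mdeg m \<le> k}"
  then obtain P where P: "P \<in> V" "P \<noteq> 0" "m = lead_exp P" "mdeg m \<le> k" by blast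
  then have "P \<in> bernstein k" using bernstein_lead_exp[of P k] by simp
  with P show "m \<in> lead_exp ` (bernstein k \<inter> V - {0})" by blast
qed

lemma dim_bernstein_Int:
  assumes "weyl_vs.subspace V"
  shows "weyl_vs.dim (bernstein k \<inter> V) = card {m \<in> lead_exp ` (V - {0}). mdeg m \<le> k}"
    and "\<exists>B. finite B \<and> B \<subseteq> bernstein k \<inter> V \<and> weyl_vs.independent B \<and> weyl_vs.span B = bernstein k \<inter> V"
proof -
  have *: "weyl_vs.subspace (bernstein k \<inter> V)" "finite (lead_exp ` (bernstein k \<inter> V - {0}))"
    using assms subspace_bernstein
    by (auto simp: lead_exp_bernstein_Int intro!: weyl_vs.subspace_inter finite_subset[OF _ finite_mdeg_le[of k]])
  from dim_eq_card_lead_exp(1)[OF *]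
  show "weyl_vs.dim (bernstein k \<inter> V) = card {m \<in> lead_exp ` (V - {0}). mdeg m \<le> k}"
    by (simp add: lead_exp_bernstein_Int)
  from dim_eq_card_lead_exp(2)[OF *]
  show "\<exists>B. finite B \<and> B \<subseteq> bernstein k \<inter> V \<and> weyl_vs.independent B \<and> weyl_vs.span B = bernstein k \<inter> V" .
qed

lemma weyl_monom_nonzero: "weyl_monom a b \<noteq> 0"
proof
  assume "weyl_monom a b = 0"
  then have "weyl_supp (weyl_monom a b) = weyl_supp 0" by (simp only:)
  then show False by (simp add: weyl_supp_def[of 0] del: split_paired_Ex split_paired_All)
qed

lemma dim_bernstein:
  "weyl_vs.dim (bernstein k :: 'v::finite weyl set) = card {m :: ('v \<Rightarrow> nat) \<times> ('v \<Rightarrow> nat). mdeg m \<le> k}"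
proof -
  have mem: "(a, b) \<in> lead_exp ` (UNIV - {0 :: 'v weyl})" for a b
  proof -
    show ?thesis by (intro image_eqI[of _ _ "weyl_monom a b"]) (simp_all add: weyl_monom_nonzero)
  qed
  have "lead_exp ` (UNIV - {0 :: 'v weyl}) = UNIV"
  proof (intro equalityI subsetI)
    fix m :: "('v \<Rightarrow> nat) \<times> ('v \<Rightarrow> nat)"
    show "m \<in> lead_exp ` (UNIV - {0 :: 'v weyl})" using mem by (cases m) blast
  qed simp
  then show ?thesis using dim_bernstein_Int(1)[of "UNIV :: 'v weyl set" k] by simp
qed

lemma left_ideal_subspace:
  assumes "left_ideal I" shows "weyl_vs.subspace I"
proof -
  have "weyl_scale c P \<in> I" if "P \<in> I" for c P
  proof -
    have "weyl_scale c P = weyl_scale c 1 * P" by (simp add: weyl_scale_times_left)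
    then show ?thesis using assms that by (simp add: left_ideal_def)
  qed
  then show ?thesis using assms by (simp add: left_ideal_def weyl_vs.subspace_def)
qed

text \<open>Macaulay's count: the quotient has as many dimensions as there are exponents that lead
  no element of \<open>I\<close>.\<close>

lemma hilbert_fun_eq_card:
  fixes I :: "'v::finite weyl set"
  assumes "weyl_vs.subspace I"
  shows "hilbert_fun I k = card {m. m \<notin> lead_exp ` (I - {0}) \<and> mdeg m \<le> k}"
proof -
  let ?L = "{m \<in> lead_exp ` (I - {0}). mdeg m \<le> k}"
  have "hilbert_fun I k = card {m :: ('v \<Rightarrow> nat) \<times> ('v \<Rightarrow> nat). mdeg m \<le> k} - card ?L"
    by (simp add: hilbert_fun_def dim_bernstein dim_bernstein_Int(1)[OF assms])
  also have "\<dots> = card ({m. mdeg m \<le> k} - ?L)"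
    by (rule card_Diff_subset[symmetric]) (auto intro: finite_subset[OF _ finite_mdeg_le[of k]])
  also have "{m. mdeg m \<le> k} - ?L = {m. m \<notin> lead_exp ` (I - {0}) \<and> mdeg m \<le> k}" by auto
  finally show ?thesis .
qed

lemma expo_upd: "expo (a(i := x), b) = (expo (a, b))(Inl i := x)"
    "expo (a, b(i := x)) = (expo (a, b))(Inr i := x)"
  by (auto simp: fun_eq_iff expo_def split: sum.split)

lemma exp_key_Suc: "exp_key (e(u := Suc (e u))) = exp_key e + exp_key ((\<lambda>_. 0)(u := 1))"
proof -
  have "e(u := Suc (e u)) = (\<lambda>w. e w + ((\<lambda>_. 0)(u := 1)) w)" by auto
  then show ?thesis by (simp only: exp_key_add)
qed

lemma weyl_linear_expand:
  fixes P :: "'a weyl"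
  assumes add: "\<And>P Q. h (P + Q) = h P + h Q" and scale: "\<And>c P. h (weyl_scale c P) = weyl_scale c (h P)"
  shows "h P = (\<Sum>m\<in>weyl_supp P. weyl_scale (weyl_coeff P m) (h (weyl_monom (fst m) (snd m))))"
proof -
  have h0: "h 0 = 0" using scale[of 0 0] by simp
  have "h (sum f A) = (\<Sum>m\<in>A. h (f m))" for f :: "('a \<Rightarrow> nat) \<times> ('a \<Rightarrow> nat) \<Rightarrow> _" and A
    by (induction A rule: infinite_finite_induct) (simp_all add: add h0)
  then have "h (\<Sum>m\<in>weyl_supp P. weyl_scale (weyl_coeff P m) (weyl_monom (fst m) (snd m)))
      = (\<Sum>m\<in>weyl_supp P. weyl_scale (weyl_coeff P m) (h (weyl_monom (fst m) (snd m))))"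
    by (simp add: scale)
  then show ?thesis using weyl_expand[of P] by metis
qed

text \<open>
  Multiplication by \<open>x\<^sub>i\<close> or \<open>\<partial>\<^sub>i\<close> shifts the leading exponent, because the correction terms of the
  Leibniz rule have lower degree.
\<close>

lemma lead_exp_mult_generator:
  fixes G P :: "'v::finite weyl"
  assumes G: "\<And>a b. \<exists>R. G * weyl_monom a b = weyl_monom (fst (sh (a, b))) (snd (sh (a, b))) + R \<and>
      (\<forall>n. weyl_coeff R n \<noteq> 0 \<longrightarrow> mdeg n < mdeg (sh (a, b)))"
    and sh: "\<And>m. expo (sh m) = (expo m)(u := Suc (expo m u))"
    and "P \<noteq> 0"
  shows "G * P \<noteq> 0" "lead_exp (G * P) = sh (lead_exp P)"
proof -
  let ?e = "lead_exp P"
  have key: "wkey (sh m) = wkey m + exp_key ((\<lambda>_. 0)(u := 1))" for m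
    by (simp only: sh exp_key_Suc)
  have sh_inj: "sh m = sh n \<longleftrightarrow> m = n" for m n by (metis key add_right_cancel wkey_inject)
  have GP: "weyl_coeff (G * P) n
      = (\<Sum>m\<in>weyl_supp P. weyl_coeff P m * weyl_coeff (G * weyl_monom (fst m) (snd m)) n)" for n
    using arg_cong[OF weyl_linear_expand[of "\<lambda>P. G * P" P], of "\<lambda>Q. weyl_coeff Q n"]
    by (simp add: distrib_left weyl_scale_times_right)
  have le: "wkey n \<le> wkey (sh m)" "n \<noteq> sh m \<Longrightarrow> wkey n < wkey (sh m)"
    if "weyl_coeff (G * weyl_monom (fst m) (snd m)) n \<noteq> 0" for m n
  proof -
    obtain R where R: "G * weyl_monom (fst m) (snd m) = weyl_monom (fst (sh m)) (snd (sh m)) + R"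
      "\<And>n. weyl_coeff R n \<noteq> 0 \<Longrightarrow> mdeg n < mdeg (sh m)"
      using G[of "fst m" "snd m"] by auto
    have "n = sh m \<or> weyl_coeff R n \<noteq> 0" using that unfolding R by (auto split: if_splits)
    then show "wkey n \<le> wkey (sh m)" "n \<noteq> sh m \<Longrightarrow> wkey n < wkey (sh m)"
      using wkey_less[of n "sh m"] R(2)[of n] by auto
  qed
  have "weyl_coeff (G * P) (sh ?e)
      = (\<Sum>m\<in>weyl_supp P. if m = ?e then weyl_coeff P ?e else 0)"
    unfolding GP
  proof (rule sum.cong)
    fix m assume m: "m \<in> weyl_supp P"
    show "weyl_coeff P m * weyl_coeff (G * weyl_monom (fst m) (snd m)) (sh ?e)
      = (if m = ?e then weyl_coeff P ?e else 0)"
    proof (cases "m = ?e")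
      case True
      obtain R where R: "G * weyl_monom (fst m) (snd m) = weyl_monom (fst (sh m)) (snd (sh m)) + R"
        "\<And>n. weyl_coeff R n \<noteq> 0 \<Longrightarrow> mdeg n < mdeg (sh m)"
        using G[of "fst m" "snd m"] by auto
      then have "weyl_coeff R (sh m) = 0" by blast
      then show ?thesis using True R(1) by simp
    next
      case False
      have "wkey m \<le> wkey ?e" using lead_exp(2)[OF \<open>P \<noteq> 0\<close>, of m] m by (simp add: weyl_supp_def)
      then have "wkey (sh m) \<le> wkey (sh ?e)" by (simp add: key)
      then have "weyl_coeff (G * weyl_monom (fst m) (snd m)) (sh ?e) = 0"
        using le(2)[of m "sh ?e"] False sh_inj by (metis not_less)
      then show ?thesis using False by simp
    qed
  qed simp
  also have "\<dots> = weyl_coeff P ?e"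
    using lead_exp(1)[OF \<open>P \<noteq> 0\<close>] by (simp add: weyl_supp_iff)
  finally have lc: "weyl_coeff (G * P) (sh ?e) \<noteq> 0" using lead_exp(1)[OF \<open>P \<noteq> 0\<close>] by simp
  then show "G * P \<noteq> 0" by auto
  show "lead_exp (G * P) = sh ?e"
  proof (rule lead_expI[OF lc])
    fix n assume "weyl_coeff (G * P) n \<noteq> 0"
    then obtain m where "weyl_coeff P m * weyl_coeff (G * weyl_monom (fst m) (snd m)) n \<noteq> 0"
      unfolding GP by (rule sum.not_neutral_contains_not_neutral)
    then have m: "weyl_coeff P m \<noteq> 0" "weyl_coeff (G * weyl_monom (fst m) (snd m)) n \<noteq> 0"
      by auto
    have "wkey n \<le> wkey (sh m)" using le m by blast
    also have "\<dots> \<le> wkey (sh ?e)" using lead_exp(2)[OF \<open>P \<noteq> 0\<close> m(1)] by (simp add: key)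
    finally show "wkey n \<le> wkey (sh ?e)" .
  qed
qed

lemma mdeg_Suc: "expo n = (expo m)(u := Suc (expo m u)) \<Longrightarrow> mdeg n = Suc (mdeg m)"
proof -
  assume n: "expo n = (expo m)(u := Suc (expo m u))"
  have "(\<Sum>w\<in>UNIV - {u}. expo n w) = (\<Sum>w\<in>UNIV - {u}. expo m w)"
    by (rule sum.cong) (auto simp: n)
  then show ?thesis using n by (simp add: mdeg_def sum.remove[of UNIV u])
qed

lemma lead_exp_x_mult:
  assumes "P \<noteq> 0"
  shows "weyl_x i * P \<noteq> 0"
    "expo (lead_exp (weyl_x i * P)) = (expo (lead_exp P))(Inl i := Suc (expo (lead_exp P) (Inl i)))"
proof -
  let ?sh = "\<lambda>(a, b). (a(i := Suc (a i)), b)"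
  have G: "\<exists>R. weyl_x i * weyl_monom a b = weyl_monom (fst (?sh (a, b))) (snd (?sh (a, b))) + R \<and>
      (\<forall>n. weyl_coeff R n \<noteq> 0 \<longrightarrow> mdeg n < mdeg (?sh (a, b)))" for a b
    by (rule exI[of _ 0]) (simp add: weyl_x_monom)
  have sh: "expo (?sh m) = (expo m)(Inl i := Suc (expo m (Inl i)))" for m
    by (cases m) (simp add: expo_upd)
  note * = lead_exp_mult_generator[OF G sh assms]
  show "weyl_x i * P \<noteq> 0" by (rule *(1))
  show "expo (lead_exp (weyl_x i * P)) = (expo (lead_exp P))(Inl i := Suc (expo (lead_exp P) (Inl i)))"
    unfolding *(2) by (rule sh)
qed

lemma mdeg_decr_le: "mdeg (a(i := a i - 1), b) \<le> mdeg (a, b)"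
  unfolding mdeg_def expo_upd by (intro sum_mono) auto

lemma lead_exp_d_mult:
  assumes "P \<noteq> 0"
  shows "weyl_d i * P \<noteq> 0"
    "expo (lead_exp (weyl_d i * P)) = (expo (lead_exp P))(Inr i := Suc (expo (lead_exp P) (Inr i)))"
proof -
  let ?sh = "\<lambda>(a, b). (a, b(i := Suc (b i)))"
  have sh: "expo (?sh m) = (expo m)(Inr i := Suc (expo m (Inr i)))" for m
    by (cases m) (simp add: expo_upd)
  have G: "\<exists>R. weyl_d i * weyl_monom a b = weyl_monom (fst (?sh (a, b))) (snd (?sh (a, b))) + R \<and>
      (\<forall>n. weyl_coeff R n \<noteq> 0 \<longrightarrow> mdeg n < mdeg (?sh (a, b)))" for a b
  proof (intro exI conjI allI impI)
    show "weyl_d i * weyl_monom a b = weyl_monom (fst (?sh (a, b))) (snd (?sh (a, b)))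
        + weyl_scale (of_nat (a i)) (weyl_monom (a(i := a i - 1)) b)"
      by (simp add: weyl_d_monom)
    fix n assume "weyl_coeff (weyl_scale (of_nat (a i)) (weyl_monom (a(i := a i - 1)) b)) n \<noteq> 0"
    then have "n = (a(i := a i - 1), b)" by (auto split: if_splits)
    then have "mdeg n \<le> mdeg (a, b)" by (simp add: mdeg_decr_le del: One_nat_def)
    also have "\<dots> < mdeg (?sh (a, b))" using mdeg_Suc[OF sh, of "(a, b)"] by simp
    finally show "mdeg n < mdeg (?sh (a, b))" .
  qed
  note * = lead_exp_mult_generator[OF G sh assms]
  show "weyl_d i * P \<noteq> 0" by (rule *(1))
  show "expo (lead_exp (weyl_d i * P)) = (expo (lead_exp P))(Inr i := Suc (expo (lead_exp P) (Inr i)))"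
    unfolding *(2) by (rule sh)
qed

lemma lower_setI_step:
  fixes D :: "('a::finite \<Rightarrow> nat) set"
  assumes step: "\<And>a u. a(u := Suc (a u)) \<in> D \<Longrightarrow> a \<in> D"
  shows "lower_set D"
  unfolding lower_set_def
proof (intro ballI allI impI)
  fix b a assume "b \<in> D" "a \<le> b"
  then show "a \<in> D"
  proof (induction "\<Sum>u\<in>UNIV. b u - a u" arbitrary: b rule: less_induct)
    case less
    show ?case
    proof (cases "a = b")
      case False
      then obtain u where u: "a u \<noteq> b u" by blast
      then have lt: "a u < b u" using le_funD[OF less.prems(2), of u] by simp
      define c where "c = b(u := b u - 1)"
      have "c(u := Suc (c u)) = b" using lt by (auto simp: c_def)
      then have "c \<in> D" using step less.prems(1) by metis
      moreover have "a \<le> c" using lt less.prems(2) by (auto simp: c_def le_fun_def)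
      moreover have "(\<Sum>u\<in>UNIV. c u - a u) < (\<Sum>u\<in>UNIV. b u - a u)"
        using lt by (intro sum_strict_mono_ex1) (auto simp: c_def intro!: exI[of _ u])
      ultimately show ?thesis using less.hyps by blast
    qed (use less in simp)
  qed
qed

text \<open>A left ideal is closed under left multiplication by x_i and d_i, so its leading
  exponents are closed under raising a coordinate. The remaining exponents therefore form a lower
  set, and lower sets have been counted.\<close>

theorem hilbert_fun_eventually_poly:
  fixes I :: "'v::finite weyl set"
  assumes "left_ideal I"
  shows "eventually_poly (hilbert_fun I)"
proof -
  define L where "L = lead_exp ` (I - {0})"
  let ?D = "expo ` (- L)"
  have surj: "\<exists>m. expo m = e" for e :: "'v + 'v \<Rightarrow> nat"
    by (rule exI[of _ "(\<lambda>v. e (Inl v), \<lambda>v. e (Inr v))"]) (auto simp: expo_def fun_eq_iff split: sum.split)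
  have up: "n \<in> L" if "m \<in> L" "expo n = (expo m)(u := Suc (expo m u))" for m n u
  proof -
    obtain P where P: "P \<in> I" "P \<noteq> 0" "m = lead_exp P" using \<open>m \<in> L\<close> by (auto simp: L_def)
    have "\<exists>Q\<in>I. Q \<noteq> 0 \<and> expo (lead_exp Q) = expo n"
    proof (cases u)
      case (Inl i)
      show ?thesis using lead_exp_x_mult[OF P(2), of i] P that(2) Inl assms
        by (intro bexI[of _ "weyl_x i * P"]) (auto simp: left_ideal_def)
    next
      case (Inr i)
      show ?thesis using lead_exp_d_mult[OF P(2), of i] P that(2) Inr assms
        by (intro bexI[of _ "weyl_d i * P"]) (auto simp: left_ideal_def)
    qed
    then show ?thesis by (auto simp: L_def expo_inject)
  qed
  have "lower_set ?D"
  proof (rule lower_setI_step)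
    fix a u assume "a(u := Suc (a u)) \<in> ?D"
    then obtain n where n: "n \<notin> L" "expo n = a(u := Suc (a u))" by auto
    obtain m where m: "expo m = a" using surj by blast
    then have "m \<notin> L" using up n by metis
    then show "a \<in> ?D" using m by blast
  qed
  then have "eventually_poly (\<lambda>k. card {a \<in> ?D. sum a UNIV \<le> k})"
    by (intro lower_set_card_eventually_poly) auto
  also have "(\<lambda>k. card {a \<in> ?D. sum a UNIV \<le> k}) = hilbert_fun I"
  proof
    fix k
    have "{a \<in> ?D. sum a UNIV \<le> k} = expo ` {m. m \<notin> L \<and> mdeg m \<le> k}" by (auto simp: mdeg_def)
    then have "card {a \<in> ?D. sum a UNIV \<le> k} = card {m. m \<notin> L \<and> mdeg m \<le> k}"
      by (simp add: card_image inj_on_def expo_inject)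
    then show "card {a \<in> ?D. sum a UNIV \<le> k} = hilbert_fun I k"
      by (simp add: hilbert_fun_eq_card[OF left_ideal_subspace[OF assms]] L_def)
  qed
  finally show ?thesis .
qed

section \<open>Bernstein's inequality\<close>

lemma weyl_monom_x:
  "weyl_monom a b * weyl_x i =
     weyl_x i * weyl_monom a b + weyl_scale (of_nat (b i)) (weyl_monom a (b(i := b i - 1)))"
proof (induction "(\<Sum>v\<in>UNIV. a v) + (\<Sum>v\<in>UNIV. b v)" arbitrary: a b rule: less_induct)
  case less
  have dec: "(\<Sum>v\<in>UNIV. (c(j := c j - 1)) v) < (\<Sum>v\<in>UNIV. c v)" if "c j \<noteq> 0" for c :: "'a \<Rightarrow> nat" and j
    by (rule sum_strict_mono_ex1) (use that in \<open>auto intro!: exI[of _ j]\<close>)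
  show ?case
  proof (cases "\<exists>j. a j \<noteq> 0")
    case True
    then obtain j where j: "a j \<noteq> 0" by blast
    define c where "c = a(j := a j - 1)"
    have a: "weyl_monom a b' = weyl_x j * weyl_monom c b'" for b'
      using j by (simp add: weyl_x_monom c_def)
    have IH: "weyl_monom c b * weyl_x i =
        weyl_x i * weyl_monom c b + weyl_scale (of_nat (b i)) (weyl_monom c (b(i := b i - 1)))"
      by (rule less) (use dec[of a, OF j] in \<open>simp add: c_def\<close>)
    show ?thesis
      unfolding a mult.assoc IH
      by (simp add: distrib_left weyl_scale_times_right) (metis mult.assoc weyl_x_commute)
  next
    case False
    then have a: "a = (\<lambda>_. 0)" by auto
    show ?thesis
    proof (cases "\<exists>j. b j \<noteq> 0")
      case True
      then obtain j where j: "b j \<noteq> 0" by blast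
      define c where "c = b(j := b j - 1)"
      have b: "b = c(j := Suc (c j))" using j by (auto simp: c_def)
      have dm: "weyl_d j * weyl_monom a c' = weyl_monom a (c'(j := Suc (c' j)))" for c'
        by (simp add: weyl_d_monom a)
      have IH: "weyl_monom a c * weyl_x i =
          weyl_x i * weyl_monom a c + weyl_scale (of_nat (c i)) (weyl_monom a (c(i := c i - 1)))"
        by (rule less) (use dec[of b, OF j] in \<open>simp add: c_def\<close>)
      have "weyl_monom a b * weyl_x i = weyl_d j * (weyl_monom a c * weyl_x i)"
        by (simp add: b dm flip: mult.assoc)
      also have "\<dots> = weyl_d j * weyl_x i * weyl_monom a c
          + weyl_scale (of_nat (c i)) (weyl_d j * weyl_monom a (c(i := c i - 1)))"
        by (simp add: IH distrib_left weyl_scale_times_right mult.assoc)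
      also have "weyl_d j * weyl_x i * weyl_monom a c
          = weyl_x i * weyl_monom a b + (if j = i then weyl_monom a c else 0)"
        by (simp add: weyl_d_x distrib_right mult.assoc dm b)
      also have "weyl_d j * weyl_monom a (c(i := c i - 1)) =
          weyl_monom a ((c(i := c i - 1))(j := Suc ((c(i := c i - 1)) j)))" by (rule dm)
      finally have eq: "weyl_monom a b * weyl_x i = weyl_x i * weyl_monom a b
          + (if j = i then weyl_monom a c else 0) + weyl_scale (of_nat (c i))
          (weyl_monom a ((c(i := c i - 1))(j := Suc ((c(i := c i - 1)) j))))" .
      show ?thesis
      proof (cases "j = i")
        case True
        then have "weyl_scale (of_nat (c i)) (weyl_monom a ((c(i := c i - 1))(j := Suc ((c(i := c i - 1)) j))))
            = weyl_scale (of_nat (c i)) (weyl_monom a c)"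
          by (cases "c i") (auto simp: fun_upd_idem)
        moreover have "b(i := b i - 1) = c" "b i = Suc (c i)" using True b by auto
        ultimately show ?thesis
          unfolding eq using True by (simp add: weyl_vs.scale_left_distrib add.assoc)
      next
        case False
        then have "b(i := b i - 1) = (c(i := c i - 1))(j := Suc ((c(i := c i - 1)) j))" "b i = c i"
          by (auto simp: b fun_upd_twist)
        then show ?thesis unfolding eq using False by simp
      qed
    next
      case False
      then have b: "b = (\<lambda>_. 0)" by auto
      show ?thesis unfolding a b one_weyl_def[symmetric] by simp
    qed
  qed
qed

lemma weyl_monom_d: "weyl_monom a b * weyl_d i = weyl_monom a (b(i := Suc (b i)))"
proof -
  have "{k :: 'a \<Rightarrow> nat. k \<le> b \<and> k \<le> (\<lambda>_. 0)} = {\<lambda>_. 0}"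
    by (auto simp: le_fun_def)
  moreover have "(\<lambda>v. b v + (if v = i then 1 else 0) - 0) = b(i := Suc (b i))" by auto
  ultimately show ?thesis
    by (simp add: weyl_d_def weyl_monom_mult weyl_monom_times_def)
qed

text \<open>Commuting with d_i is formal differentiation with respect to x_i, just as commuting with
  x_i differentiates with respect to d_i. This lowers the degree but annihilates only what is free
  of that variable.\<close>

lemma weyl_coeff_commutator_d:
  "weyl_coeff (weyl_d i * P - P * weyl_d i) (a, b)
     = of_nat (Suc (a i)) * weyl_coeff P (a(i := Suc (a i)), b)"
proof (induction P rule: weyl_linear_induct)
  case (monom c d)
  have eq: "weyl_d i * weyl_monom c d - weyl_monom c d * weyl_d i
      = weyl_scale (of_nat (c i)) (weyl_monom (c(i := c i - 1)) d)"
    by (simp add: weyl_d_monom weyl_monom_d)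
  have "(c i \<noteq> 0 \<and> a = c(i := c i - 1)) \<longleftrightarrow> a(i := Suc (a i)) = c"
    by (auto simp: fun_eq_iff)
  then show ?case unfolding eq by (cases "c i = 0") auto
qed (simp_all add: algebra_simps weyl_scale_times_left weyl_scale_times_right)

lemma weyl_coeff_commutator_x:
  "weyl_coeff (P * weyl_x i - weyl_x i * P) (a, b)
     = of_nat (Suc (b i)) * weyl_coeff P (a, b(i := Suc (b i)))"
proof (induction P rule: weyl_linear_induct)
  case (monom c d)
  have eq: "weyl_monom c d * weyl_x i - weyl_x i * weyl_monom c d
      = weyl_scale (of_nat (d i)) (weyl_monom c (d(i := d i - 1)))"
    by (simp add: weyl_monom_x)
  have "(d i \<noteq> 0 \<and> b = d(i := d i - 1)) \<longleftrightarrow> b(i := Suc (b i)) = d"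
    by (auto simp: fun_eq_iff)
  then show ?case unfolding eq by (cases "d i = 0") auto
qed (simp_all add: algebra_simps weyl_scale_times_left weyl_scale_times_right)

lemma bernstein_x_mult: "P \<in> bernstein k \<Longrightarrow> weyl_x i * P \<in> bernstein (Suc k)"
proof (cases "P = 0")
  case False
  assume "P \<in> bernstein k"
  then have "mdeg (lead_exp P) \<le> k" by (simp add: bernstein_lead_exp[OF False])
  then show ?thesis using lead_exp_x_mult[OF False, of i]
    by (simp add: bernstein_lead_exp mdeg_Suc)
qed (simp add: bernstein_iff)

lemma bernstein_d_mult: "P \<in> bernstein k \<Longrightarrow> weyl_d i * P \<in> bernstein (Suc k)"
proof (cases "P = 0")
  case False
  assume "P \<in> bernstein k"
  then have "mdeg (lead_exp P) \<le> k" by (simp add: bernstein_lead_exp[OF False])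
  then show ?thesis using lead_exp_d_mult[OF False, of i]
    by (simp add: bernstein_lead_exp mdeg_Suc)
qed (simp add: bernstein_iff)

lemma mdeg_upd_Suc:
  "mdeg (a(i := Suc (a i)), b) = Suc (mdeg (a, b))"
  "mdeg (a, b(i := Suc (b i))) = Suc (mdeg (a, b))"
  by (rule mdeg_Suc[of _ _ "Inl i"], simp add: expo_upd)
     (rule mdeg_Suc[of _ _ "Inr i"], simp add: expo_upd)

lemma bernstein_mono: "k \<le> l \<Longrightarrow> bernstein k \<subseteq> bernstein l"
  by (auto simp: bernstein_iff) (meson order_trans)

text \<open>The Bernstein filtration is the smallest one that starts with 1 and along which every
  generator moves up one step. Bounds on B_k can therefore be checked on left multiplication by
  generators.\<close>

lemma bernstein_subset_filtration:
  fixes K :: "nat \<Rightarrow> 'v::finite weyl set"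
  assumes sub: "\<And>n. weyl_vs.subspace (K n)" and mono: "\<And>n. K n \<subseteq> K (Suc n)"
    and one: "1 \<in> K 0"
    and x: "\<And>i n R. R \<in> K n \<Longrightarrow> weyl_x i * R \<in> K (Suc n)"
    and d: "\<And>i n R. R \<in> K n \<Longrightarrow> weyl_d i * R \<in> K (Suc n)"
  shows "bernstein k \<subseteq> K k"
proof
  have monom: "weyl_monom a b \<in> K (mdeg (a, b))" for a b
  proof (induction "mdeg (a, b)" arbitrary: a b)
    case 0
    then have "a = (\<lambda>_. 0)" "b = (\<lambda>_. 0)"
      by (auto simp: mdeg_def sum_expo fun_eq_iff)
    then show ?case using one 0 by (simp flip: one_weyl_def)
  next
    case (Suc n)
    show ?case
    proof (cases "\<exists>i. a i \<noteq> 0")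
      case True
      then obtain i where i: "a i \<noteq> 0" by blast
      define c where "c = a(i := a i - 1)"
      have a: "a = c(i := Suc (c i))" using i by (auto simp: c_def)
      have "mdeg (a, b) = Suc (mdeg (c, b))" unfolding a by (rule mdeg_upd_Suc)
      with Suc have "weyl_monom c b \<in> K n" by simp
      from x[OF this, of i] show ?thesis
        using Suc.hyps(2)[symmetric] by (simp add: a weyl_x_monom)
    next
      case False
      then have a: "a = (\<lambda>_. 0)" by auto
      have "\<exists>i. b i \<noteq> 0"
      proof (rule ccontr)
        assume "\<not> ?thesis"
        then show False using Suc.hyps(2) a by (simp add: mdeg_def sum_expo)
      qed
      then obtain i where i: "b i \<noteq> 0" by blast
      define c where "c = b(i := b i - 1)"
      have b: "b = c(i := Suc (c i))" using i by (auto simp: c_def)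
      have "mdeg (a, b) = Suc (mdeg (a, c))" unfolding b by (rule mdeg_upd_Suc)
      with Suc have "weyl_monom a c \<in> K n" by simp
      from d[OF this, of i] show ?thesis
        using Suc.hyps(2)[symmetric] by (simp add: a b weyl_d_monom)
    qed
  qed
  have K: "K m \<subseteq> K n" if "m \<le> n" for m n using lift_Suc_mono_le[of K, OF mono that] .
  fix P :: "'v weyl" assume P: "P \<in> bernstein k"
  have "(\<Sum>m\<in>weyl_supp P. weyl_scale (weyl_coeff P m) (weyl_monom (fst m) (snd m))) \<in> K k"
  proof (intro weyl_vs.subspace_sum weyl_vs.subspace_scale sub)
    fix m assume "m \<in> weyl_supp P"
    then have "mdeg m \<le> k" using P unfolding bernstein_iff weyl_supp_iff by blast
    then show "weyl_monom (fst m) (snd m) \<in> K k"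
      using monom[of "fst m" "snd m"] K[of "mdeg m" k] by auto
  qed
  then show "P \<in> K k" unfolding weyl_expand[of P, symmetric] .
qed

text \<open>For fixed \<open>Q\<close>, the left factors whose product with \<open>Q\<close> has
  degree at most n + l form a filtration of the required kind.\<close>

lemma bernstein_mult:
  assumes "P \<in> bernstein k" "Q \<in> bernstein l"
  shows "P * Q \<in> bernstein (k + l)"
proof -
  have "bernstein k \<subseteq> {P. P * Q \<in> bernstein (k + l)}"
  proof (rule bernstein_subset_filtration[where K = "\<lambda>n. {P. P * Q \<in> bernstein (n + l)}"])
    show "weyl_vs.subspace {P. P * Q \<in> bernstein (n + l)}" for n
      using subspace_bernstein[of "n + l"]
      by (auto simp: weyl_vs.subspace_def distrib_right weyl_scale_times_left)
    show "{P. P * Q \<in> bernstein (n + l)} \<subseteq> {P. P * Q \<in> bernstein (Suc n + l)}" for n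
      using bernstein_mono[of "n + l" "Suc n + l"] by auto
  qed (use assms(2) bernstein_x_mult bernstein_d_mult in \<open>auto simp: mult.assoc\<close>)
  then show ?thesis using assms(1) by blast
qed

lemma left_ideal_diff: "left_ideal I \<Longrightarrow> P \<in> I \<Longrightarrow> Q \<in> I \<Longrightarrow> P - Q \<in> I"
  by (rule weyl_vs.subspace_diff[OF left_ideal_subspace])

lemma left_ideal_one: "left_ideal I \<Longrightarrow> 1 \<in> I \<Longrightarrow> I = UNIV"
  unfolding left_ideal_def by (metis UNIV_eq_I mult.right_neutral)

text \<open>
  Joseph's argument: commutators with the generators lower the degree of \<open>P\<close> until a nonzero
  constant is reached.
\<close>

lemma bernstein_annihilator_trivial:
  assumes I: "left_ideal I" "I \<noteq> UNIV"
  shows "P \<in> bernstein k \<Longrightarrow> (\<And>Q. Q \<in> bernstein k \<Longrightarrow> P * Q \<in> I) \<Longrightarrow> P = 0"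
proof (induction k arbitrary: P rule: less_induct)
  case (less k)
  show ?case
  proof (rule ccontr)
    assume "P \<noteq> 0"
    have 1: "1 \<in> bernstein k" unfolding bernstein_iff one_weyl_def
      by (auto simp: mdeg_def sum_expo split: if_splits)
    show False
    proof (cases "\<exists>a b i. weyl_coeff P (a, b) \<noteq> 0 \<and> (a i \<noteq> 0 \<or> b i \<noteq> 0)")
      case False
      have "P = weyl_scale (weyl_coeff P (\<lambda>_. 0, \<lambda>_. 0)) 1"
      proof (rule weyl_eqI)
        fix m :: "('a \<Rightarrow> nat) \<times> ('a \<Rightarrow> nat)"
        obtain a b where m: "m = (a, b)" by (cases m)
        show "weyl_coeff P m = weyl_coeff (weyl_scale (weyl_coeff P (\<lambda>_. 0, \<lambda>_. 0)) 1) m"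
        proof (cases "a = (\<lambda>_. 0) \<and> b = (\<lambda>_. 0)")
          case True
          then show ?thesis by (simp add: m one_weyl_def)
        next
          case ne: False
          then obtain i where "a i \<noteq> 0 \<or> b i \<noteq> 0" by (auto simp: fun_eq_iff)
          then have "weyl_coeff P (a, b) = 0" using False by blast
          then show ?thesis using ne by (auto simp: m one_weyl_def)
        qed
      qed
      then obtain c where P: "P = weyl_scale c 1" by blast
      then have "c \<noteq> 0" using \<open>P \<noteq> 0\<close> by auto
      have "weyl_scale (inverse c) (P * 1) \<in> I"
        by (rule weyl_vs.subspace_scale[OF left_ideal_subspace[OF I(1)] less.prems(2)[OF 1]])
      then have "1 \<in> I" using \<open>c \<noteq> 0\<close> by (simp add: P)
      then show False using I left_ideal_one by blast
    next
      case True
      then obtain a b i where ab: "weyl_coeff P (a, b) \<noteq> 0" "a i \<noteq> 0 \<or> b i \<noteq> 0" by blast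
      have "mdeg (a, b) \<le> k" using less.prems(1) ab(1) unfolding bernstein_iff by blast
      moreover have "mdeg (a, b) \<noteq> 0" using ab(2) by (auto simp: mdeg_def sum_expo)
      ultimately obtain l where k: "k = Suc l" by (cases k) auto
      have Pk: "\<And>m. weyl_coeff P m \<noteq> 0 \<Longrightarrow> mdeg m \<le> k"
        using less.prems(1) unfolding bernstein_iff by blast
      show False
      proof (cases "a i = 0")
        case False
        define R where "R = weyl_d i * P - P * weyl_d i"
        have "R \<in> bernstein l" unfolding bernstein_iff
        proof (intro allI impI)
          fix m :: "('a \<Rightarrow> nat) \<times> ('a \<Rightarrow> nat)" assume m: "weyl_coeff R m \<noteq> 0"
          obtain c d where cd: "m = (c, d)" by (cases m)
          have "weyl_coeff P (c(i := Suc (c i)), d) \<noteq> 0"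
            using m by (auto simp: R_def cd weyl_coeff_commutator_d simp del: weyl_coeff_simps)
          then have "mdeg (c(i := Suc (c i)), d) \<le> k" by (rule Pk)
          moreover have "mdeg (c(i := Suc (c i)), d) = Suc (mdeg (c, d))"
            by (rule mdeg_upd_Suc)
          ultimately show "mdeg m \<le> l" by (simp add: cd k)
        qed
        \<comment> \<open>R * Q is d_i (P Q) - P (d_i Q). Since \<open>k = Suc l\<close>, both Q and
          d_i Q are still in B_k, so the hypothesis on P applies to both terms.\<close>
        moreover have "R * Q \<in> I" if "Q \<in> bernstein l" for Q
        proof -
          have "P * Q \<in> I" "P * (weyl_d i * Q) \<in> I"
            using that bernstein_mono[of l k] bernstein_d_mult[OF that, of i] less.prems(2) by (auto simp: k)
          then have "weyl_d i * (P * Q) - P * (weyl_d i * Q) \<in> I"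
            using I(1) by (intro left_ideal_diff) (auto simp: left_ideal_def)
          then show ?thesis by (simp add: R_def left_diff_distrib mult.assoc)
        qed
        ultimately have "R = 0" by (intro less.IH[of l]) (auto simp: k)
        define c where "c = a(i := a i - 1)"
        have "c(i := Suc (c i)) = a" using False by (auto simp: c_def)
        then have "weyl_coeff R (c, b) = of_nat (Suc (c i)) * weyl_coeff P (a, b)"
          unfolding R_def weyl_coeff_commutator_d by simp
        then show False using ab(1) \<open>R = 0\<close> by (simp del: of_nat_Suc)
      next
        case True
        with ab have bi: "b i \<noteq> 0" by simp
        define R where "R = P * weyl_x i - weyl_x i * P"
        have "R \<in> bernstein l" unfolding bernstein_iff
        proof (intro allI impI)
          fix m :: "('a \<Rightarrow> nat) \<times> ('a \<Rightarrow> nat)" assume m: "weyl_coeff R m \<noteq> 0"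
          obtain c d where cd: "m = (c, d)" by (cases m)
          have "weyl_coeff P (c, d(i := Suc (d i))) \<noteq> 0"
            using m by (auto simp: R_def cd weyl_coeff_commutator_x simp del: weyl_coeff_simps)
          then have "mdeg (c, d(i := Suc (d i))) \<le> k" by (rule Pk)
          moreover have "mdeg (c, d(i := Suc (d i))) = Suc (mdeg (c, d))"
            by (rule mdeg_upd_Suc)
          ultimately show "mdeg m \<le> l" by (simp add: cd k)
        qed
        moreover have "R * Q \<in> I" if "Q \<in> bernstein l" for Q
        proof -
          have "P * Q \<in> I" "P * (weyl_x i * Q) \<in> I"
            using that bernstein_mono[of l k] bernstein_x_mult[OF that, of i] less.prems(2) by (auto simp: k)
          then have "P * (weyl_x i * Q) - weyl_x i * (P * Q) \<in> I"
            using I(1) by (intro left_ideal_diff) (auto simp: left_ideal_def)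
          then show ?thesis by (simp add: R_def left_diff_distrib mult.assoc)
        qed
        ultimately have "R = 0" by (intro less.IH[of l]) (auto simp: k)
        define c where "c = b(i := b i - 1)"
        have "c(i := Suc (c i)) = b" using bi by (auto simp: c_def)
        then have "weyl_coeff R (a, c) = of_nat (Suc (c i)) * weyl_coeff P (a, b)"
          unfolding R_def weyl_coeff_commutator_x by simp
        then show False using ab(1) \<open>R = 0\<close> by (simp del: of_nat_Suc)
      qed
    qed
  qed
qed

section \<open>Complements of an ideal, their coordinates, and Bernstein's dimension
  estimate\<close>

abbreviation weyl_functional :: "('v weyl \<Rightarrow> complex) \<Rightarrow> bool" where
  "weyl_functional \<equiv> Vector_Spaces.linear weyl_scale (*)"

interpretation weyl_functional: vector_space_pair "weyl_scale :: complex \<Rightarrow> 'v weyl \<Rightarrow> _" "(*) :: complex \<Rightarrow> _"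
  by unfold_locales (auto simp: algebra_simps)

lemma weyl_functionalI:
  assumes "\<And>P Q. f (P + Q) = f P + f Q" "\<And>c P. f (weyl_scale c P) = c * f P"
  shows "weyl_functional f"
  using assms by unfold_locales

lemma weyl_functionalD:
  assumes "weyl_functional f"
  shows "f (P + Q) = f P + f Q" "f (weyl_scale c P) = c * f P" "f (P - Q) = f P - f Q" "f 0 = 0"
    "f (sum g A) = (\<Sum>a\<in>A. f (g a))"
  by (rule weyl_functional.linear_add[OF assms] weyl_functional.linear_scale[OF assms]
      weyl_functional.linear_diff[OF assms] weyl_functional.linear_0[OF assms]
      weyl_functional.linear_sum[OF assms])+

text \<open>Each functional cuts out a subspace of codimension at most one, and jointly they leave
  only 0. The finite set \<open>B\<close> guarantees that the dimensions are genuine.\<close>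

lemma dim_le_card_functionals:
  assumes "finite X" and "\<And>x. x \<in> X \<Longrightarrow> weyl_functional (f x)"
    and "finite B" "weyl_vs.subspace V" "V \<subseteq> weyl_vs.span B"
    and "\<And>v. v \<in> V \<Longrightarrow> (\<And>x. x \<in> X \<Longrightarrow> f x v = 0) \<Longrightarrow> v = 0"
  shows "weyl_vs.dim V \<le> card X"
  using assms(1,2,4,5,6)
proof (induction X arbitrary: V)
  case empty
  then have "V \<subseteq> {0}" by auto
  then show ?case using weyl_vs.dim_le_card[of V "{}"] by simp
next
  case (insert x X)
  define W where "W = {v \<in> V. f x v = 0}"
  note fx = weyl_functionalD[OF insert.prems(1)[of x, simplified]]
  have W: "weyl_vs.subspace W"
    using insert.prems(2) unfolding weyl_vs.subspace_def W_def by (auto simp: fx)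
  have dimW: "weyl_vs.dim W \<le> card X"
  proof (rule insert.IH)
    show "W \<subseteq> weyl_vs.span B" using insert.prems(3) by (auto simp: W_def)
    fix v assume "v \<in> W" "\<And>x. x \<in> X \<Longrightarrow> f x v = 0"
    then show "v = 0" using insert.prems(4)[of v] by (auto simp: W_def)
  qed (use insert.prems W in auto)
  obtain C where C: "C \<subseteq> W" "weyl_vs.independent C" "W \<subseteq> weyl_vs.span C" "card C = weyl_vs.dim W"
    using weyl_vs.basis_exists by blast
  have "finite C"
    using weyl_vs.independent_span_bound[OF assms(3) C(2)] C(1) insert.prems(3) by (auto simp: W_def)
  show ?case
  proof (cases "W = V")
    case True
    then show ?thesis using dimW insert.hyps by simp
  next
    case False
    then obtain w where w: "w \<in> V" "f x w \<noteq> 0" by (auto simp: W_def)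
    have "V \<subseteq> weyl_vs.span (insert w C)"
    proof
      fix v assume v: "v \<in> V"
      let ?c = "f x v / f x w"
      have "v - weyl_scale ?c w \<in> W"
        using v w insert.prems(2) by (auto simp: W_def fx intro: weyl_vs.subspace_diff weyl_vs.subspace_scale)
      then have "v - weyl_scale ?c w \<in> weyl_vs.span C" using C(3) by blast
      then show "v \<in> weyl_vs.span (insert w C)" unfolding weyl_vs.span_insert by blast
    qed
    then have "weyl_vs.dim V \<le> card (insert w C)" using \<open>finite C\<close> by (intro weyl_vs.dim_le_card) auto
    also have "\<dots> \<le> Suc (card C)" using \<open>finite C\<close> by (simp add: card_insert_if)
    also have "\<dots> \<le> card (insert x X)" using C(4) dimW insert.hyps by simp
    finally show ?thesis .
  qed
qed

text \<open>\<open>S\<close> is a basis of a complement of the ideal inside B_k, and the functionals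
  \<open>\<tau> s\<close> are coordinates along it. The pair stands in for the quotient of B_k by
  its intersection with \<open>I\<close>.\<close>

definition dual_complement ::
    "'v::finite weyl set \<Rightarrow> nat \<Rightarrow> 'v weyl set \<Rightarrow> ('v weyl \<Rightarrow> 'v weyl \<Rightarrow> complex) \<Rightarrow> bool" where
  "dual_complement I k S \<tau> \<longleftrightarrow> finite S \<and> card S = hilbert_fun I k \<and> S \<subseteq> bernstein k \<and>
     (\<forall>s. weyl_functional (\<tau> s)) \<and>
     (\<forall>s\<in>S. \<forall>t\<in>S. \<tau> s t = (if s = t then 1 else 0)) \<and>
     (\<forall>s\<in>S. \<forall>R\<in>bernstein k \<inter> I. \<tau> s R = 0) \<and>
     (\<forall>R\<in>bernstein k. (\<forall>s\<in>S. \<tau> s R = 0) \<longrightarrow> R \<in> I)"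

lemma dual_complementD:
  assumes "dual_complement I k S \<tau>"
  shows "finite S" "card S = hilbert_fun I k" "S \<subseteq> bernstein k"
    "\<And>s. weyl_functional (\<tau> s)"
    "\<And>s t. s \<in> S \<Longrightarrow> t \<in> S \<Longrightarrow> \<tau> s t = (if s = t then 1 else 0)"
    "\<And>s R. s \<in> S \<Longrightarrow> R \<in> bernstein k \<Longrightarrow> R \<in> I \<Longrightarrow> \<tau> s R = 0"
    "\<And>R. R \<in> bernstein k \<Longrightarrow> (\<And>s. s \<in> S \<Longrightarrow> \<tau> s R = 0) \<Longrightarrow> R \<in> I"
  using assms unfolding dual_complement_def by blast+

lemma dual_complement_coordinates:
  assumes "dual_complement I k S \<tau>" "t \<in> S"
  shows "\<tau> t (\<Sum>s\<in>S. weyl_scale (u s) s) = u t"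
proof -
  note S = dual_complementD[OF assms(1)]
  have "\<tau> t (\<Sum>s\<in>S. weyl_scale (u s) s) = (\<Sum>s\<in>S. if t = s then u s else 0)"
    unfolding weyl_functionalD[OF S(4)] by (intro sum.cong) (simp_all add: S(5) assms(2))
  then show ?thesis using S(1) assms(2) by simp
qed

lemma dual_complement_reduce:
  assumes "dual_complement I k S \<tau>" "R \<in> bernstein k"
  shows "R - (\<Sum>s\<in>S. weyl_scale (\<tau> s R) s) \<in> I"
proof (rule dual_complementD(7)[OF assms(1)])
  note S = dual_complementD[OF assms(1)]
  show "R - (\<Sum>s\<in>S. weyl_scale (\<tau> s R) s) \<in> bernstein k" using assms(2) S(3)
    by (intro weyl_vs.subspace_diff weyl_vs.subspace_sum weyl_vs.subspace_scale subspace_bernstein) auto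
  show "\<tau> t (R - (\<Sum>s\<in>S. weyl_scale (\<tau> s R) s)) = 0" if "t \<in> S" for t
    unfolding weyl_functionalD(3)[OF S(4)] dual_complement_coordinates[OF assms(1) that] by simp
qed

lemma dual_complement_exists:
  fixes I :: "'v::finite weyl set"
  assumes "weyl_vs.subspace I"
  shows "\<exists>S \<tau>. dual_complement I k S \<tau>"
proof -
  let ?B = "bernstein k :: 'v weyl set"
  obtain C where C: "finite C" "C \<subseteq> ?B \<inter> I" "weyl_vs.independent C" "weyl_vs.span C = ?B \<inter> I"
    using dim_bernstein_Int(2)[OF assms, of k] by (elim exE conjE)
  obtain D where D: "C \<subseteq> D" "D \<subseteq> ?B" "weyl_vs.independent D" "?B \<subseteq> weyl_vs.span D"
    using weyl_vs.maximal_independent_subset_extend[of C ?B] C by blast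
  have spanD: "weyl_vs.span D = ?B"
    using D weyl_vs.span_minimal[OF D(2) subspace_bernstein] by blast
  obtain F :: "'v weyl set" where F: "finite F" "weyl_vs.span F = ?B"
    using dim_bernstein_Int(2)[of UNIV k] by auto
  have "finite D" using weyl_vs.independent_span_bound[OF F(1) D(3)] D(2) F(2) by blast
  \<comment> \<open>Extending to a basis of the whole algebra makes the coordinates linear
    everywhere, while on B_k they agree with those along D.\<close>
  define E where "E = weyl_vs.extend_basis D"
  have E: "D \<subseteq> E" "weyl_vs.independent E" "weyl_vs.span E = UNIV"
    using D(3) by (simp_all add: E_def weyl_vs.extend_basis_superset weyl_vs.independent_extend_basis)
  define \<tau> where "\<tau> s R = weyl_vs.representation E R s" for s R
  have inD: "weyl_vs.representation E R = weyl_vs.representation D R" if "R \<in> ?B" for R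
    using weyl_vs.representation_extend[OF E(2) _ E(1)] that spanD by blast
  have inC: "weyl_vs.representation D R = weyl_vs.representation C R" if "R \<in> ?B" "R \<in> I" for R
    using weyl_vs.representation_extend[OF D(3) _ D(1)] that C(4) by blast
  have "dual_complement I k (D - C) \<tau>"
    unfolding dual_complement_def
  proof (intro conjI allI ballI impI)
    show "finite (D - C)" using \<open>finite D\<close> by simp
    have "weyl_vs.dim ?B = card D" using weyl_vs.dim_span_eq_card_independent[OF D(3)] spanD by simp
    moreover have "weyl_vs.dim (?B \<inter> I) = card C" using weyl_vs.dim_span_eq_card_independent[OF C(3)] C(4) by simp
    ultimately show "card (D - C) = hilbert_fun I k"
      using D(1) C(1) by (simp add: hilbert_fun_def card_Diff_subset)
    show "D - C \<subseteq> ?B" using D(2) by blast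
    show "weyl_functional (\<tau> s)" for s
      by (rule weyl_functionalI)
         (simp_all add: \<tau>_def weyl_vs.representation_add[OF E(2)] weyl_vs.representation_scale[OF E(2)] E(3))
    show "\<tau> s t = (if s = t then 1 else 0)" if "s \<in> D - C" "t \<in> D - C" for s t
      using weyl_vs.representation_basis[OF E(2), of t] that E(1) by (auto simp: \<tau>_def)
    show "\<tau> s R = 0" if "s \<in> D - C" "R \<in> ?B \<inter> I" for s R
      using weyl_vs.representation_ne_zero[of C R s] that by (auto simp: \<tau>_def inD inC)
    show "R \<in> I" if R: "R \<in> ?B" and 0: "\<forall>s\<in>D - C. \<tau> s R = 0" for R
    proof -
      have "R = (\<Sum>b | weyl_vs.representation D R b \<noteq> 0. weyl_scale (weyl_vs.representation D R b) b)"
        using weyl_vs.sum_nonzero_representation_eq[OF D(3)] R spanD by simp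
      also have "\<dots> \<in> weyl_vs.span C"
      proof (intro weyl_vs.span_sum weyl_vs.span_scale weyl_vs.span_base)
        fix b assume b: "b \<in> {b. weyl_vs.representation D R b \<noteq> 0}"
        then have "b \<in> D" using weyl_vs.representation_ne_zero by blast
        then show "b \<in> C" using b 0 inD[OF R] by (auto simp: \<tau>_def)
      qed
      finally show ?thesis using C(4) by blast
    qed
  qed
  then show ?thesis by blast
qed

text \<open>A complement basis can be moved modulo \<open>I\<close> into the span of
  \<open>X\<close>. It stays independent, because a relation between the new vectors would put the
  same combination of the old ones into \<open>I\<close>.\<close>

lemma hilbert_fun_le_card:
  assumes I: "weyl_vs.subspace I" and "finite X"
    and X: "\<And>R. R \<in> bernstein k \<Longrightarrow> \<exists>y\<in>weyl_vs.span X. R - y \<in> I"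
  shows "hilbert_fun I k \<le> card X"
proof -
  obtain S \<tau> where dual: "dual_complement I k S \<tau>" using dual_complement_exists[OF I] by blast
  note S = dual_complementD[OF dual]
  obtain y where y: "\<And>s. s \<in> S \<Longrightarrow> y s \<in> weyl_vs.span X \<and> s - y s \<in> I"
    using X S(3) by (metis subsetD)
  have zero: "u t = 0" if "(\<Sum>s\<in>S. weyl_scale (u s) (y s)) = 0" "t \<in> S" for u t
  proof -
    let ?R = "\<Sum>s\<in>S. weyl_scale (u s) s"
    have "?R = (\<Sum>s\<in>S. weyl_scale (u s) (s - y s))"
      using that(1) by (simp add: weyl_vs.scale_right_diff_distrib sum_subtractf)
    also have "\<dots> \<in> I" using y I by (intro weyl_vs.subspace_sum weyl_vs.subspace_scale) auto
    finally have "?R \<in> I" .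
    moreover have "?R \<in> bernstein k" using S(3)
      by (intro weyl_vs.subspace_sum weyl_vs.subspace_scale subspace_bernstein) auto
    ultimately have "\<tau> t ?R = 0" using S(6) that(2) by blast
    then show ?thesis using dual_complement_coordinates[OF dual that(2)] by simp
  qed
  have inj: "inj_on y S"
  proof (rule inj_onI, rule ccontr)
    fix s t assume st: "s \<in> S" "t \<in> S" "y s = y t" "s \<noteq> t"
    define u :: "'a weyl \<Rightarrow> complex" where "u r = (if r = s then 1 else if r = t then - 1 else 0)" for r
    have "(\<Sum>r\<in>S. weyl_scale (u r) (y r)) = (\<Sum>r\<in>{s, t}. weyl_scale (u r) (y r))"
      by (rule sum.mono_neutral_right) (use S(1) st in \<open>auto simp: u_def\<close>)
    also have "\<dots> = 0" using st by (simp add: u_def)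
    finally have "u s = 0" using zero[of u s] st(1) by simp
    then show False by (simp add: u_def)
  qed
  have "weyl_vs.independent (y ` S)"
  proof
    assume "weyl_vs.dependent (y ` S)"
    then obtain u v where "v \<in> y ` S" "u v \<noteq> 0" "(\<Sum>v\<in>y ` S. weyl_scale (u v) v) = 0"
      using weyl_vs.dependent_finite[of "y ` S"] S(1) by blast
    then show False using zero[of "\<lambda>s. u (y s)"] by (auto simp: sum.reindex[OF inj])
  qed
  then have "card (y ` S) \<le> card X"
    using weyl_vs.independent_span_bound[OF \<open>finite X\<close>] y by blast
  then show ?thesis using S(2) card_image[OF inj] by simp
qed

text \<open>Left multiplication sends P in B_k to a linear map from B_k modulo I to B_2k modulo I.
  By Joseph's argument this assignment is injective, and the right side is the dimension of the
  space of such maps.\<close>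

theorem bernstein_dim_le_hilbert_fun:
  fixes I :: "'v::finite weyl set"
  assumes I: "left_ideal I" "I \<noteq> UNIV"
  shows "weyl_vs.dim (bernstein k :: 'v weyl set) \<le> hilbert_fun I k * hilbert_fun I (2 * k)"
proof -
  note sub = left_ideal_subspace[OF I(1)]
  obtain S \<sigma> where dual: "dual_complement I k S \<sigma>" using dual_complement_exists[OF sub] by blast
  note S = dual_complementD[OF dual]
  obtain T \<tau> where "dual_complement I (2 * k) T \<tau>" using dual_complement_exists[OF sub] by blast
  note T = dual_complementD[OF this]
  obtain F :: "'v weyl set" where F: "finite F" "weyl_vs.span F = bernstein k"
    using dim_bernstein_Int(2)[of UNIV k] by auto
  have "weyl_vs.dim (bernstein k :: 'v weyl set) \<le> card (S \<times> T)"
  proof (rule dim_le_card_functionals[where B = F])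
    \<comment> \<open>The matrix entries of left multiplication by P in the two complement
      bases.\<close>
    let ?f = "\<lambda>(s, t) P. \<tau> t (P * s)"
    show "weyl_functional (?f x)" for x
      by (cases x, simp, rule weyl_functionalI)
         (simp_all add: distrib_right weyl_scale_times_left weyl_functionalD[OF T(4)])
    fix P :: "'v weyl" assume P: "P \<in> bernstein k" and 0: "\<And>x. x \<in> S \<times> T \<Longrightarrow> ?f x P = 0"
    have PS: "P * s \<in> I" if "s \<in> S" for s
    proof (rule T(7))
      show "P * s \<in> bernstein (2 * k)" using bernstein_mult[OF P, of s k] that S(3) by (auto simp: mult_2)
    qed (use 0[of "(s, _)"] that in auto)
    show "P = 0"
    proof (rule bernstein_annihilator_trivial[OF I P])
      fix Q :: "'v weyl" assume Q: "Q \<in> bernstein k"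
      define R where "R = (\<Sum>s\<in>S. weyl_scale (\<sigma> s Q) s)"
      have "Q - R \<in> I" unfolding R_def by (rule dual_complement_reduce[OF dual Q])
      then have "P * (Q - R) \<in> I" using I(1) by (simp add: left_ideal_def)
      moreover have "P * R \<in> I" unfolding R_def sum_distrib_left weyl_scale_times_right
        by (intro weyl_vs.subspace_sum weyl_vs.subspace_scale sub PS)
      ultimately have "P * (Q - R) + P * R \<in> I" using I(1) by (simp add: left_ideal_def)
      then show "P * Q \<in> I" by (simp flip: distrib_left)
    qed
  qed (use S(1) T(1) F subspace_bernstein in auto)
  then show ?thesis by (simp add: card_cartesian_product S(2) T(2))
qed

text \<open>A box with side bound q in all 2n exponents consists of exponents of degree at most 2nq.
  This crude bound already has the full order of growth 2n.\<close>

lemma card_box_le_dim_bernstein: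
  "(q + 1) ^ (2 * CARD('v)) \<le> weyl_vs.dim (bernstein (2 * CARD('v) * q) :: 'v::finite weyl set)"
proof -
  let ?box = "\<Pi>\<^sub>E u\<in>(UNIV :: ('v + 'v) set). {..q}"
  have "?box \<subseteq> expo ` {m. mdeg m \<le> 2 * CARD('v) * q}"
  proof
    fix e assume "e \<in> ?box"
    then have e: "e u \<le> q" for u by (auto simp: PiE_def)
    define m where "m = (\<lambda>v. e (Inl v), \<lambda>v. e (Inr v))"
    have m: "expo m = e" by (auto simp: m_def expo_def fun_eq_iff split: sum.split)
    have "(\<Sum>u\<in>UNIV. e u) \<le> (\<Sum>u\<in>(UNIV :: ('v + 'v) set). q)" by (rule sum_mono) (rule e)
    also have "\<dots> = 2 * CARD('v) * q" by (simp add: card_Plus UNIV_Plus_UNIV[symmetric] del: UNIV_Plus_UNIV)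
    finally have "mdeg m \<le> 2 * CARD('v) * q" by (simp add: mdeg_def m)
    then show "e \<in> expo ` {m. mdeg m \<le> 2 * CARD('v) * q}" using m by blast
  qed
  then have "card ?box \<le> card (expo ` {m :: ('v \<Rightarrow> nat) \<times> ('v \<Rightarrow> nat). mdeg m \<le> 2 * CARD('v) * q})"
    by (intro card_mono finite_imageI finite_mdeg_le)
  also have "\<dots> \<le> card {m :: ('v \<Rightarrow> nat) \<times> ('v \<Rightarrow> nat). mdeg m \<le> 2 * CARD('v) * q}"
    by (rule card_image_le[OF finite_mdeg_le])
  finally show ?thesis
    by (simp add: dim_bernstein card_PiE card_Plus UNIV_Plus_UNIV[symmetric] mult_2 del: UNIV_Plus_UNIV)
qed

lemma poly_gt_of_degree_gt:
  fixes p q :: "real poly"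
  assumes "degree q < degree p" "lead_coeff p > 0"
  shows "\<exists>N. \<forall>x\<ge>N. poly q x < poly p x"
proof -
  have "degree (p - q) = degree p" "coeff (p - q) (degree p) = lead_coeff p"
    using assms(1) degree_add_eq_left[of "- q" p] by (simp_all add: coeff_eq_0)
  then have "lead_coeff (p - q) > 0" using assms(2) by simp
  from poly_pinfty_gt_lc[OF this] obtain n where
    "\<forall>x\<ge>n. poly (p - q) x \<ge> lead_coeff (p - q)" by blast
  with \<open>lead_coeff (p - q) > 0\<close> show ?thesis by (intro exI[of _ n]) force
qed

text \<open>
  The lower bound on the degree is Bernstein's inequality; since the ideal is allowed to be
  the whole ring, only the upper bound needs to be checked.
\<close>

theorem holonomic_idealI:
  fixes J :: "'v::finite weyl set" and q :: "real poly"
  assumes J: "left_ideal J" and q: "degree q \<le> CARD('v)"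
    and bound: "\<And>k. k \<ge> N \<Longrightarrow> real (hilbert_fun J k) \<le> poly q (real k)"
  shows "holonomic_ideal J"
proof (cases "J = UNIV")
  case False
  let ?n = "CARD('v)"
  obtain p :: "real poly" and M where p: "\<And>k. k \<ge> M \<Longrightarrow> real (hilbert_fun J k) = poly p (real k)"
    using hilbert_fun_eventually_poly[OF J] unfolding eventually_poly_def eventually_sequentially by blast
  \<comment> \<open>A Hilbert function takes no negative values, so its polynomial cannot tend to
    minus infinity.\<close>
  have lc: "\<not> lead_coeff p < 0"
  proof
    assume "lead_coeff p < 0"
    then have "lead_coeff (- p) > 0" by simp
    from poly_pinfty_gt_lc[OF this] obtain x where
      x: "\<forall>y\<ge>x. poly (- p) y \<ge> lead_coeff (- p)" by blast
    define k where "k = max M (nat \<lceil>x\<rceil>)"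
    have "x \<le> real k" unfolding k_def by linarith
    then have "poly p (real k) < 0" using x \<open>lead_coeff p < 0\<close> by force
    moreover have "poly p (real k) \<ge> 0" using p[of k] by (metis k_def max.cobounded1 of_nat_0_le_iff)
    ultimately show False by simp
  qed
  have "degree p \<le> ?n"
  proof (rule ccontr)
    assume "\<not> degree p \<le> ?n"
    then have "degree q < degree p" "p \<noteq> 0" using q by auto
    then have "lead_coeff p > 0" using lc by (metis leading_coeff_0_iff linorder_neqE)
    from poly_gt_of_degree_gt[OF \<open>degree q < degree p\<close> this]
    obtain x where x: "\<forall>y\<ge>x. poly q y < poly p y" by blast
    define k where "k = max N (max M (nat \<lceil>x\<rceil>))"
    have "x \<le> real k" unfolding k_def by linarith
    then have "poly q (real k) < poly p (real k)" using x by blast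
    moreover have "poly p (real k) \<le> poly q (real k)" using p[of k] bound[of k] by (simp add: k_def)
    ultimately show False by simp
  qed
  moreover have "?n \<le> degree p"
  proof (rule ccontr)
    assume less: "\<not> ?n \<le> degree p"
    \<comment> \<open>Its value at k is the product of the Hilbert polynomial at 2nk and at 4nk,
      which bounds the dimension of B_2nk. That space contains a box of (k+1)^(2n) exponents,
      whereas a degree of p below n would leave this product of degree below 2n.\<close>
    let ?r = "pcompose p [:0, real (2 * ?n):] * pcompose p [:0, real (4 * ?n):]"
    have n0: "?n > 0" by (simp add: card_gt_0_iff)
    have "degree ?r \<le> degree p + degree p"
      by (rule order_trans[OF degree_mult_le]) (simp add: degree_pcompose n0)
    then have "degree ?r < degree (monom 1 (2 * ?n) :: real poly)"
      using less by (simp add: degree_monom_eq)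
    from poly_gt_of_degree_gt[OF this] obtain x where
      x: "\<forall>y\<ge>x. poly ?r y < poly (monom 1 (2 * ?n)) y" by (auto simp: degree_monom_eq)
    define k where "k = max M (nat \<lceil>x\<rceil>)"
    have kx: "x \<le> real k" unfolding k_def by linarith
    have kM: "2 * ?n * k \<ge> M"
    proof -
      have "1 * k \<le> 2 * ?n * k" using n0 by (intro mult_right_mono) auto
      then show ?thesis by (simp add: k_def)
    qed
    have "real ((k + 1) ^ (2 * ?n)) \<le> real (hilbert_fun J (2 * ?n * k) * hilbert_fun J (2 * (2 * ?n * k)))"
      using order_trans[OF card_box_le_dim_bernstein[of k] bernstein_dim_le_hilbert_fun[OF J False]]
      by (rule of_nat_mono)
    also have "\<dots> = poly p (real (2 * ?n * k)) * poly p (real (2 * (2 * ?n * k)))"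
      using p[of "2 * ?n * k"] p[of "2 * (2 * ?n * k)"] kM by simp
    also have "\<dots> = poly ?r (real k)" by (simp add: poly_pcompose mult_ac)
    also have "\<dots> < real k ^ (2 * ?n)" using x kx by (simp add: poly_monom)
    also have "\<dots> \<le> real ((k + 1) ^ (2 * ?n))" by (simp add: power_mono)
    finally show False by simp
  qed
  ultimately have "degree p = ?n" by simp
  then show ?thesis
    using J p unfolding holonomic_ideal_def eventually_sequentially by blast
qed (use J in \<open>simp add: holonomic_ideal_def\<close>)

section \<open>The Hilbert function of the transformed ideal\<close>

lemma one_bernstein: "1 \<in> bernstein k"
  unfolding bernstein_iff one_weyl_def by (auto simp: mdeg_def sum_expo split: if_splits)

lemma left_ideal_gen: "left_ideal (left_ideal_gen S)" "S \<subseteq> left_ideal_gen S"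
  by (auto simp: left_ideal_gen_def left_ideal_def)

lemma left_ideal_gen_minimal: "left_ideal I \<Longrightarrow> S \<subseteq> I \<Longrightarrow> left_ideal_gen S \<subseteq> I"
  by (auto simp: left_ideal_gen_def)

lemma weyl_left_commute:
  "weyl_d i * (weyl_d j * P) = weyl_d j * (weyl_d i * P)"
  "weyl_x i * (weyl_x j * P) = weyl_x j * (weyl_x i * P)"
  by (simp_all only: mult.assoc[symmetric] weyl_d_commute[of i j] weyl_x_commute[of i j])

lemma phi_simps:
  fixes P Q :: "'d::finite weyl"
  shows "phi (1 :: 'd weyl) = 1" "phi (P + Q) = phi P + phi Q" "phi (P * Q) = phi P * phi Q"
  "phi (weyl_scale c P) = weyl_scale c (phi P)" "phi (0 :: 'd weyl) = 0" "phi (P - Q) = phi P - phi Q"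
proof -
  have *: "phi (1 :: 'd weyl) = 1" "phi (P + Q) = phi P + phi Q" "phi (P * Q) = phi P * phi Q"
    "phi (weyl_scale c P) = weyl_scale c (phi P)" for P Q :: "'d weyl" and c
    using phi_props(1) unfolding weyl_hom_def by blast+
  show "phi (1 :: 'd weyl) = 1" "phi (P + Q) = phi P + phi Q" "phi (P * Q) = phi P * phi Q"
    "phi (weyl_scale c P) = weyl_scale c (phi P)" by (rule *)+
  show "phi (0 :: 'd weyl) = 0" using *(4)[of 0 0] by simp
  show "phi (P - Q) = phi P - phi Q" using *(2)[of "P - Q" Q] by (simp add: eq_diff_eq)
qed

lemma phi_sum: "phi (sum f A) = (\<Sum>a\<in>A. phi (f a))"
  by (induction A rule: infinite_finite_induct) (simp_all add: phi_simps)

lemma phi_left_ideal_gen: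
  assumes "left_ideal J" "phi ` S \<subseteq> J" "P \<in> left_ideal_gen S"
  shows "phi P \<in> J"
proof -
  have "left_ideal {P. phi P \<in> J}"
    using assms(1) by (auto simp: left_ideal_def phi_simps)
  from left_ideal_gen_minimal[OF this, of S] assms(2,3) show ?thesis by blast
qed

text \<open>There is one variable per unordered pair, so the derivative of the quadratic form with
  respect to x_ij is t_i^2 on the diagonal and 2 t_i t_j off it. This is the source of the
  coefficients 1 and 2.\<close>

definition heat :: "'d \<Rightarrow> 'd \<Rightarrow> 'd::finite xy weyl" where
  "heat i j = dxvar i j - (if i = j then 1 else 2) * (dyvar i * dyvar j)"

text \<open>The left side is the commutator of \<open>dxvar i j\<close> with the sum in
  \<open>phi (weyl_d k)\<close>; it picks out the l for which {k, l} equals {i, j}.\<close>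

lemma d_x_sum_y:
  fixes i j k :: "'d::finite"
  shows "(\<Sum>l\<in>UNIV. (if Inl (Upair i j) = (Inl (Upair k l) :: 'd xy) then 1 else 0) * dyvar l)
    = (if i = j then if i = k then dyvar i else 0
       else (if i = k then dyvar j else 0) + (if j = k then dyvar i else 0))"
proof -
  have "(\<Sum>l\<in>UNIV. (if Inl (Upair i j) = (Inl (Upair k l) :: 'd xy) then 1 else 0) * dyvar l)
    = (\<Sum>l\<in>UNIV. (if l = j \<and> i = k then dyvar j else 0) + (if l = i \<and> j = k \<and> i \<noteq> j then dyvar i else (0 :: 'd xy weyl)))"
    by (rule sum.cong) auto
  also have "\<dots> = (if i = k then dyvar j else 0) + (if j = k \<and> i \<noteq> j then dyvar i else 0)"
    by (simp add: sum.distrib if_distrib[of "\<lambda>x. x \<and> _"] cong: if_cong)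
       (cases "i = k"; cases "j = k"; simp)
  finally show ?thesis by auto
qed

text \<open>
  Under the Fourier transform \<open>t = \<partial>\<^sub>y\<close>, the heat operators and \<open>phi P\<close> are the conjugates by \<open>e\<^sup>q\<close>, where
  \<open>q = \<Sum>i j. x\<^sub>i\<^sub>j t\<^sub>i t\<^sub>j\<close>, of the operators \<open>\<partial>\<^sub>x\<close> and of operators in \<open>t\<close> alone; therefore they commute.
\<close>

lemma heat_phi_commute: "heat i j * phi P = phi P * heat i j"
proof (induction P rule: weyl_induct)
  case (x k P)
  have "heat i j * dyvar k = dyvar k * heat i j"
  proof -
    have "dxvar i j * dyvar k = dyvar k * dxvar i j" "dyvar i * dyvar j * dyvar k = dyvar k * (dyvar i * dyvar j)"
      by (rule weyl_d_commute) (simp only: mult.assoc weyl_d_commute weyl_left_commute)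
    then show ?thesis by (simp add: heat_def left_diff_distrib right_diff_distrib mult.assoc mult_2 distrib_right distrib_left)
  qed
  then have "heat i j * (dyvar k * phi P) = dyvar k * (heat i j * phi P)" by (simp flip: mult.assoc)
  then show ?case by (simp add: phi_simps phi_props(2) x mult.assoc)
next
  case (d k P)
  let ?S = "\<Sum>l\<in>UNIV. xvar k l * dyvar l"
  let ?c = "\<lambda>l. if Inl (Upair i j) = (Inl (Upair k l) :: 'a xy) then 1 else (0 :: 'a xy weyl)"
  have dyS: "dyvar n * ?S = ?S * dyvar n" for n
    unfolding sum_distrib_left sum_distrib_right
  proof (rule sum.cong)
    fix l
    have "dyvar n * xvar k l = xvar k l * dyvar n" by (simp add: weyl_d_x)
    then have "dyvar n * (xvar k l * dyvar l) = xvar k l * (dyvar n * dyvar l)"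
      by (simp only: mult.assoc[symmetric])
    then show "dyvar n * (xvar k l * dyvar l) = xvar k l * dyvar l * dyvar n"
      by (simp only: mult.assoc weyl_d_commute)
  qed simp
  have dxS: "dxvar i j * ?S = ?S * dxvar i j + (\<Sum>l\<in>UNIV. ?c l * dyvar l)"
    unfolding sum_distrib_left sum_distrib_right sum.distrib[symmetric]
  proof (rule sum.cong)
    fix l
    have "dxvar i j * (xvar k l * dyvar l) = (xvar k l * dxvar i j + ?c l) * dyvar l"
      by (simp add: weyl_d_x flip: mult.assoc)
    also have "\<dots> = xvar k l * (dyvar l * dxvar i j) + ?c l * dyvar l"
      by (simp only: distrib_right mult.assoc weyl_d_commute)
    finally show "dxvar i j * (xvar k l * dyvar l) = xvar k l * dyvar l * dxvar i j + ?c l * dyvar l"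
      by (simp only: mult.assoc)
  qed simp
  have dxy: "dxvar i j * yvar k = yvar k * dxvar i j" by (simp add: weyl_d_x)
  have dyy: "dyvar n * yvar k = yvar k * dyvar n + (if n = k then 1 else 0)" for n :: 'a by (simp add: weyl_d_x)
  have ddy: "dyvar i * dyvar j * yvar k = yvar k * (dyvar i * dyvar j)
      + ((if i = k then dyvar j else 0) + (if j = k then dyvar i else 0))"
  proof -
    have "dyvar i * dyvar j * yvar k = dyvar i * (yvar k * dyvar j + (if j = k then 1 else 0))"
      by (simp only: dyy[symmetric] mult.assoc)
    also have "\<dots> = dyvar i * yvar k * dyvar j + dyvar i * (if j = k then 1 else 0)"
      by (simp only: distrib_left mult.assoc)
    finally have "dyvar i * dyvar j * yvar k = dyvar i * yvar k * dyvar j + dyvar i * (if j = k then 1 else 0)" .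
    then show ?thesis unfolding dyy distrib_right by (simp add: mult.assoc)
  qed
  have ddS: "dyvar i * dyvar j * ?S = ?S * (dyvar i * dyvar j)"
    by (simp only: mult.assoc dyS) (simp only: mult.assoc[symmetric] dyS)
  \<comment> \<open>Twice the commutator s of X with T cancels against the commutator of c * D with
    Y.\<close>
  have ring: "(X - c * D) * (Y + 2 * T) = (Y + 2 * T) * (X - c * D)"
    if "X * Y = Y * X" "X * T = T * X + s" "c * (D * Y) = Y * (c * D) + (s + s)" "c * D * T = T * (c * D)"
    for c D X Y T s :: "'a xy weyl"
    using that by (simp add: mult_2 left_diff_distrib right_diff_distrib distrib_left distrib_right mult.assoc)
  have "heat i j * (yvar k + 2 * ?S) = (yvar k + 2 * ?S) * heat i j"
    unfolding heat_def
  proof (rule ring[OF dxy dxS[unfolded d_x_sum_y]])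
    show "(if i = j then 1 else 2) * (dyvar i * dyvar j * yvar k) = yvar k * ((if i = j then 1 else 2) * (dyvar i * dyvar j)) +
      ((if i = j then if i = k then dyvar i else 0 else (if i = k then dyvar j else 0) + (if j = k then dyvar i else 0)) +
       (if i = j then if i = k then dyvar i else 0 else (if i = k then dyvar j else 0) + (if j = k then dyvar i else 0)))"
      unfolding ddy by (simp add: mult_2 distrib_left distrib_right)
    show "(if i = j then 1 else 2) * (dyvar i * dyvar j) * ?S = ?S * ((if i = j then 1 else 2) * (dyvar i * dyvar j))"
      using ddS by (cases "i = j") (simp_all add: mult_2 distrib_left distrib_right)
  qed
  then have comm: "heat i j * phi (weyl_d k) = phi (weyl_d k) * heat i j"
    unfolding phi_props(3) by (simp add: algebra_simps)
  have "heat i j * (phi (weyl_d k) * phi P) = phi (weyl_d k) * (heat i j * phi P)"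
    using comm by (simp flip: mult.assoc)
  then show ?case by (simp add: phi_simps d mult.assoc)
qed (simp_all add: phi_simps distrib_left distrib_right weyl_scale_times_left weyl_scale_times_right)

section \<open>Reduction modulo the transformed ideal to products of x-monomials and images of
  \<open>phi\<close>\<close>

definition xmonom :: "('d uprod \<Rightarrow> nat) \<Rightarrow> 'd::finite xy weyl" where
  "xmonom a = weyl_monom (case_sum a (\<lambda>_. 0)) (\<lambda>_. 0)"

lemma case_sum_upd: "(case_sum a b)(Inl u := x) = case_sum (a(u := x)) b"
  by (auto simp: fun_eq_iff split: sum.split)

lemma xmonom_0: "xmonom (\<lambda>_. 0) = 1"
proof -
  have "case_sum (\<lambda>_. 0) (\<lambda>_. 0) = (\<lambda>_. 0 :: nat)" by (auto simp: fun_eq_iff split: sum.split)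
  then show ?thesis by (simp add: xmonom_def one_weyl_def)
qed

lemma xmonom_simps:
  "weyl_x (Inl u) * xmonom a = xmonom (a(u := Suc (a u)))"
  "weyl_x v * xmonom a = xmonom a * weyl_x v"
  "dyvar k * xmonom a = xmonom a * dyvar k"
  "weyl_d (Inl u) * xmonom a = xmonom a * weyl_d (Inl u) + weyl_scale (of_nat (a u)) (xmonom (a(u := a u - 1)))"
  unfolding xmonom_def
  by (simp_all add: weyl_x_monom weyl_monom_x weyl_d_monom weyl_monom_d case_sum_upd)

context
  fixes I :: "'d::finite weyl set" and J :: "'d xy weyl set"
  assumes I: "left_ideal I" and J: "left_ideal J"
    and phiI: "\<And>P. P \<in> I \<Longrightarrow> phi P \<in> J" and heatJ: "\<And>i j. heat i j \<in> J"
begin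

text \<open>Bounding each exponent separately, instead of the total degree, makes the exponents fill
  a box, whose cardinality is a pure power of n + 1.\<close>

definition products :: "nat \<Rightarrow> 'd xy weyl set" where
  "products n = {xmonom a * phi P | a P. (\<forall>u. a u \<le> n) \<and> P \<in> bernstein n}"

definition prod_filt :: "nat \<Rightarrow> 'd xy weyl set" where
  "prod_filt n = {R. \<exists>y\<in>weyl_vs.span (products n). R - y \<in> J}"

lemma subspace_J: "weyl_vs.subspace J"
  by (rule left_ideal_subspace[OF J])

lemma subspace_mod:
  assumes "weyl_vs.subspace V" shows "weyl_vs.subspace {R. \<exists>y\<in>V. R - y \<in> J}"
proof (rule weyl_vs.subspaceI)
  show "0 \<in> {R. \<exists>y\<in>V. R - y \<in> J}"
    using weyl_vs.subspace_0[OF assms] weyl_vs.subspace_0[OF subspace_J] by (auto intro!: bexI[of _ 0])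
next
  fix R S assume "R \<in> {R. \<exists>y\<in>V. R - y \<in> J}" "S \<in> {R. \<exists>y\<in>V. R - y \<in> J}"
  then obtain y z where yz: "y \<in> V" "R - y \<in> J" "z \<in> V" "S - z \<in> J" by blast
  have "(R + S) - (y + z) = (R - y) + (S - z)" by simp
  then have "(R + S) - (y + z) \<in> J" using weyl_vs.subspace_add[OF subspace_J yz(2,4)] by metis
  then show "R + S \<in> {R. \<exists>y\<in>V. R - y \<in> J}"
    using weyl_vs.subspace_add[OF assms yz(1,3)] by blast
next
  fix c R assume "R \<in> {R. \<exists>y\<in>V. R - y \<in> J}"
  then obtain y where y: "y \<in> V" "R - y \<in> J" by blast
  have "weyl_scale c R - weyl_scale c y \<in> J"
    using weyl_vs.subspace_scale[OF subspace_J y(2), of c] by (simp add: weyl_vs.scale_right_diff_distrib)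
  then show "weyl_scale c R \<in> {R. \<exists>y\<in>V. R - y \<in> J}"
    using weyl_vs.subspace_scale[OF assms y(1)] by blast
qed

lemma subspace_prod_filt: "weyl_vs.subspace (prod_filt n)"
  unfolding prod_filt_def by (rule subspace_mod) simp

lemma prod_filt_product:
  "(\<And>u. a u \<le> n) \<Longrightarrow> P \<in> bernstein n \<Longrightarrow> xmonom a * phi P \<in> prod_filt n"
  unfolding prod_filt_def products_def
  using weyl_vs.subspace_0[OF subspace_J]
  by (auto intro!: bexI[of _ "xmonom a * phi P"] weyl_vs.span_base)

lemma prod_filt_J: "R \<in> J \<Longrightarrow> R \<in> prod_filt n"
  unfolding prod_filt_def using weyl_vs.span_zero by (auto intro!: bexI[of _ 0])

text \<open>J absorbs left multiplication, so the effect of G needs to be tested only on the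
  spanning products.\<close>

lemma prod_filt_mult:
  assumes "\<And>a P. (\<And>u. a u \<le> n) \<Longrightarrow> P \<in> bernstein n \<Longrightarrow> G * (xmonom a * phi P) \<in> prod_filt m"
    and "R \<in> prod_filt n"
  shows "G * R \<in> prod_filt m"
proof -
  obtain y where y: "y \<in> weyl_vs.span (products n)" "R - y \<in> J"
    using assms(2) by (auto simp: prod_filt_def)
  have "G * y \<in> prod_filt m" using y(1)
  proof (induction rule: weyl_vs.span_induct_alt)
    case base
    show ?case using weyl_vs.subspace_0[OF subspace_prod_filt] by simp
  next
    case (step c x y)
    have "G * x \<in> prod_filt m" using step(1) assms(1) by (auto simp: products_def)
    then show ?case using step(2)
      by (simp add: distrib_left weyl_scale_times_right weyl_vs.subspace_add[OF subspace_prod_filt]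
          weyl_vs.subspace_scale[OF subspace_prod_filt])
  qed
  moreover have "G * (R - y) \<in> prod_filt m" using y(2) J by (intro prod_filt_J) (simp add: left_ideal_def)
  ultimately have "G * y + G * (R - y) \<in> prod_filt m" by (rule weyl_vs.subspace_add[OF subspace_prod_filt])
  then show ?thesis by (simp flip: distrib_left)
qed

text \<open>Multiplication by an x variable raises an exponent of the monomial. For y_k the formula
  for \<open>phi (weyl_d k)\<close> is solved for y_k, which turns it into left factors of P and
  further x variables.\<close>

lemma prod_filt_xmult: "R \<in> prod_filt n \<Longrightarrow> weyl_x v * R \<in> prod_filt (n + 2)"
proof (rule prod_filt_mult)
  fix a :: "'d uprod \<Rightarrow> nat" and P :: "'d weyl"
  assume a: "\<And>u. a u \<le> n" and P: "P \<in> bernstein n"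
  have x: "weyl_x (Inl u) * (xmonom a * phi Q) \<in> prod_filt (n + 2)" if "Q \<in> bernstein (Suc n)" for u and Q :: "'d weyl"
  proof -
    have "xmonom (a(u := Suc (a u))) * phi Q \<in> prod_filt (n + 2)"
    proof (rule prod_filt_product)
      show "(a(u := Suc (a u))) w \<le> n + 2" for w using a[of w] by auto
      show "Q \<in> bernstein (n + 2)" using that bernstein_mono[of "Suc n" "n + 2"] by auto
    qed
    then show ?thesis by (simp add: xmonom_simps(1) flip: mult.assoc)
  qed
  show "weyl_x v * (xmonom a * phi P) \<in> prod_filt (n + 2)"
  proof (cases v)
    case (Inl u)
    then show ?thesis using x[of P] P bernstein_mono[of n "Suc n"] by auto
  next
    case (Inr k)
    have y: "yvar k = - phi (weyl_d k) - 2 * (\<Sum>l\<in>UNIV. xvar k l * phi (weyl_x l))"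
      by (simp add: phi_props)
    have "weyl_x v * (xmonom a * phi P) = xmonom a * (yvar k * phi P)"
      unfolding Inr by (simp add: xmonom_simps(2) flip: mult.assoc)
    also have "\<dots> = - (xmonom a * phi (weyl_d k * P))
        - (\<Sum>l\<in>UNIV. weyl_scale 2 (xvar k l * (xmonom a * phi (weyl_x l * P))))"
    proof -
      have "xvar k l * xmonom a = xmonom a * xvar k l" for l by (rule xmonom_simps(2))
      then have "xmonom a * (xvar k l * (phi (weyl_x l) * phi P)) = xvar k l * (xmonom a * (phi (weyl_x l) * phi P))" for l
        by (simp flip: mult.assoc)
      moreover have "2 * Q = weyl_scale 2 Q" for Q :: "'d xy weyl"
        using weyl_scale_of_nat[of 2 Q] by simp
      ultimately show ?thesis unfolding y
        by (simp add: phi_simps left_diff_distrib right_diff_distrib sum_distrib_left sum_distrib_right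
            weyl_scale_times_left weyl_scale_times_right weyl_vs.scale_sum_right mult.assoc)
    qed
    also have "\<dots> \<in> prod_filt (n + 2)"
    proof (intro weyl_vs.subspace_diff weyl_vs.subspace_neg weyl_vs.subspace_sum weyl_vs.subspace_scale subspace_prod_filt x)
      show "xmonom a * phi (weyl_d k * P) \<in> prod_filt (n + 2)"
        using bernstein_d_mult[OF P, of k] bernstein_mono[of "Suc n" "n + 2"] a
        by (intro prod_filt_product) (auto simp: le_SucI)
      show "weyl_x l * P \<in> bernstein (Suc n)" for l by (rule bernstein_x_mult[OF P])
    qed
    finally show ?thesis .
  qed
qed

text \<open>A derivative in y_k is \<open>phi\<close> of a variable. A derivative in x_ij is a heat
  operator plus \<open>phi\<close> of a multiple of t_i t_j, which is why the filtration index
  advances by two.\<close>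

lemma prod_filt_dmult: "R \<in> prod_filt n \<Longrightarrow> weyl_d v * R \<in> prod_filt (n + 2)"
proof (rule prod_filt_mult)
  fix a :: "'d uprod \<Rightarrow> nat" and P :: "'d weyl"
  assume a: "\<And>u. a u \<le> n" and P: "P \<in> bernstein n"
  show "weyl_d v * (xmonom a * phi P) \<in> prod_filt (n + 2)"
  proof (cases v)
    case (Inr k)
    have "weyl_d v * (xmonom a * phi P) = xmonom a * phi (weyl_x k * P)"
      unfolding Inr by (simp add: xmonom_simps(3) phi_simps phi_props(2) flip: mult.assoc)
    also have "\<dots> \<in> prod_filt (n + 2)"
      using bernstein_x_mult[OF P, of k] bernstein_mono[of "Suc n" "n + 2"] a
      by (intro prod_filt_product) (auto simp: le_SucI)
    finally show ?thesis .
  next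
    case (Inl u)
    obtain i j where u: "u = Upair i j" by (cases u) auto
    define c :: complex where "c = (if i = j then 1 else 2)"
    have dx: "dxvar i j = heat i j + weyl_scale c (phi (weyl_x i * weyl_x j))"
      using weyl_scale_of_nat[of 2 "dyvar i * dyvar j"]
      by (simp add: heat_def c_def phi_simps phi_props(2))
    have "weyl_d v * (xmonom a * phi P) = xmonom a * (dxvar i j * phi P)
        + weyl_scale (of_nat (a u)) (xmonom (a(u := a u - 1)) * phi P)"
      unfolding Inl u[symmetric]
      by (simp add: xmonom_simps(4) distrib_right weyl_scale_times_left flip: mult.assoc)
    \<comment> \<open>Only as the rightmost factor is the heat operator absorbed by the left ideal
      J, so it has to be moved past \<open>phi P\<close>.\<close>
    also have "xmonom a * (dxvar i j * phi P) = xmonom a * phi P * heat i j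
        + weyl_scale c (xmonom a * phi (weyl_x i * (weyl_x j * P)))"
      by (simp add: dx distrib_left distrib_right heat_phi_commute phi_simps weyl_scale_times_left
          weyl_scale_times_right mult.assoc)
    also have "xmonom a * phi P * heat i j + weyl_scale c (xmonom a * phi (weyl_x i * (weyl_x j * P)))
        + weyl_scale (of_nat (a u)) (xmonom (a(u := a u - 1)) * phi P) \<in> prod_filt (n + 2)"
    proof (intro weyl_vs.subspace_add weyl_vs.subspace_scale subspace_prod_filt)
      have le: "a w \<le> n + 2" "(a(u := a u - 1)) w \<le> n + 2" for w
        using a[of w] a[of u] by auto
      show "xmonom a * phi P * heat i j \<in> prod_filt (n + 2)"
        using J heatJ by (intro prod_filt_J) (simp add: left_ideal_def)
      have "weyl_x i * (weyl_x j * P) \<in> bernstein (n + 2)"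
        using bernstein_x_mult[OF bernstein_x_mult[OF P, of j], of i] by simp
      then show "xmonom a * phi (weyl_x i * (weyl_x j * P)) \<in> prod_filt (n + 2)"
        by (rule prod_filt_product[OF le(1)])
      have "P \<in> bernstein (n + 2)" using P bernstein_mono[of n "n + 2"] by auto
      then show "xmonom (a(u := a u - 1)) * phi P \<in> prod_filt (n + 2)"
        by (rule prod_filt_product[OF le(2)])
    qed
    finally show ?thesis .
  qed
qed

lemma bernstein_subset_prod_filt: "bernstein k \<subseteq> prod_filt (2 * k)"
proof (rule bernstein_subset_filtration)
  show "prod_filt (2 * n) \<subseteq> prod_filt (2 * Suc n)" for n
  proof -
    have "products (2 * n) \<subseteq> products (2 * Suc n)"
      unfolding products_def using bernstein_mono[of "2 * n" "2 * Suc n"] by (fastforce intro: le_SucI)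
    then show ?thesis unfolding prod_filt_def using weyl_vs.span_mono by blast
  qed
  show "1 \<in> prod_filt (2 * 0)"
    using prod_filt_product[of "\<lambda>_. 0" 0 1] by (simp add: xmonom_0 phi_simps one_bernstein)
qed (use subspace_prod_filt prod_filt_xmult prod_filt_dmult in auto)

lemma hilbert_fun_bound:
  "hilbert_fun J k \<le> (2 * k + 1) ^ CARD('d uprod) * hilbert_fun I (2 * k)"
proof -
  obtain S \<tau> where dual: "dual_complement I (2 * k) S \<tau>"
    using dual_complement_exists[OF left_ideal_subspace[OF I]] by blast
  note S = dual_complementD[OF dual]
  define A where "A = (\<Pi>\<^sub>E u\<in>(UNIV :: 'd uprod set). {..2 * k})"
  define X where "X = (\<lambda>(a, s). xmonom a * phi s) ` (A \<times> S)"
  have "finite A" unfolding A_def by (rule finite_PiE) auto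
  then have finX: "finite X" using S(1) by (simp add: X_def)
  have "products (2 * k) \<subseteq> {R. \<exists>y\<in>weyl_vs.span X. R - y \<in> J}"
  proof
    fix R assume "R \<in> products (2 * k)"
    then obtain a P where R: "R = xmonom a * phi P" "\<And>u. a u \<le> 2 * k" "P \<in> bernstein (2 * k)"
      by (auto simp: products_def)
    define Q where "Q = (\<Sum>s\<in>S. weyl_scale (\<tau> s P) s)"
    have "P - Q \<in> I" unfolding Q_def by (rule dual_complement_reduce[OF dual R(3)])
    then have "xmonom a * phi (P - Q) \<in> J" using phiI J by (simp add: left_ideal_def)
    then have "R - xmonom a * phi Q \<in> J" by (simp add: R(1) phi_simps right_diff_distrib)
    moreover have "xmonom a * phi Q = (\<Sum>s\<in>S. weyl_scale (\<tau> s P) (xmonom a * phi s))"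
      by (simp add: Q_def phi_sum phi_simps sum_distrib_left weyl_scale_times_right)
    moreover have "\<dots> \<in> weyl_vs.span X"
      by (intro weyl_vs.span_sum weyl_vs.span_scale weyl_vs.span_base)
         (use R(2) in \<open>force simp: X_def A_def\<close>)
    ultimately show "R \<in> {R. \<exists>y\<in>weyl_vs.span X. R - y \<in> J}" by auto
  qed
  then have span: "weyl_vs.span (products (2 * k)) \<subseteq> {R. \<exists>y\<in>weyl_vs.span X. R - y \<in> J}"
    by (intro weyl_vs.span_minimal subspace_mod) auto
  have "hilbert_fun J k \<le> card X"
  proof (rule hilbert_fun_le_card[OF subspace_J finX])
    fix R :: "'d xy weyl" assume "R \<in> bernstein k"
    then obtain y where y: "y \<in> weyl_vs.span (products (2 * k))" "R - y \<in> J"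
      using bernstein_subset_prod_filt by (auto simp: prod_filt_def)
    then obtain z where z: "z \<in> weyl_vs.span X" "y - z \<in> J" using span by blast
    have "(R - y) + (y - z) \<in> J" by (rule weyl_vs.subspace_add[OF subspace_J y(2) z(2)])
    then show "\<exists>y\<in>weyl_vs.span X. R - y \<in> J" using z(1) by auto
  qed
  also have "\<dots> \<le> card (A \<times> S)" unfolding X_def using \<open>finite A\<close> S(1) by (intro card_image_le) auto
  also have "\<dots> = (2 * k + 1) ^ CARD('d uprod) * hilbert_fun I (2 * k)"
    by (simp add: card_cartesian_product S(2) A_def card_PiE)
  finally show ?thesis .
qed

theorem holonomic_transform:
  assumes "holonomic_ideal I" shows "holonomic_ideal J"
proof (cases "I = UNIV")
  case True
  then have "1 \<in> J" using phiI[of 1] by (simp add: phi_simps)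
  then have "J = UNIV" by (rule left_ideal_one[OF J])
  then show ?thesis using J by (simp add: holonomic_ideal_def)
next
  case False
  then obtain p :: "real poly" and N where p: "degree p = CARD('d)"
    "\<And>k. k \<ge> N \<Longrightarrow> real (hilbert_fun I k) = poly p (real k)"
    using assms unfolding holonomic_ideal_def eventually_sequentially by blast
  \<comment> \<open>The factor [:1, 2:] stands for 2k + 1, once per x variable, and composing with
    [:0, 2:] evaluates p at 2k. The degrees add up to the number of variables x_ij and y_k.\<close>
  show ?thesis
  proof (rule holonomic_idealI[OF J, of "[:1, 2:] ^ CARD('d uprod) * pcompose p [:0, 2:]" N])
    have "degree ([:1, 2:] ^ CARD('d uprod) * pcompose p [:0, 2:] :: real poly)
        \<le> degree ([:1, 2:] ^ CARD('d uprod) :: real poly) + degree (pcompose p [:0, 2:])"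
      by (rule degree_mult_le)
    also have "\<dots> \<le> CARD('d uprod) + CARD('d)"
      using degree_power_le[of "[:1, 2:] :: real poly" "CARD('d uprod)"]
      by (simp add: degree_pcompose p(1))
    also have "\<dots> = CARD('d xy)" by (simp add: card_Plus UNIV_Plus_UNIV[symmetric] del: UNIV_Plus_UNIV)
    finally show "degree ([:1, 2:] ^ CARD('d uprod) * pcompose p [:0, 2:]) \<le> CARD('d xy)" .
    fix k assume "k \<ge> N"
    have "real (hilbert_fun J k) \<le> real ((2 * k + 1) ^ CARD('d uprod) * hilbert_fun I (2 * k))"
      by (rule of_nat_mono) (rule hilbert_fun_bound)
    also have "\<dots> = poly ([:1, 2:] ^ CARD('d uprod) * pcompose p [:0, 2:]) (real k)"
      using \<open>k \<ge> N\<close> p(2)[of "2 * k"] by (simp add: poly_pcompose mult_ac add_ac)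
    finally show "real (hilbert_fun J k) \<le> poly ([:1, 2:] ^ CARD('d uprod) * pcompose p [:0, 2:]) (real k)" .
  qed
qed

end

section \<open>Laplace transforms of functions of exponential growth\<close>

lemma integrable_gaussian_real:
  fixes \<eta> :: real assumes "\<eta> > 0"
  shows "integrable lborel (\<lambda>x. exp (- \<eta> * x\<^sup>2))"
proof -
  define \<sigma> where "\<sigma> = sqrt (1 / (2 * \<eta>))"
  have \<sigma>: "2 * \<sigma>\<^sup>2 = 1 / \<eta>" "\<sigma> > 0" using assms by (simp_all add: \<sigma>_def)
  have "exp (- \<eta> * x\<^sup>2) = sqrt (2 * pi * \<sigma>\<^sup>2) * normal_density 0 \<sigma> x" for x
    using \<sigma> assms by (simp add: normal_density_def)
  then show ?thesis using \<sigma> integrable_normal_density[of \<sigma> 0] by simp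
qed

text \<open>The Gaussian is a product over the coordinates, so its integral factors into
  one-dimensional ones.\<close>

lemma integrable_gaussian:
  fixes \<eta> :: real assumes "\<eta> > 0"
  shows "integrable lborel (\<lambda>t :: 'a::euclidean_space. exp (- \<eta> * (norm t)\<^sup>2))"
proof (rule integrableI_nonneg)
  have "(norm t)\<^sup>2 = (\<Sum>b\<in>Basis. (t \<bullet> b)\<^sup>2)" for t :: 'a
    unfolding power2_norm_eq_inner by (subst euclidean_inner) (simp add: power2_eq_square)
  then have "exp (- \<eta> * (norm t)\<^sup>2) = (\<Prod>b\<in>Basis. exp (- \<eta> * (t \<bullet> b)\<^sup>2))" for t :: 'a
    by (simp add: exp_sum sum_distrib_left flip: sum_negf)
  then have "(\<integral>\<^sup>+t. ennreal (exp (- \<eta> * (norm t)\<^sup>2)) \<partial>(lborel :: 'a measure))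
      = (\<integral>\<^sup>+t. (\<Prod>b\<in>Basis. ennreal (exp (- \<eta> * (t \<bullet> b)\<^sup>2))) \<partial>(lborel :: 'a measure))"
    by (simp add: prod_ennreal)
  also have "\<dots> = (\<Prod>b\<in>(Basis :: 'a set). \<integral>\<^sup>+x. ennreal (exp (- \<eta> * x\<^sup>2)) \<partial>lborel)"
    by (rule nn_integral_lborel_prod) auto
  also have "\<dots> < \<infinity>"
    using integrable_gaussian_real[OF assms]
    by (auto simp: integrable_iff_bounded power_less_top_ennreal)
  finally show "(\<integral>\<^sup>+t. ennreal (exp (- \<eta> * (norm t)\<^sup>2)) \<partial>(lborel :: 'a measure)) < \<infinity>" .
qed auto

lemma integrable_exp_gaussian:
  fixes \<epsilon> c :: real assumes "\<epsilon> > 0"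
  shows "integrable lborel (\<lambda>t :: 'a::euclidean_space. exp (c * norm t - \<epsilon> * (norm t)\<^sup>2))"
proof (rule Bochner_Integration.integrable_bound)
  show "integrable lborel (\<lambda>t :: 'a. exp (c\<^sup>2 / (2 * \<epsilon>)) * exp (- (\<epsilon> / 2) * (norm t)\<^sup>2))"
    using integrable_gaussian[of "\<epsilon> / 2"] assms by simp
  show "AE t in lborel. norm (exp (c * norm (t :: 'a) - \<epsilon> * (norm t)\<^sup>2))
      \<le> norm (exp (c\<^sup>2 / (2 * \<epsilon>)) * exp (- (\<epsilon> / 2) * (norm t)\<^sup>2))"
  proof (rule AE_I2)
    fix t :: 'a
    \<comment> \<open>Completing the square lets half of the quadratic decay absorb the linear
      growth.\<close>
    have "0 \<le> (c - \<epsilon> * norm t)\<^sup>2 / (2 * \<epsilon>)" using assms by simp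
    also have "\<dots> = c\<^sup>2 / (2 * \<epsilon>) - c * norm t + (\<epsilon> / 2) * (norm t)\<^sup>2"
      using assms by (simp add: power2_eq_square field_simps)
    finally show "norm (exp (c * norm t - \<epsilon> * (norm t)\<^sup>2))
      \<le> norm (exp (c\<^sup>2 / (2 * \<epsilon>)) * exp (- (\<epsilon> / 2) * (norm t)\<^sup>2))"
      by (simp add: mult_exp_exp)
  qed
qed auto

text \<open>The amplitudes to which the transform is applied. Besides f itself the class contains
  the coordinate functions and is closed under sums and products, so differentiating the kernel
  never leaves it.\<close>

definition tame :: "(real ^ 'd \<Rightarrow> complex) \<Rightarrow> bool" where
  "tame a \<longleftrightarrow> a \<in> borel_measurable borel \<and> exponential_growth a"

lemma tame_measurable: "tame a \<Longrightarrow> a \<in> borel_measurable lborel"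
  by (simp add: tame_def)

lemma tame_bound: "tame a \<Longrightarrow> \<exists>C c. C \<ge> 0 \<and> (\<forall>t. norm (a t) \<le> C * exp (c * norm t))"
proof -
  assume "tame a"
  then obtain C c where C: "\<And>t. norm (a t) \<le> C * exp (c * norm t)"
    by (auto simp: tame_def exponential_growth_def)
  have "0 \<le> C * exp (c * norm (0 :: real ^ 'a))" using C[of 0] norm_ge_zero order_trans by blast
  then show ?thesis using C by (intro exI[of _ C] exI[of _ c]) simp
qed

lemma tame_mult: "tame a \<Longrightarrow> tame b \<Longrightarrow> tame (\<lambda>t. a t * b t)"
proof -
  assume ab: "tame a" "tame b"
  obtain C c where C: "C \<ge> 0" "\<And>t. norm (a t) \<le> C * exp (c * norm t)" using tame_bound[OF ab(1)] by blast
  obtain D d where D: "D \<ge> 0" "\<And>t. norm (b t) \<le> D * exp (d * norm t)" using tame_bound[OF ab(2)] by blast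
  have "norm (a t * b t) \<le> C * D * exp ((c + d) * norm t)" for t
  proof -
    have "norm (a t) * norm (b t) \<le> (C * exp (c * norm t)) * (D * exp (d * norm t))"
      using C D by (intro mult_mono) auto
    then show ?thesis by (simp add: norm_mult distrib_right exp_add mult.assoc mult.left_commute[of _ D])
  qed
  then show ?thesis using ab by (auto simp: tame_def exponential_growth_def)
qed

lemma tame_add: "tame a \<Longrightarrow> tame b \<Longrightarrow> tame (\<lambda>t. a t + b t)"
proof -
  assume ab: "tame a" "tame b"
  obtain C c where C: "C \<ge> 0" "\<And>t. norm (a t) \<le> C * exp (c * norm t)" using tame_bound[OF ab(1)] by blast
  obtain D d where D: "D \<ge> 0" "\<And>t. norm (b t) \<le> D * exp (d * norm t)" using tame_bound[OF ab(2)] by blast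
  have "norm (a t + b t) \<le> (C + D) * exp (max c d * norm t)" for t
  proof -
    have "norm (a t + b t) \<le> C * exp (c * norm t) + D * exp (d * norm t)"
      using C D norm_triangle_mono by blast
    also have "\<dots> \<le> C * exp (max c d * norm t) + D * exp (max c d * norm t)"
      using C D by (intro add_mono mult_left_mono) (auto intro: mult_right_mono)
    finally show ?thesis by (simp add: distrib_right)
  qed
  then show ?thesis using ab by (auto simp: tame_def exponential_growth_def)
qed

lemma tame_const: "tame (\<lambda>_. k)"
  unfolding tame_def exponential_growth_def
  by (intro conjI exI[of _ "norm k"] exI[of _ 0]) auto

lemma tame_sum: "(\<And>i. i \<in> A \<Longrightarrow> tame (a i)) \<Longrightarrow> tame (\<lambda>t. \<Sum>i\<in>A. a i t)"
  by (induction A rule: infinite_finite_induct) (auto intro: tame_add tame_const)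

lemma tame_prod: "(\<And>i. i \<in> A \<Longrightarrow> tame (a i)) \<Longrightarrow> tame (\<lambda>t. \<Prod>i\<in>A. a i t)"
  by (induction A rule: infinite_finite_induct) (auto intro: tame_mult tame_const)

lemma tame_power: "tame a \<Longrightarrow> tame (\<lambda>t. a t ^ n)"
  by (induction n) (auto intro: tame_mult tame_const)

lemma tame_norm: "tame (\<lambda>t. of_real (norm t))"
proof -
  have "norm t \<le> 1 * exp (1 * norm t)" for t :: "real ^ 'a"
    using exp_ge_add_one_self[of "norm t"] unfolding mult_1_left by linarith
  moreover have "(\<lambda>t :: real ^ 'a. complex_of_real (norm t)) \<in> borel_measurable borel" by measurable
  ultimately show ?thesis unfolding tame_def exponential_growth_def norm_of_real abs_norm_cancel by blast
qed

lemma tame_coord: "tame (\<lambda>t. of_real (t $ i))"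
proof -
  have "\<bar>t $ i\<bar> \<le> 1 * exp (1 * norm t)" for t :: "real ^ 'a"
    using component_le_norm_cart[of t i] exp_ge_add_one_self[of "norm t"] unfolding mult_1_left by linarith
  moreover have "(\<lambda>t :: real ^ 'a. complex_of_real (t $ i)) \<in> borel_measurable borel"
    by (intro borel_measurable_continuous_onI continuous_intros)
  ultimately show ?thesis unfolding tame_def exponential_growth_def norm_of_real by blast
qed

lemma tame_integrable:
  assumes "tame a" "\<epsilon> > 0"
  shows "integrable lborel (\<lambda>t. a t * of_real (exp (b * norm t - \<epsilon> * (norm t)\<^sup>2)))"
proof -
  obtain C c where C: "C \<ge> 0" "\<And>t. norm (a t) \<le> C * exp (c * norm t)" using tame_bound[OF assms(1)] by blast
  show ?thesis
  proof (rule Bochner_Integration.integrable_bound)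
    show "integrable lborel (\<lambda>t :: real ^ 'a. C * exp ((c + b) * norm t - \<epsilon> * (norm t)\<^sup>2))"
      by (intro integrable_mult_right integrable_exp_gaussian assms)
    show "AE t in lborel. norm (a t * of_real (exp (b * norm t - \<epsilon> * (norm t)\<^sup>2)))
        \<le> norm (C * exp ((c + b) * norm t - \<epsilon> * (norm t)\<^sup>2))"
    proof (rule AE_I2)
      fix t :: "real ^ 'a"
      have "norm (a t) * exp (b * norm t - \<epsilon> * (norm t)\<^sup>2)
          \<le> C * exp (c * norm t) * exp (b * norm t - \<epsilon> * (norm t)\<^sup>2)"
        using C by (intro mult_right_mono) auto
      also have "\<dots> = C * exp ((c + b) * norm t - \<epsilon> * (norm t)\<^sup>2)"
        by (simp add: mult_exp_exp algebra_simps)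
      finally show "norm (a t * of_real (exp (b * norm t - \<epsilon> * (norm t)\<^sup>2)))
          \<le> norm (C * exp ((c + b) * norm t - \<epsilon> * (norm t)\<^sup>2))"
        using C(1) by (simp add: norm_mult)
    qed
  qed (use tame_measurable[OF assms(1)] in measurable)
qed

text \<open>The derivative of \<open>phase\<close> with respect to the variable v. Summing over
  ordered pairs gives the factor 2 for off-diagonal variables.\<close>

definition xy_monom :: "'d::finite xy \<Rightarrow> real ^ 'd \<Rightarrow> real" where
  "xy_monom v t = (case v of
     Inl u \<Rightarrow> \<Sum>i\<in>UNIV. \<Sum>j\<in>UNIV. if Upair i j = u then t $ i * t $ j else 0 | Inr k \<Rightarrow> t $ k)"

definition quad :: "real ^ 'd::finite xy \<Rightarrow> real ^ 'd \<Rightarrow> real" where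
  "quad z t = (\<Sum>i\<in>UNIV. \<Sum>j\<in>UNIV. x_matrix z $ i $ j * t $ i * t $ j)"

definition phase :: "real ^ 'd::finite xy \<Rightarrow> real ^ 'd \<Rightarrow> real" where
  "phase z t = quad z t + (\<Sum>i\<in>UNIV. y_vector z $ i * t $ i)"

text \<open>The phase is linear in z, so each derivative in z multiplies the integrand by one fixed
  polynomial in t.\<close>

lemma phase_eq_sum_monom: "phase z t = (\<Sum>v\<in>UNIV. z $ v * xy_monom v t)"
proof -
  have "(\<Sum>v\<in>UNIV. z $ v * xy_monom v t)
      = (\<Sum>u\<in>UNIV. z $ Inl u * xy_monom (Inl u) t) + (\<Sum>k\<in>UNIV. z $ Inr k * xy_monom (Inr k) t)"
    by (subst UNIV_Plus_UNIV[symmetric]) (simp add: sum.Plus del: UNIV_Plus_UNIV)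
  also have "(\<Sum>u\<in>UNIV. z $ Inl u * xy_monom (Inl u) t)
      = (\<Sum>u\<in>UNIV. \<Sum>i\<in>UNIV. \<Sum>j\<in>UNIV. if Upair i j = u then z $ Inl u * (t $ i * t $ j) else 0)"
    by (simp add: xy_monom_def sum_distrib_left if_distrib cong: if_cong)
  also have "\<dots> = (\<Sum>i\<in>UNIV. \<Sum>u\<in>UNIV. \<Sum>j\<in>UNIV. if Upair i j = u then z $ Inl u * (t $ i * t $ j) else 0)"
    by (rule sum.swap)
  also have "\<dots> = (\<Sum>i\<in>UNIV. \<Sum>j\<in>UNIV. \<Sum>u\<in>UNIV. if Upair i j = u then z $ Inl u * (t $ i * t $ j) else 0)"
    by (intro sum.cong sum.swap refl)
  also have "\<dots> = quad z t"
    by (simp add: quad_def x_matrix_def mult.assoc)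
  finally show ?thesis by (simp add: phase_def y_vector_def xy_monom_def)
qed

lemma phase_add: "phase (z + h) t = phase z t + phase h t"
  by (simp add: phase_eq_sum_monom distrib_right sum.distrib)

lemma tame_xy_monom: "tame (\<lambda>t. of_real (xy_monom v t))"
proof -
  have "tame (\<lambda>t. of_real (if b then t $ i * t $ j else 0))" for b i j
    by (cases b) (auto intro: tame_mult[OF tame_coord tame_coord] tame_const)
  then show ?thesis
    by (cases v) (auto simp: xy_monom_def intro!: tame_sum tame_coord)
qed

section \<open>Bounds for the phase and the domain of convergence\<close>

lemma quad_bound: "\<bar>quad z (t :: real ^ 'd::finite)\<bar> \<le> real (CARD('d) * CARD('d)) * norm z * (norm t)\<^sup>2"
proof -
  have "\<bar>x_matrix z $ i $ j * t $ i * t $ j\<bar> \<le> norm z * norm t * norm t" for i j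
    unfolding abs_mult x_matrix_def
    by (intro mult_mono) (auto simp: component_le_norm_cart)
  then have "\<bar>quad z t\<bar> \<le> (\<Sum>i\<in>(UNIV :: 'd set). \<Sum>j\<in>(UNIV :: 'd set). norm z * norm t * norm t)"
    unfolding quad_def by (intro order_trans[OF sum_abs] sum_mono order_trans[OF sum_abs])
  then show ?thesis by (simp add: power2_eq_square mult_ac)
qed

lemma phase_bound:
  "\<bar>phase z (t :: real ^ 'd::finite)\<bar> \<le> norm z * (real (CARD('d) * CARD('d)) * (norm t + (norm t)\<^sup>2))"
proof -
  have "\<bar>y_vector z $ i * t $ i\<bar> \<le> norm z * norm t" for i
    unfolding abs_mult y_vector_def by (intro mult_mono) (auto simp: component_le_norm_cart)
  then have "\<bar>\<Sum>i\<in>UNIV. y_vector z $ i * t $ i\<bar> \<le> (\<Sum>i\<in>(UNIV :: 'd set). norm z * norm t)"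
    by (intro order_trans[OF sum_abs] sum_mono)
  also have "\<dots> \<le> real (CARD('d) * CARD('d)) * (norm z * norm t)"
  proof -
    have "1 * CARD('d) \<le> CARD('d) * CARD('d)" by (intro mult_right_mono) (simp_all add: Suc_leI)
    then show ?thesis by (simp del: of_nat_mult) (intro mult_right_mono, simp_all del: of_nat_mult)
  qed
  finally have "\<bar>phase z t\<bar> \<le> real (CARD('d) * CARD('d)) * norm z * (norm t)\<^sup>2
      + real (CARD('d) * CARD('d)) * (norm z * norm t)"
    using quad_bound[of z t] unfolding phase_def by linarith
  then show ?thesis by (simp add: algebra_simps)
qed

lemma x_matrix_sym: "x_matrix z $ i $ j = x_matrix z $ j $ i"
proof -
  have eq: "Upair i j = Upair j i" by simp
  show ?thesis unfolding x_matrix_def vec_lambda_beta eq ..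
qed

lemma quad_scale: "quad z (c *\<^sub>R t) = c\<^sup>2 * quad z t"
  by (simp add: quad_def sum_distrib_left power2_eq_square mult_ac)

lemma quad_add: "quad (z + h) t = quad z t + quad h t"
  by (simp add: quad_def x_matrix_def distrib_right sum.distrib)

lemma xy_domain_iff: "z \<in> xy_domain \<longleftrightarrow> (\<forall>t. t \<noteq> 0 \<longrightarrow> quad z t < 0)"
proof -
  have "t \<bullet> ((- x_matrix z) *v t) = - quad z t" for t
    by (simp add: quad_def inner_vec_def matrix_vector_mult_def sum_distrib_left sum_negf mult_ac)
  moreover have "transpose (- x_matrix z) = - x_matrix z"
    unfolding transpose_def vec_eq_iff by (auto intro: x_matrix_sym)
  ultimately show ?thesis by (auto simp: xy_domain_def positive_definite_def)
qed

text \<open>The form attains its maximum on the compact unit sphere, where it is negative;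
  homogeneity of degree two carries the bound to all t.\<close>

lemma xy_domain_coercive:
  assumes "z \<in> xy_domain"
  shows "\<exists>\<epsilon>>0. \<forall>t. quad z t \<le> - \<epsilon> * (norm t)\<^sup>2"
proof -
  let ?S = "sphere (0 :: real ^ 'a) 1"
  have "continuous_on ?S (quad z)" unfolding quad_def by (intro continuous_intros)
  moreover have "?S \<noteq> {}" "compact ?S" by auto
  ultimately obtain s where s: "s \<in> ?S" "\<And>t. t \<in> ?S \<Longrightarrow> quad z t \<le> quad z s"
    using continuous_attains_sup[of ?S "quad z"] by blast
  have "s \<noteq> 0" using s(1) by auto
  then have neg: "quad z s < 0" using assms by (simp add: xy_domain_iff)
  have "quad z t \<le> - (- quad z s) * (norm t)\<^sup>2" for t
  proof (cases "t = 0")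
    case True
    then show ?thesis by (simp add: quad_def)
  next
    case False
    then have t: "t = norm t *\<^sub>R ((1 / norm t) *\<^sub>R t)" by simp
    have "quad z ((1 / norm t) *\<^sub>R t) \<le> quad z s" using False by (intro s(2)) simp
    then have "(norm t)\<^sup>2 * quad z ((1 / norm t) *\<^sub>R t) \<le> (norm t)\<^sup>2 * quad z s"
      by (intro mult_left_mono) auto
    then show ?thesis by (subst t, subst quad_scale) (simp add: mult_ac)
  qed
  then show ?thesis using neg by (intro exI[of _ "- quad z s"]) auto
qed

lemma phase_coercive:
  assumes "z \<in> xy_domain"
  shows "\<exists>\<epsilon>>0. \<exists>b. \<forall>t. phase z t \<le> b * norm t - \<epsilon> * (norm t)\<^sup>2"
proof -
  obtain \<epsilon> where \<epsilon>: "\<epsilon> > 0" "\<And>t. quad z t \<le> - \<epsilon> * (norm t)\<^sup>2" using xy_domain_coercive[OF assms] by blast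
  have "phase z t \<le> norm (y_vector z) * norm t - \<epsilon> * (norm t)\<^sup>2" for t
  proof -
    have "(\<Sum>i\<in>UNIV. y_vector z $ i * t $ i) = y_vector z \<bullet> t" by (simp add: inner_vec_def)
    also have "\<dots> \<le> norm (y_vector z) * norm t" by (rule norm_cauchy_schwarz)
    finally show ?thesis using \<epsilon>(2)[of t] by (simp add: phase_def)
  qed
  then show ?thesis using \<epsilon>(1) by blast
qed

text \<open>By \<open>quad_bound\<close>, a perturbation of norm below \<epsilon> / d^2 changes the
  form by less than the \<epsilon> |t|^2 that coercivity leaves free.\<close>

lemma open_xy_domain: "open (xy_domain :: (real ^ 'd::finite xy) set)"
  unfolding open_dist
proof
  fix z :: "real ^ 'd xy" assume "z \<in> xy_domain"
  then obtain \<epsilon> where \<epsilon>: "\<epsilon> > 0" "\<And>t. quad z t \<le> - \<epsilon> * (norm t)\<^sup>2" using xy_domain_coercive by blast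
  let ?D = "real (CARD('d) * CARD('d))"
  have D: "?D > 0" by simp
  show "\<exists>e>0. \<forall>z'. dist z' z < e \<longrightarrow> z' \<in> xy_domain"
  proof (intro exI[of _ "\<epsilon> / ?D"] conjI allI impI)
    show "\<epsilon> / ?D > 0" using \<epsilon>(1) D by simp
    fix z' assume "dist z' z < \<epsilon> / ?D"
    then have h: "?D * norm (z' - z) < \<epsilon>" using D by (simp add: dist_norm field_simps)
    show "z' \<in> xy_domain" unfolding xy_domain_iff
    proof (intro allI impI)
      fix t :: "real ^ 'd" assume "t \<noteq> 0"
      have "quad z' t = quad z t + quad (z' - z) t" using quad_add[of z "z' - z" t] by simp
      also have "\<dots> \<le> - \<epsilon> * (norm t)\<^sup>2 + ?D * norm (z' - z) * (norm t)\<^sup>2"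
        using \<epsilon>(2)[of t] quad_bound[of "z' - z" t] by linarith
      also have "\<dots> = (?D * norm (z' - z) - \<epsilon>) * (norm t)\<^sup>2" by (simp add: algebra_simps)
      also have "\<dots> < 0" using h \<open>t \<noteq> 0\<close> by (simp add: mult_neg_pos)
      finally show "quad z' t < 0" .
    qed
  qed
qed

section \<open>Differentiation under the integral sign\<close>

definition laplace :: "(real ^ 'd::finite \<Rightarrow> complex) \<Rightarrow> real ^ 'd xy \<Rightarrow> complex" where
  "laplace a z = (LINT t|lborel. a t * of_real (exp (phase z t)))"

lemma laplace_integrable:
  assumes "tame a" "z \<in> xy_domain"
  shows "integrable lborel (\<lambda>t. a t * of_real (exp (phase z t)))"
proof -
  obtain \<epsilon> b where \<epsilon>: "\<epsilon> > 0" "\<And>t. phase z t \<le> b * norm t - \<epsilon> * (norm t)\<^sup>2"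
    using phase_coercive[OF assms(2)] by blast
  show ?thesis
  proof (rule Bochner_Integration.integrable_bound[OF tame_integrable[OF assms(1) \<epsilon>(1), of b]])
    show "(\<lambda>t. a t * of_real (exp (phase z t))) \<in> borel_measurable lborel"
      using tame_measurable[OF assms(1)] unfolding phase_def quad_def by measurable
    show "AE t in lborel. norm (a t * of_real (exp (phase z t)))
        \<le> norm (a t * of_real (exp (b * norm t - \<epsilon> * (norm t)\<^sup>2)))"
      by (rule AE_I2) (simp add: norm_mult mult_left_mono \<epsilon>(2))
  qed
qed

text \<open>A second-order remainder valid for all s, obtained from 1 + s \<le> exp s at s and at
  -s.\<close>

lemma exp_remainder: "\<bar>exp s - 1 - s\<bar> \<le> s\<^sup>2 * exp \<bar>s\<bar>" for s :: real
proof -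
  have 1: "1 + s \<le> exp s" by (rule exp_ge_add_one_self)
  have "(1 - s) * exp s \<le> exp (- s) * exp s"
    using exp_ge_add_one_self[of "- s"] by (intro mult_right_mono) auto
  then have 2: "exp s - 1 - s \<le> s * (exp s - 1)" by (simp add: mult_exp_exp algebra_simps)
  have "s * (exp s - 1) \<le> s\<^sup>2 * exp \<bar>s\<bar>"
  proof (cases "s \<ge> 0")
    case True
    have "exp s - 1 \<le> s * exp s" using \<open>(1 - s) * exp s \<le> exp (- s) * exp s\<close>
      by (simp add: mult_exp_exp algebra_simps)
    then have "s * (exp s - 1) \<le> s * (s * exp s)" using True by (rule mult_left_mono)
    then show ?thesis using True by (simp add: power2_eq_square mult.assoc)
  next
    case False
    have "s * (exp s - 1) \<le> s * s" by (rule mult_left_mono_neg) (use False 1 in linarith)+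
    also have "\<dots> \<le> s\<^sup>2 * exp \<bar>s\<bar>" using mult_left_mono[of 1 "exp \<bar>s\<bar>" "s\<^sup>2"] by (simp add: power2_eq_square)
    finally show ?thesis .
  qed
  then show ?thesis using 1 2 by linarith
qed

text \<open>The quadratic remainder of exp bounds the error of the linear approximation by |h|^2
  times one integrable function, uniformly for small h. This gives the full derivative and not only
  the partial ones.\<close>

lemma laplace_has_derivative:
  fixes z :: "real ^ 'd::finite xy"
  assumes a: "tame a" and z: "z \<in> xy_domain"
  shows "(laplace a has_derivative
      (\<lambda>h. \<Sum>v\<in>UNIV. of_real (h $ v) * laplace (\<lambda>t. a t * of_real (xy_monom v t)) z)) (at z)"
proof -
  define L where "L h = (\<Sum>v\<in>UNIV. of_real (h $ v) * laplace (\<lambda>t. a t * of_real (xy_monom v t)) z)"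
    for h :: "real ^ 'd xy"
  have L_int: "integrable lborel (\<lambda>t. a t * of_real (phase h t) * of_real (exp (phase z t)))"
    and L_eq: "L h = (LINT t|lborel. a t * of_real (phase h t) * of_real (exp (phase z t)))" for h
  proof -
    let ?g = "\<lambda>v t. of_real (h $ v) * (a t * of_real (xy_monom v t) * of_real (exp (phase z t)))"
    have int: "integrable lborel (?g v)" for v
      by (intro integrable_mult_right laplace_integrable tame_mult a tame_xy_monom z)
    have eq: "a t * of_real (phase h t) * of_real (exp (phase z t)) = (\<Sum>v\<in>UNIV. ?g v t)" for t
      by (simp add: phase_eq_sum_monom[of h] sum_distrib_left sum_distrib_right mult_ac)
    show "integrable lborel (\<lambda>t. a t * of_real (phase h t) * of_real (exp (phase z t)))"
      unfolding eq by (intro Bochner_Integration.integrable_sum int)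
    show "L h = (LINT t|lborel. a t * of_real (phase h t) * of_real (exp (phase z t)))"
      unfolding eq L_def laplace_def by (subst Bochner_Integration.integral_sum) (simp_all add: int)
  qed
  obtain \<epsilon> b where \<epsilon>: "\<epsilon> > 0" "\<And>t. phase z t \<le> b * norm t - \<epsilon> * (norm t)\<^sup>2"
    using phase_coercive[OF z] by blast
  obtain e where e: "e > 0" "ball z e \<subseteq> xy_domain"
    using open_xy_domain z by (meson openE)
  define K where "K = real (CARD('d) * CARD('d))"
  have K: "K > 0" by (simp add: K_def)
  define r where "r t = K * (norm t + (norm t)\<^sup>2)" for t :: "real ^ 'd"
  have r0: "r t \<ge> 0" for t using K by (simp add: r_def)
  \<comment> \<open>Small enough that z + h stays in the domain and that the phase of h spends at
    most half of the quadratic decay of the kernel at z.\<close>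
  define \<delta> where "\<delta> = min e (\<epsilon> / (2 * K))"
  have \<delta>: "\<delta> > 0" "\<delta> \<le> e" "\<delta> * K \<le> \<epsilon> / 2" using e(1) \<epsilon>(1) K by (auto simp: \<delta>_def min_def field_simps)
  \<comment> \<open>The factor \<open>(r t)\<^sup>2\<close> comes from the square in the remainder
    of exp, after |h|^2 has been taken out.\<close>
  define A where "A t = a t * (of_real (r t))\<^sup>2" for t
  have tameA: "tame A" unfolding A_def r_def of_real_mult of_real_add of_real_power
    by (intro tame_mult a tame_power tame_add tame_norm tame_const)
  define g where "g t = A t * of_real (exp ((b + \<epsilon> / 2) * norm t - (\<epsilon> / 2) * (norm t)\<^sup>2))" for t
  have g: "integrable lborel g" unfolding g_def
    by (rule tame_integrable[OF tameA]) (use \<epsilon> in simp)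
  define M where "M = (LINT t|lborel. norm (g t))"
  have remainder: "norm (laplace a (z + h) - laplace a z - L h) \<le> (norm h)\<^sup>2 * M" if h: "norm h < \<delta>" for h
  proof -
    have zh: "z + h \<in> xy_domain" using e(2) h \<delta>(2) by (auto simp: dist_norm)
    let ?k = "\<lambda>t. a t * of_real (exp (phase (z + h) t)) - a t * of_real (exp (phase z t))
        - a t * of_real (phase h t) * of_real (exp (phase z t))"
    have intk: "integrable lborel ?k"
      by (intro Bochner_Integration.integrable_diff laplace_integrable a z zh L_int)
    have "laplace a (z + h) - laplace a z - L h = (LINT t|lborel. ?k t)"
      using laplace_integrable[OF a z] laplace_integrable[OF a zh] L_int
      by (simp add: laplace_def L_eq)
    also have "norm \<dots> \<le> (LINT t|lborel. (norm h)\<^sup>2 * norm (g t))"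
    proof (rule Bochner_Integration.integral_norm_bound_integral)
      show "integrable lborel (\<lambda>t. (norm h)\<^sup>2 * norm (g t))"
        using g by (intro integrable_mult_right integrable_norm)
      fix t :: "real ^ 'd"
      let ?s = "phase h t" and ?E = "exp (phase z t)"
      have s: "\<bar>?s\<bar> \<le> norm h * r t" using phase_bound[of h t] by (simp add: r_def K_def)
      have "norm h * r t \<le> \<delta> * r t" using h r0 by (intro mult_right_mono) auto
      also have "\<dots> \<le> (\<epsilon> / 2) * (norm t + (norm t)\<^sup>2)"
        using mult_right_mono[OF \<delta>(3), of "norm t + (norm t)\<^sup>2"] by (simp add: r_def mult.assoc)
      finally have s2: "\<bar>?s\<bar> \<le> (\<epsilon> / 2) * (norm t + (norm t)\<^sup>2)" using s by simp
      have "?k t = a t * of_real (?E * (exp ?s - 1 - ?s))"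
        by (simp add: phase_add exp_add algebra_simps)
      then have "norm (?k t) = norm (a t) * (?E * \<bar>exp ?s - 1 - ?s\<bar>)"
        by (simp only: norm_mult norm_of_real abs_mult abs_exp_cancel)
      also have "\<dots> \<le> norm (a t) * (?E * ((norm h * r t)\<^sup>2 * exp ((\<epsilon> / 2) * (norm t + (norm t)\<^sup>2))))"
      proof (intro mult_left_mono order_trans[OF exp_remainder] mult_mono)
        show "?s\<^sup>2 \<le> (norm h * r t)\<^sup>2" using s by (metis abs_ge_zero power2_abs power_mono)
      qed (use s2 in auto)
      also have "\<dots> = norm (a t) * (norm h * r t)\<^sup>2 * exp (phase z t + (\<epsilon> / 2) * (norm t + (norm t)\<^sup>2))"
        by (simp add: exp_add mult_ac)
      also have "\<dots> \<le> norm (a t) * (norm h * r t)\<^sup>2 * exp ((b + \<epsilon> / 2) * norm t - (\<epsilon> / 2) * (norm t)\<^sup>2)"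
        using \<epsilon>(2)[of t] by (intro mult_left_mono) (auto simp: algebra_simps)
      also have "\<dots> = (norm h)\<^sup>2 * norm (g t)"
        using r0[of t] by (simp add: g_def A_def norm_mult norm_power power_mult_distrib mult_ac)
      finally show "norm (?k t) \<le> (norm h)\<^sup>2 * norm (g t)" .
    qed (rule intk)
    also have "\<dots> = (norm h)\<^sup>2 * M" by (simp add: M_def)
    finally show ?thesis .
  qed
  show ?thesis unfolding L_def[symmetric]
  proof (rule has_derivativeI_sandwich[OF \<delta>(1), where H = "\<lambda>w. M * norm (w - z)"])
    have "linear L"
    proof (rule linearI)
      show "L (h + k) = L h + L k" for h k by (simp add: L_def distrib_right sum.distrib)
      show "L (c *\<^sub>R h) = c *\<^sub>R L h" for c h
        by (simp add: L_def scaleR_conv_of_real[of c "_ :: complex"] sum_distrib_left mult.assoc)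
    qed
    then show "bounded_linear L" by (simp add: linear_conv_bounded_linear)
    fix w assume "w \<noteq> z" "dist w z < \<delta>"
    then show "norm (laplace a w - laplace a z - L (w - z)) / norm (w - z) \<le> M * norm (w - z)"
      using remainder[of "w - z"] by (simp add: dist_norm divide_simps power2_eq_square mult_ac)
  next
    have "((\<lambda>w. M * norm (w - z)) \<longlongrightarrow> M * norm (z - z)) (at z)" by (intro tendsto_intros)
    then show "((\<lambda>w. M * norm (w - z)) \<longlongrightarrow> 0) (at z)" by simp
  qed
qed

text \<open>The integral formula for a derivative holds only inside the domain, so locality is what
  permits differentiating it again.\<close>

lemma partial_cong_open:
  assumes "open U" "x \<in> U" "\<And>y. y \<in> U \<Longrightarrow> f y = g y"
  shows "partial i f x = partial i g x"
proof -
  have "((\<lambda>h. x + h *\<^sub>R axis i 1) \<longlongrightarrow> x + 0 *\<^sub>R axis i 1) (nhds (0 :: real))"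
    by (intro tendsto_intros filterlim_ident)
  then have "eventually (\<lambda>h. x + h *\<^sub>R axis i 1 \<in> U) (nhds (0 :: real))"
    using assms(1,2) by (intro topological_tendstoD) auto
  then have "eventually (\<lambda>h. f (x + h *\<^sub>R axis i 1) = g (x + h *\<^sub>R axis i 1)) (nhds (0 :: real))"
    by eventually_elim (rule assms(3))
  then have "((\<lambda>h. f (x + h *\<^sub>R axis i 1)) has_vector_derivative D) (at 0) \<longleftrightarrow>
      ((\<lambda>h. g (x + h *\<^sub>R axis i 1)) has_vector_derivative D) (at 0)" for D
    by (intro has_vector_derivative_cong_ev) (auto dest: eventually_nhds_x_imp_x)
  then show ?thesis unfolding partial_def vector_derivative_def by simp
qed

lemma has_derivative_imp_partial:
  assumes "(f has_derivative f') (at x)"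
  shows "partial i f x = f' (axis i 1)"
    and "((\<lambda>h. f (x + h *\<^sub>R axis i 1)) has_vector_derivative f' (axis i 1)) (at 0)"
proof -
  have "((\<lambda>h :: real. x + h *\<^sub>R axis i 1) has_derivative (\<lambda>h. h *\<^sub>R axis i 1)) (at 0)"
    by (auto intro!: derivative_eq_intros)
  from diff_chain_at[OF this, of f f'] assms
  have "((\<lambda>h. f (x + h *\<^sub>R axis i 1)) has_derivative (\<lambda>h. f' (h *\<^sub>R axis i 1))) (at 0)"
    by (simp add: o_def)
  then show *: "((\<lambda>h. f (x + h *\<^sub>R axis i 1)) has_vector_derivative f' (axis i 1)) (at 0)"
    using linear_cmul[OF has_derivative_linear[OF assms]] by (simp add: has_vector_derivative_def)
  show "partial i f x = f' (axis i 1)" unfolding partial_def by (rule vector_derivative_at[OF *])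
qed

lemma differentiable_partial:
  assumes "f differentiable (at x)"
  shows "((\<lambda>h. f (x + h *\<^sub>R axis i 1)) has_vector_derivative partial i f x) (at 0)"
  using assms has_derivative_imp_partial[of f _ x i] unfolding differentiable_def by metis

lemma partial_laplace:
  assumes "tame a" "z \<in> xy_domain"
  shows "partial v (laplace a) z = laplace (\<lambda>t. a t * of_real (xy_monom v t)) z"
proof -
  have "(\<Sum>w\<in>UNIV. of_real ((axis v 1 :: real ^ 'a xy) $ w) * laplace (\<lambda>t. a t * of_real (xy_monom w t)) z)
      = (\<Sum>w\<in>UNIV. if w = v then laplace (\<lambda>t. a t * of_real (xy_monom w t)) z else 0)"
    by (rule sum.cong) (auto simp: axis_def)
  then show ?thesis using has_derivative_imp_partial(1)[OF laplace_has_derivative[OF assms], of v] by simp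
qed

lemma tame_prod_list: "(\<And>v. tame (a v)) \<Longrightarrow> tame (\<lambda>t. prod_list (map (\<lambda>v. a v t) l))"
  by (induction l) (auto intro: tame_mult tame_const)

text \<open>Multiplying by \<open>xy_monom\<close> keeps an amplitude tame, so the formula for one
  derivative can be iterated.\<close>

lemma foldr_partial_laplace:
  assumes "tame a" "z \<in> xy_domain"
  shows "foldr partial l (laplace a) z
    = laplace (\<lambda>t. a t * prod_list (map (\<lambda>v. of_real (xy_monom v t)) l)) z"
  using assms(2)
proof (induction l arbitrary: z)
  case (Cons v l)
  have tame: "tame (\<lambda>t. a t * prod_list (map (\<lambda>v. of_real (xy_monom v t)) l))"
    by (intro tame_mult assms tame_prod_list tame_xy_monom)
  have "foldr partial (v # l) (laplace a) z
      = partial v (laplace (\<lambda>t. a t * prod_list (map (\<lambda>v. of_real (xy_monom v t)) l))) z"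
    using partial_cong_open[OF open_xy_domain Cons.prems Cons.IH] by simp
  also have "\<dots> = laplace (\<lambda>t. a t * prod_list (map (\<lambda>v. of_real (xy_monom v t)) l) * of_real (xy_monom v t)) z"
    by (rule partial_laplace[OF tame Cons.prems])
  finally show ?case by (simp add: mult_ac)
qed simp

lemma differentiable_cong_open:
  assumes "open U" "x \<in> U" "\<And>y. y \<in> U \<Longrightarrow> f y = g y" "g differentiable (at x)"
  shows "f differentiable (at x)"
  using assms has_derivative_transform_within_open[of g _ x UNIV U f] unfolding differentiable_def by (metis)

lemma smooth_on_laplace:
  assumes "tame a" shows "smooth_on xy_domain (laplace a)"
  unfolding smooth_on_def
proof (intro allI ballI)
  fix l and z :: "real ^ 'a xy" assume z: "z \<in> xy_domain"
  have tame: "tame (\<lambda>t. a t * prod_list (map (\<lambda>v. of_real (xy_monom v t)) l))"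
    by (intro tame_mult assms tame_prod_list tame_xy_monom)
  show "foldr partial l (laplace a) differentiable (at z)"
  proof (rule differentiable_cong_open[OF open_xy_domain z])
    show "laplace (\<lambda>t. a t * prod_list (map (\<lambda>v. of_real (xy_monom v t)) l)) differentiable (at z)"
      using laplace_has_derivative[OF tame z] unfolding differentiable_def by blast
  qed (rule foldr_partial_laplace[OF assms])
qed

text \<open>Shows that the choice made in \<open>multi_partial\<close> has a witness for every
  exponent vector.\<close>

lemma ex_count_list: "\<exists>l. \<forall>v :: 'a::finite. count_list l v = \<beta> v"
proof -
  obtain l where l: "mset l = Abs_multiset \<beta>" using ex_mset by blast
  have "count_list l v = \<beta> v" for v
    using l by (simp add: count_mset[symmetric] Abs_multiset_inverse)
  then show ?thesis by blast
qed

lemma prod_list_map_eq_prod_count: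
  fixes g :: "'a::finite \<Rightarrow> 'b::comm_monoid_mult"
  shows "prod_list (map g l) = (\<Prod>v\<in>UNIV. g v ^ count_list l v)"
proof (induction l)
  case (Cons w l)
  have "(\<Prod>v\<in>UNIV. g v ^ count_list (w # l) v) = (\<Prod>v\<in>UNIV. (if v = w then g v else 1) * g v ^ count_list l v)"
    by (rule prod.cong) auto
  then show ?case using Cons by (simp add: prod.distrib)
qed simp

lemma multi_partial_laplace:
  assumes "tame a" "z \<in> xy_domain"
  shows "multi_partial \<beta> (laplace a) z = laplace (\<lambda>t. a t * (\<Prod>v\<in>UNIV. of_real (xy_monom v t) ^ \<beta> v)) z"
  using someI_ex[OF ex_count_list[of \<beta>]]
  by (simp add: multi_partial_def foldr_partial_laplace[OF assms] prod_list_map_eq_prod_count)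

section \<open>Integration by parts against cutoffs\<close>

lemma weyl_act_superset:
  assumes "finite A" "weyl_supp P \<subseteq> A"
  shows "weyl_act P f x = (\<Sum>m\<in>A. weyl_coeff P m *
    (of_real (\<Prod>v\<in>UNIV. (x $ v) ^ fst m v) * multi_partial (snd m) f x))"
proof -
  have "weyl_act P f x = (\<Sum>m\<in>weyl_supp P. weyl_coeff P m *
    (of_real (\<Prod>v\<in>UNIV. (x $ v) ^ fst m v) * multi_partial (snd m) f x))"
    by (simp add: weyl_act_def case_prod_beta mult.assoc)
  also have "\<dots> = (\<Sum>m\<in>A. weyl_coeff P m *
    (of_real (\<Prod>v\<in>UNIV. (x $ v) ^ fst m v) * multi_partial (snd m) f x))"
    by (rule sum.mono_neutral_left) (use assms in \<open>auto simp: weyl_supp_def\<close>)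
  finally show ?thesis .
qed

lemma weyl_act_add: "weyl_act (P + Q) f x = weyl_act P f x + weyl_act Q f x"
proof -
  let ?A = "weyl_supp P \<union> weyl_supp Q \<union> weyl_supp (P + Q)"
  show ?thesis
    by (subst (1 2 3) weyl_act_superset[of ?A]) (auto simp: sum.distrib distrib_right)
qed

lemma weyl_act_scale: "weyl_act (weyl_scale c P) f x = c * weyl_act P f x"
proof -
  let ?A = "weyl_supp P \<union> weyl_supp (weyl_scale c P)"
  show ?thesis
    by (subst (1 2) weyl_act_superset[of ?A]) (auto simp: sum_distrib_left mult.assoc)
qed

lemma weyl_act_zero: "weyl_act 0 f x = 0"
  using weyl_act_scale[of 0 0 f x] by simp

lemma weyl_act_diff: "weyl_act (P - Q) f x = weyl_act P f x - weyl_act Q f x"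
  using weyl_act_add[of "P - Q" Q f x] by simp

lemma weyl_act_uminus: "weyl_act (- P) f x = - weyl_act P f x"
  using weyl_act_diff[of 0 P f x] by (simp add: weyl_act_zero)

lemma weyl_act_sum: "weyl_act (sum P A) f x = (\<Sum>a\<in>A. weyl_act (P a) f x)"
  by (induction A rule: infinite_finite_induct) (simp_all add: weyl_act_zero weyl_act_add)

lemma weyl_act_monom:
  "weyl_act (weyl_monom a b) f x = of_real (\<Prod>v\<in>UNIV. (x $ v) ^ a v) * multi_partial b f x"
  by (simp add: weyl_act_def)

lemma prod_power_Suc:
  fixes g :: "'a::finite \<Rightarrow> 'b::comm_monoid_mult"
  shows "(\<Prod>v\<in>UNIV. g v ^ (a(i := Suc (a i))) v) = g i * (\<Prod>v\<in>UNIV. g v ^ a v)"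
proof -
  have "(\<Prod>v\<in>UNIV. g v ^ (a(i := Suc (a i))) v) = (\<Prod>v\<in>UNIV. (if v = i then g v else 1) * g v ^ a v)"
    by (rule prod.cong) auto
  then show ?thesis by (simp add: prod.distrib)
qed

lemma weyl_act_x_mult: "weyl_act (weyl_x i * P) f x = of_real (x $ i) * weyl_act P f x"
proof (induction P rule: weyl_linear_induct)
  case (monom a b)
  show ?case unfolding weyl_x_monom weyl_act_monom prod_power_Suc by simp
qed (simp_all add: weyl_act_zero weyl_act_add weyl_act_scale distrib_left weyl_scale_times_right mult.left_commute)

section \<open>Compactly supported test functions\<close>

definition tmon :: "('d::finite \<Rightarrow> nat) \<Rightarrow> real ^ 'd \<Rightarrow> real" where
  "tmon \<gamma> t = (\<Prod>v\<in>UNIV. (t $ v) ^ \<gamma> v)"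

text \<open>It is only continuous; its powers supply as many derivatives as are wanted. The radius n
  + 1 avoids a division by zero, and its square in the denominator is the factor that later sends
  the correction terms to 0.\<close>

definition cutoff :: "nat \<Rightarrow> real ^ 'd \<Rightarrow> real" where
  "cutoff n t = max 0 (1 - (norm t)\<^sup>2 / (real (Suc n))\<^sup>2)"

lemma tmon_Suc: "tmon (\<gamma>(i := Suc (\<gamma> i))) t = t $ i * tmon \<gamma> t"
  unfolding tmon_def by (rule prod_power_Suc)

lemma tmon_derivative:
  "((\<lambda>s. tmon \<gamma> (t + s *\<^sub>R axis i 1)) has_real_derivative
     real (\<gamma> i) * tmon (\<gamma>(i := \<gamma> i - 1)) t) (at 0)"
proof -
  let ?p = "\<Prod>v\<in>UNIV - {i}. (t $ v) ^ \<gamma> v"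
  have "(\<Prod>v\<in>UNIV - {i}. ((t + s *\<^sub>R axis i 1) $ v) ^ \<gamma> v) = ?p" for s
    by (rule prod.cong) (auto simp: axis_def)
  then have 1: "tmon \<gamma> (t + s *\<^sub>R axis i 1) = (t $ i + s) ^ \<gamma> i * ?p" for s
    unfolding tmon_def by (subst prod.remove[of UNIV i]) (simp_all add: axis_def)
  have "(\<Prod>v\<in>UNIV - {i}. (t $ v) ^ (\<gamma>(i := \<gamma> i - 1)) v) = ?p"
    by (rule prod.cong) auto
  then have 2: "tmon (\<gamma>(i := \<gamma> i - 1)) t = (t $ i) ^ (\<gamma> i - 1) * ?p"
    unfolding tmon_def by (subst prod.remove[of UNIV i]) simp_all
  show ?thesis unfolding 1 2
    by (auto intro!: derivative_eq_intros)
qed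

text \<open>An exponent of at least two removes the kink at 0: the difference quotient there is
  bounded by a positive power of max 0 h.\<close>

lemma max_power_derivative:
  "((\<lambda>x :: real. max 0 x ^ Suc (Suc k)) has_real_derivative real (Suc (Suc k)) * max 0 x ^ Suc k) (at x)"
proof (cases "x = 0")
  case True
  have "((\<lambda>h. max 0 h ^ Suc (Suc k) / h) \<longlongrightarrow> 0) (at (0 :: real))"
  proof (rule Lim_null_comparison)
    show "eventually (\<lambda>h :: real. norm (max 0 h ^ Suc (Suc k) / h) \<le> max 0 h ^ Suc k) (at 0)"
      by (rule always_eventually) (auto simp: max_def)
    have "((\<lambda>h :: real. max 0 h ^ Suc k) \<longlongrightarrow> max 0 0 ^ Suc k) (at 0)"
      by (intro tendsto_intros)
    then show "((\<lambda>h :: real. max 0 h ^ Suc k) \<longlongrightarrow> 0) (at 0)" by simp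
  qed
  then show ?thesis unfolding True DERIV_def by simp
next
  case False
  then consider "x > 0" | "x < 0" by linarith
  then show ?thesis
  proof cases
    case 1
    have "((\<lambda>x :: real. x ^ Suc (Suc k)) has_real_derivative real (Suc (Suc k)) * x ^ Suc k) (at x)"
      by (rule DERIV_cong[OF DERIV_pow]) simp
    then have "((\<lambda>x :: real. max 0 x ^ Suc (Suc k)) has_real_derivative real (Suc (Suc k)) * x ^ Suc k) (at x)"
      by (rule has_field_derivative_transform_within_open[where S = "{0<..}"]) (use 1 in \<open>auto simp: max_def\<close>)
    then show ?thesis using 1 by (simp add: max_def)
  next
    case 2
    have "((\<lambda>x :: real. 0 :: real) has_real_derivative 0) (at x)" by simp
    then have "((\<lambda>x :: real. max 0 x ^ Suc (Suc k)) has_real_derivative 0) (at x)"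
      by (rule has_field_derivative_transform_within_open[where S = "{..<0}"]) (use 2 in \<open>auto simp: max_def\<close>)
    then show ?thesis using 2 by (simp add: max_def)
  qed
qed

lemma cutoff_derivative:
  fixes t :: "real ^ 'd::finite"
  shows "((\<lambda>s. cutoff n (t + s *\<^sub>R axis i 1) ^ Suc (Suc k)) has_real_derivative
     real (Suc (Suc k)) * cutoff n t ^ Suc k * (- (2 * t $ i) / (real (Suc n))\<^sup>2)) (at 0)"
proof -
  have "(norm (t + s *\<^sub>R axis i 1))\<^sup>2 = (norm t)\<^sup>2 + 2 * s * t $ i + s\<^sup>2" for s
  proof -
    have "t \<bullet> axis i 1 = t $ i" "axis i 1 \<bullet> t = t $ i" "axis i (1 :: real) \<bullet> axis i 1 = 1"
      by (simp_all add: inner_axis inner_axis' inner_axis_axis)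
    then show ?thesis
      unfolding power2_norm_eq_inner inner_add_left inner_add_right by (simp add: power2_eq_square)
  qed
  then have eq: "cutoff n (t + s *\<^sub>R axis i 1) ^ Suc (Suc k)
      = max 0 (1 - ((norm t)\<^sup>2 + 2 * s * t $ i + s\<^sup>2) / (real (Suc n))\<^sup>2) ^ Suc (Suc k)" for s
    by (simp only: cutoff_def)
  define r where "r s = 1 - ((norm t)\<^sup>2 + 2 * s * t $ i + s\<^sup>2) / (real (Suc n))\<^sup>2" for s
  have "((\<lambda>s. 1 - (a + 2 * s * b + s\<^sup>2) * c) has_real_derivative - (2 * b) * c) (at 0)" for a b c :: real
    by (auto intro!: derivative_eq_intros)
  from this[of _ "t $ i" "inverse ((real (Suc n))\<^sup>2)"]
  have "(r has_real_derivative - (2 * t $ i) / (real (Suc n))\<^sup>2) (at 0)"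
    unfolding r_def divide_inverse .
  from DERIV_chain2[OF max_power_derivative[of k "r 0"] this]
  show ?thesis unfolding eq r_def by (simp add: cutoff_def del: of_nat_Suc power_Suc)
qed

text \<open>An exact expansion in s. Its linear coefficient is the negative of
  \<open>phi (weyl_d i)\<close> with t_k put for the derivative in y_k.\<close>

lemma phase_shift:
  "phase z (t + s *\<^sub>R axis i 1) = phase z t
     + s * (2 * (\<Sum>k\<in>UNIV. x_matrix z $ i $ k * t $ k) + y_vector z $ i) + s\<^sup>2 * x_matrix z $ i $ i"
proof -
  let ?e = "\<lambda>v. if v = i then s else 0"
  have comp: "(t + s *\<^sub>R axis i 1) $ v = t $ v + ?e v" for v by (simp add: axis_def)
  have "quad z (t + s *\<^sub>R axis i 1) = quad z t
      + (\<Sum>j\<in>UNIV. \<Sum>k\<in>UNIV. ?e j * (x_matrix z $ j $ k * t $ k))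
      + (\<Sum>j\<in>UNIV. \<Sum>k\<in>UNIV. ?e k * (x_matrix z $ j $ k * t $ j))
      + (\<Sum>j\<in>UNIV. \<Sum>k\<in>UNIV. ?e k * (?e j * x_matrix z $ j $ k))"
    unfolding quad_def comp by (simp only: sum.distrib[symmetric]) (simp add: algebra_simps)
  also have "(\<Sum>j\<in>UNIV. \<Sum>k\<in>UNIV. ?e j * (x_matrix z $ j $ k * t $ k)) = s * (\<Sum>k\<in>UNIV. x_matrix z $ i $ k * t $ k)"
    by (subst sum.swap) (simp add: sum_distrib_left if_distrib[of "\<lambda>x. x * _"] cong: if_cong)
  also have "(\<Sum>j\<in>UNIV. \<Sum>k\<in>UNIV. ?e k * (x_matrix z $ j $ k * t $ j)) = s * (\<Sum>k\<in>UNIV. x_matrix z $ i $ k * t $ k)"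
    by (simp add: sum_distrib_left if_distrib[of "\<lambda>x. x * _"] x_matrix_sym[of z _ i] cong: if_cong)
  also have "(\<Sum>j\<in>UNIV. \<Sum>k\<in>UNIV. ?e k * (?e j * x_matrix z $ j $ k)) = s\<^sup>2 * x_matrix z $ i $ i"
  proof -
    have "(\<Sum>k\<in>UNIV. ?e k * (?e j * x_matrix z $ j $ k)) = (if j = i then s * (s * x_matrix z $ i $ i) else 0)" for j
      by (simp add: if_distrib[of "\<lambda>x. x * _"] cong: if_cong)
    then show ?thesis by (simp add: power2_eq_square mult.assoc)
  qed
  finally have q: "quad z (t + s *\<^sub>R axis i 1) = quad z t
      + 2 * s * (\<Sum>k\<in>UNIV. x_matrix z $ i $ k * t $ k) + s\<^sup>2 * x_matrix z $ i $ i" by simp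
  have "(\<Sum>v\<in>UNIV. y_vector z $ v * (t + s *\<^sub>R axis i 1) $ v)
      = (\<Sum>v\<in>UNIV. y_vector z $ v * t $ v) + s * y_vector z $ i"
    unfolding comp by (simp add: distrib_left sum.distrib if_distrib[of "\<lambda>x. _ * x"] cong: if_cong)
  with q show ?thesis unfolding phase_def by (simp add: algebra_simps)
qed

lemma integrable_continuous_support:
  fixes g :: "real ^ 'd::finite \<Rightarrow> complex"
  assumes "continuous_on UNIV g" "\<And>t. norm t > R \<Longrightarrow> g t = 0"
  shows "integrable lborel g"
proof -
  have "(\<lambda>t. indicator (cball 0 R) t *\<^sub>R g t) = g"
    using assms(2) by (auto simp: fun_eq_iff indicator_def not_le)
  then show ?thesis
    using borel_integrable_compact[OF compact_cball continuous_on_subset[OF assms(1)], of 0 R] by simp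
qed

text \<open>
  The integral of \<open>h\<close> is invariant under translation by \<open>s e\<^sub>i\<close>; differentiate at \<open>s = 0\<close>.
\<close>

lemma integral_directional_derivative_eq_0:
  fixes h h' :: "real ^ 'd::finite \<Rightarrow> complex"
  assumes h: "continuous_on UNIV h" and h': "continuous_on UNIV h'"
    and deriv: "\<And>t. ((\<lambda>s. h (t + s *\<^sub>R e)) has_vector_derivative h' t) (at 0)"
    and supp: "\<And>t. norm t > R \<Longrightarrow> h t = 0" "\<And>t. norm t > R \<Longrightarrow> h' t = 0"
    and e: "norm e = 1"
  shows "(LINT t|lborel. h' t) = 0"
proof -
  have "bounded (h' ` cball 0 R)"
    by (intro compact_imp_bounded compact_continuous_image continuous_on_subset[OF h']) auto
  then obtain B where B: "B > 0" "\<And>t. t \<in> cball 0 R \<Longrightarrow> norm (h' t) \<le> B"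
    unfolding bounded_pos by auto
  have B': "norm (h' t) \<le> B" for t
    using B(2)[of t] supp(2)[of t] B(1) by (cases "norm t \<le> R") auto
  have deriv': "((\<lambda>s. h (t + s *\<^sub>R e)) has_vector_derivative h' (t + a *\<^sub>R e)) (at a)" for t a
  proof -
    have "((\<lambda>s. h (t + a *\<^sub>R e + (s - a) *\<^sub>R e)) has_vector_derivative 1 *\<^sub>R h' (t + a *\<^sub>R e)) (at a)"
    proof (rule vector_diff_chain_at[of "\<lambda>s. s - a", unfolded o_def])
      show "((\<lambda>s. s - a) has_vector_derivative 1) (at a)" by (auto intro!: derivative_eq_intros)
      show "((\<lambda>s. h (t + a *\<^sub>R e + s *\<^sub>R e)) has_vector_derivative h' (t + a *\<^sub>R e)) (at (a - a))"
        using deriv by simp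
    qed
    then show ?thesis by (simp add: algebra_simps)
  qed
  \<comment> \<open>The mean value bound along the line dominates all difference quotients at
    once.\<close>
  have lip: "norm (h (t + s *\<^sub>R e) - h t) \<le> B * \<bar>s\<bar>" for t s
  proof -
    have "norm (h (t + s *\<^sub>R e) - h (t + 0 *\<^sub>R e)) \<le> B * norm (s - 0)"
    proof (rule differentiable_bound[of UNIV])
      show "((\<lambda>s. h (t + s *\<^sub>R e)) has_derivative (\<lambda>k. k *\<^sub>R h' (t + a *\<^sub>R e))) (at a within UNIV)" for a
        using deriv'[of t a] by (simp add: has_vector_derivative_def)
      show "onorm (\<lambda>k. k *\<^sub>R h' (t + a *\<^sub>R e)) \<le> B" for a
        by (rule onorm_le) (simp add: mult.commute[of B] mult_left_mono B')
    qed auto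
    then show ?thesis by simp
  qed
  define s where "s n = 1 / real (Suc n)" for n
  have s: "s n > 0" "s n \<le> 1" for n by (simp_all add: s_def)
  define D where "D n t = (h (t + s n *\<^sub>R e) - h t) /\<^sub>R s n" for n t
  have hm: "h \<in> borel_measurable borel" and hm': "h' \<in> borel_measurable borel"
    using h h' by (simp_all add: borel_measurable_continuous_onI)
  have inth: "integrable lborel h" by (rule integrable_continuous_support[OF h supp(1)])
  have trans: "integrable lborel (\<lambda>t. h (t + c))" "(LINT t|lborel. h (t + c)) = (LINT t|lborel. h t)" for c
  proof -
    have "integrable (distr lborel borel ((+) c)) h" by (simp add: lborel_distr_plus inth)
    then have "integrable lborel (\<lambda>t. h (c + t))" by (subst (asm) integrable_distr_eq) (auto intro: hm)
    then show "integrable lborel (\<lambda>t. h (t + c))" by (simp add: add.commute)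
    have "(LINT t|distr lborel borel ((+) c). h t) = (LINT t|lborel. h (c + t))"
      by (rule integral_distr) (auto intro: hm)
    then show "(LINT t|lborel. h (t + c)) = (LINT t|lborel. h t)" by (simp add: lborel_distr_plus add.commute)
  qed
  have D0: "(LINT t|lborel. D n t) = 0" for n
    by (simp add: D_def trans inth Bochner_Integration.integral_diff)
  have "(\<lambda>n. LINT t|lborel. D n t) \<longlonglongrightarrow> (LINT t|lborel. h' t)"
  proof (rule integral_dominated_convergence)
    \<comment> \<open>As the shifts \<open>s n\<close> are at most 1 and e has norm 1, every
      difference quotient is supported in the ball of radius R + 1.\<close>
    show "integrable lborel (\<lambda>t :: real ^ 'd. B * indicator (cball 0 (R + 1)) t)"
      by (intro integrable_mult_right integrable_real_indicator) (use emeasure_lborel_cball_finite[of "0 :: real ^ 'd" "R + 1"] in auto)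
    show "AE t in lborel. (\<lambda>n. D n t) \<longlonglongrightarrow> h' t"
    proof (rule AE_I2)
      fix t :: "real ^ 'd"
      have "((\<lambda>r. (h (t + r *\<^sub>R e) - h t) /\<^sub>R r) \<longlongrightarrow> h' t) (at 0)"
      proof (rule LIM_zero_cancel, rule tendsto_norm_zero_cancel, rule Lim_transform_eventually)
        show "((\<lambda>r. norm (h (t + r *\<^sub>R e) - h t - r *\<^sub>R h' t) / norm r) \<longlongrightarrow> 0) (at 0)"
          using deriv[of t] unfolding has_vector_derivative_def has_derivative_at by simp
        show "eventually (\<lambda>r. norm (h (t + r *\<^sub>R e) - h t - r *\<^sub>R h' t) / norm r
            = norm ((h (t + r *\<^sub>R e) - h t) /\<^sub>R r - h' t)) (at 0)"
        proof (rule eventually_at_filter[THEN iffD2], rule always_eventually, intro allI impI)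
          fix r :: real assume "r \<noteq> 0"
          then have "(h (t + r *\<^sub>R e) - h t) /\<^sub>R r - h' t = (h (t + r *\<^sub>R e) - h t - r *\<^sub>R h' t) /\<^sub>R r"
            by (simp add: scaleR_diff_right)
          then show "norm (h (t + r *\<^sub>R e) - h t - r *\<^sub>R h' t) / norm r
            = norm ((h (t + r *\<^sub>R e) - h t) /\<^sub>R r - h' t)"
            by (simp add: divide_inverse mult.commute)
        qed
      qed
      moreover have "filterlim s (at 0) sequentially"
        unfolding filterlim_at s_def using LIMSEQ_inverse_real_of_nat by (auto simp: field_simps inverse_eq_divide)
      ultimately show "(\<lambda>n. D n t) \<longlonglongrightarrow> h' t"
        unfolding D_def by (rule filterlim_compose)
    qed
    show "AE t in lborel. norm (D n t) \<le> B * indicator (cball 0 (R + 1)) t" for n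
    proof (rule AE_I2)
      fix t :: "real ^ 'd"
      show "norm (D n t) \<le> B * indicator (cball 0 (R + 1)) t"
      proof (cases "norm t \<le> R + 1")
        case True
        have "norm (D n t) \<le> (B * \<bar>s n\<bar>) / s n"
          unfolding D_def using lip[of t "s n"] s(1)[of n] by (simp add: divide_simps)
        then show ?thesis using True s(1)[of n] by simp
      next
        case False
        have "norm t \<le> norm (t + s n *\<^sub>R e) + norm (s n *\<^sub>R e)"
          using norm_triangle_ineq4[of "t + s n *\<^sub>R e" "s n *\<^sub>R e"] by simp
        then have "norm (t + s n *\<^sub>R e) > R" using False s[of n] e by simp
        then show ?thesis using False by (simp add: D_def supp(1))
      qed
    qed
    show "D n \<in> borel_measurable lborel" for n
      using trans(1)[of "s n *\<^sub>R e"] inth unfolding D_def by measurable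
    show "h' \<in> borel_measurable lborel" using hm' by simp
  qed
  then show ?thesis unfolding D0 by (simp add: LIMSEQ_const_iff)
qed

lemma continuous_tmon: "continuous_on UNIV (tmon \<gamma>)"
  unfolding tmon_def[abs_def] by (intro continuous_intros)

lemma continuous_cutoff: "continuous_on UNIV (cutoff n)"
  unfolding cutoff_def[abs_def] by (intro continuous_intros) auto

lemma continuous_phase: "continuous_on UNIV (phase z)"
  unfolding phase_def[abs_def] quad_def by (intro continuous_intros)

lemma cutoff_eq_0: "norm t > real (Suc n) \<Longrightarrow> cutoff n t = 0"
proof -
  assume "norm t > real (Suc n)"
  then have "(real (Suc n))\<^sup>2 \<le> (norm t)\<^sup>2" by (intro power_mono) auto
  then show ?thesis by (simp add: cutoff_def max_def divide_simps del: of_nat_Suc)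
qed

text \<open>Monomial, power of the cutoff and kernel: differentiation gives linear combinations of
  functions of the same shape, so repeated integration by parts needs no further estimates.\<close>

definition test :: "real ^ 'd::finite xy \<Rightarrow> ('d \<Rightarrow> nat) \<Rightarrow> nat \<Rightarrow> nat \<Rightarrow> real ^ 'd \<Rightarrow> real" where
  "test z \<gamma> N n t = tmon \<gamma> t * cutoff n t ^ N * exp (phase z t)"

lemma continuous_test: "continuous_on UNIV (test z \<gamma> N n)"
  unfolding test_def[abs_def]
  by (intro continuous_intros continuous_tmon continuous_cutoff continuous_phase)

lemma test_eq_0: "N > 0 \<Longrightarrow> norm t > real (Suc n) \<Longrightarrow> test z \<gamma> N n t = 0"
  by (simp add: test_def cutoff_eq_0 del: of_nat_Suc)

lemma test_integrable:
  fixes u :: "real ^ 'd::finite \<Rightarrow> complex"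
  assumes "continuous_on UNIV u" "N > 0"
  shows "integrable lborel (\<lambda>t. u t * of_real (test z \<gamma> N n t))"
  by (rule integrable_continuous_support[where R = "real (Suc n)"])
     (use assms in \<open>auto intro!: continuous_intros continuous_test simp: test_eq_0 simp del: of_nat_Suc\<close>)

lemma test_derivative:
  "((\<lambda>s. test z \<gamma> (Suc (Suc k)) n (t + s *\<^sub>R axis i 1)) has_real_derivative
     real (\<gamma> i) * test z (\<gamma>(i := \<gamma> i - 1)) (Suc (Suc k)) n t
     - 2 * real (Suc (Suc k)) / (real (Suc n))\<^sup>2 * test z (\<gamma>(i := Suc (\<gamma> i))) (Suc k) n t
     + y_vector z $ i * test z \<gamma> (Suc (Suc k)) n t
     + 2 * (\<Sum>l\<in>UNIV. x_matrix z $ i $ l * test z (\<gamma>(l := Suc (\<gamma> l))) (Suc (Suc k)) n t)) (at 0)"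
proof -
  let ?L = "2 * (\<Sum>k\<in>UNIV. x_matrix z $ i $ k * t $ k) + y_vector z $ i"
  have phase: "((\<lambda>s. exp (phase z (t + s *\<^sub>R axis i 1))) has_real_derivative exp (phase z t) * ?L) (at 0)"
    unfolding phase_shift by (auto intro!: derivative_eq_intros)
  have "2 * (\<Sum>l\<in>UNIV. x_matrix z $ i $ l * test z (\<gamma>(l := Suc (\<gamma> l))) (Suc (Suc k)) n t)
      = 2 * (\<Sum>l\<in>UNIV. x_matrix z $ i $ l * t $ l) * test z \<gamma> (Suc (Suc k)) n t"
    unfolding test_def tmon_Suc by (simp only: sum_distrib_left sum_distrib_right mult.assoc)
  moreover have "((\<lambda>s. test z \<gamma> (Suc (Suc k)) n (t + s *\<^sub>R axis i 1)) has_real_derivative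
      (real (\<gamma> i) * tmon (\<gamma>(i := \<gamma> i - 1)) t * cutoff n t ^ Suc (Suc k)
       + real (Suc (Suc k)) * cutoff n t ^ Suc k * (- (2 * t $ i) / (real (Suc n))\<^sup>2) * tmon \<gamma> t) * exp (phase z t)
       + exp (phase z t) * ?L * (tmon \<gamma> t * cutoff n t ^ Suc (Suc k))) (at 0)"
    using DERIV_mult[OF DERIV_mult[OF tmon_derivative[of \<gamma> t i] cutoff_derivative[of n t i k]] phase]
    unfolding test_def by (simp del: of_nat_Suc power_Suc)
  ultimately show ?thesis
    by (elim DERIV_cong) (simp add: test_def[of z _ _ n t] tmon_Suc algebra_simps del: of_nat_Suc power_Suc)
qed

definition pairing ::
    "real ^ 'd::finite xy \<Rightarrow> (real ^ 'd \<Rightarrow> complex) \<Rightarrow> ('d \<Rightarrow> nat) \<Rightarrow> nat \<Rightarrow> nat \<Rightarrow> complex" where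
  "pairing z u \<gamma> N n = (LINT t|lborel. u t * of_real (test z \<gamma> N n t))"

text \<open>Integration by parts: the derivative of u times the test function integrates to 0. The
  term with denominator (n+1)^2 comes from differentiating the cutoff; it is the only one whose
  power of the cutoff is lowered.\<close>

lemma pairing_partial:
  fixes u :: "real ^ 'd::finite \<Rightarrow> complex"
  assumes diff: "\<And>t. u differentiable (at t)" and cont: "continuous_on UNIV (partial i u)"
  shows "pairing z (partial i u) \<gamma> (Suc (Suc k)) n =
     - of_nat (\<gamma> i) * pairing z u (\<gamma>(i := \<gamma> i - 1)) (Suc (Suc k)) n
     + of_real (2 * real (Suc (Suc k)) / (real (Suc n))\<^sup>2) * pairing z u (\<gamma>(i := Suc (\<gamma> i))) (Suc k) n
     - of_real (y_vector z $ i) * pairing z u \<gamma> (Suc (Suc k)) n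
     - 2 * (\<Sum>l\<in>UNIV. of_real (x_matrix z $ i $ l) * pairing z u (\<gamma>(l := Suc (\<gamma> l))) (Suc (Suc k)) n)"
proof -
  let ?N = "Suc (Suc k)" and ?c = "2 * real (Suc (Suc k)) / (real (Suc n))\<^sup>2"
  let ?T = "\<lambda>\<gamma> N t. of_real (test z \<gamma> N n t) :: complex"
  have u: "continuous_on UNIV u"
    using diff by (auto simp: continuous_on_eq_continuous_at intro: differentiable_imp_continuous_within)
  define g where "g t = real (\<gamma> i) * test z (\<gamma>(i := \<gamma> i - 1)) ?N n t
     - ?c * test z (\<gamma>(i := Suc (\<gamma> i))) (Suc k) n t
     + y_vector z $ i * test z \<gamma> ?N n t
     + 2 * (\<Sum>l\<in>UNIV. x_matrix z $ i $ l * test z (\<gamma>(l := Suc (\<gamma> l))) ?N n t)" for t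
  have g: "continuous_on UNIV g" unfolding g_def by (intro continuous_intros continuous_test)
  have "(LINT t|lborel. partial i u t * ?T \<gamma> ?N t + u t * of_real (g t)) = 0"
  proof (rule integral_directional_derivative_eq_0)
    show "continuous_on UNIV (\<lambda>t. u t * ?T \<gamma> ?N t)"
      by (intro continuous_intros u continuous_test)
    show "continuous_on UNIV (\<lambda>t. partial i u t * ?T \<gamma> ?N t + u t * of_real (g t))"
      by (intro continuous_intros u cont g continuous_test)
    show "((\<lambda>s. u (t + s *\<^sub>R axis i 1) * ?T \<gamma> ?N (t + s *\<^sub>R axis i 1)) has_vector_derivative
        partial i u t * ?T \<gamma> ?N t + u t * of_real (g t)) (at 0)" for t
    proof -
      have "((\<lambda>s. test z \<gamma> ?N n (t + s *\<^sub>R axis i 1)) has_real_derivative g t) (at 0)"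
        unfolding g_def by (rule test_derivative)
      then have "((\<lambda>s. ?T \<gamma> ?N (t + s *\<^sub>R axis i 1)) has_vector_derivative of_real (g t)) (at 0)"
        by (intro has_vector_derivative_of_real) (simp add: has_real_derivative_iff_has_vector_derivative)
      from has_vector_derivative_mult[OF differentiable_partial[OF diff[of t], of i] this]
      show ?thesis by (simp add: add.commute)
    qed
    show "u t * ?T \<gamma> ?N t = 0" "partial i u t * ?T \<gamma> ?N t + u t * of_real (g t) = 0"
      if "norm t > real (Suc n)" for t
      using that by (simp_all add: g_def test_eq_0 del: of_nat_Suc)
    show "norm (axis i 1 :: real ^ 'd) = 1" by simp
  qed
  also have "(\<lambda>t. partial i u t * ?T \<gamma> ?N t + u t * of_real (g t)) =
     (\<lambda>t. partial i u t * ?T \<gamma> ?N t + (of_nat (\<gamma> i) * (u t * ?T (\<gamma>(i := \<gamma> i - 1)) ?N t)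
       - of_real ?c * (u t * ?T (\<gamma>(i := Suc (\<gamma> i))) (Suc k) t)
       + of_real (y_vector z $ i) * (u t * ?T \<gamma> ?N t)
       + 2 * (\<Sum>l\<in>UNIV. of_real (x_matrix z $ i $ l) * (u t * ?T (\<gamma>(l := Suc (\<gamma> l))) ?N t))))"
    by (rule ext) (simp add: g_def algebra_simps sum_distrib_left del: of_nat_Suc)
  finally have "pairing z (partial i u) \<gamma> ?N n + (of_nat (\<gamma> i) * pairing z u (\<gamma>(i := \<gamma> i - 1)) ?N n
       - of_real ?c * pairing z u (\<gamma>(i := Suc (\<gamma> i))) (Suc k) n
       + of_real (y_vector z $ i) * pairing z u \<gamma> ?N n
       + 2 * (\<Sum>l\<in>UNIV. of_real (x_matrix z $ i $ l) * pairing z u (\<gamma>(l := Suc (\<gamma> l))) ?N n)) = 0"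
    using test_integrable[OF u, of _ z _ n] test_integrable[OF cont, of _ z _ n]
    by (simp add: pairing_def del: of_nat_Suc of_real_divide of_real_mult)
  then show ?thesis by (simp add: algebra_simps eq_neg_iff_add_eq_0)
qed

lemma cutoff_range: "0 \<le> cutoff n t" "cutoff n t \<le> 1"
  by (simp_all add: cutoff_def)

lemma cutoff_tendsto: "(\<lambda>n. cutoff n t) \<longlonglongrightarrow> 1"
proof -
  have "(\<lambda>n. (norm t)\<^sup>2 * (inverse (real (Suc n)))\<^sup>2) \<longlonglongrightarrow> (norm t)\<^sup>2 * 0\<^sup>2"
    by (intro tendsto_intros LIMSEQ_inverse_real_of_nat)
  then have "(\<lambda>n. (norm t)\<^sup>2 / (real (Suc n))\<^sup>2) \<longlonglongrightarrow> 0"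
    by (simp add: divide_inverse power_inverse)
  then have "(\<lambda>n. max 0 (1 - (norm t)\<^sup>2 / (real (Suc n))\<^sup>2)) \<longlonglongrightarrow> max 0 (1 - 0)"
    by (intro tendsto_intros)
  then show ?thesis by (simp add: cutoff_def)
qed

lemma tame_tmon: "tame (\<lambda>t. of_real (tmon \<gamma> t))"
  unfolding tmon_def of_real_prod of_real_power by (intro tame_prod tame_power tame_coord)

text \<open>The cutoff lies between 0 and 1, so the integrand without it dominates. Exponential
  growth is required of the amplitude alone, which in the application is f and not one of its
  derivatives.\<close>

lemma pairing_tendsto_laplace:
  fixes a :: "real ^ 'd::finite \<Rightarrow> complex"
  assumes "tame a" "z \<in> xy_domain"
  shows "(\<lambda>n. pairing z a \<gamma> N n) \<longlonglongrightarrow> laplace (\<lambda>t. a t * of_real (tmon \<gamma> t)) z"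
  unfolding pairing_def laplace_def
proof (rule integral_dominated_convergence)
  let ?g = "\<lambda>t. a t * of_real (tmon \<gamma> t) * of_real (exp (phase z t)) :: complex"
  have g: "integrable lborel ?g" by (intro laplace_integrable tame_mult assms tame_tmon)
  then show "integrable lborel (\<lambda>t. norm (?g t))" by (rule integrable_norm)
  show "?g \<in> borel_measurable lborel" using g by simp
  have "test z \<gamma> N n \<in> borel_measurable borel" for n
    by (intro borel_measurable_continuous_onI continuous_test)
  then show "(\<lambda>t. a t * of_real (test z \<gamma> N n t)) \<in> borel_measurable lborel" for n
    using tame_measurable[OF assms(1)] by measurable
  show "AE t in lborel. (\<lambda>n. a t * of_real (test z \<gamma> N n t)) \<longlonglongrightarrow> ?g t"
  proof (rule AE_I2)
    fix t :: "real ^ 'd"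
    have "(\<lambda>n. a t * of_real (tmon \<gamma> t * cutoff n t ^ N * exp (phase z t)))
        \<longlonglongrightarrow> a t * of_real (tmon \<gamma> t * 1 ^ N * exp (phase z t))"
      by (intro tendsto_intros cutoff_tendsto)
    then show "(\<lambda>n. a t * of_real (test z \<gamma> N n t)) \<longlonglongrightarrow> ?g t"
      by (simp add: test_def mult.assoc)
  qed
  show "AE t in lborel. norm (a t * of_real (test z \<gamma> N n t)) \<le> norm (?g t)" for n
  proof (rule AE_I2)
    fix t :: "real ^ 'd"
    have "\<bar>cutoff n t\<bar> ^ N \<le> 1" by (rule power_le_one) (simp_all add: cutoff_range)
    then have "norm (a t) * \<bar>tmon \<gamma> t\<bar> * exp (phase z t) * \<bar>cutoff n t\<bar> ^ N
        \<le> norm (a t) * \<bar>tmon \<gamma> t\<bar> * exp (phase z t) * 1" by (intro mult_left_mono) auto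
    then show "norm (a t * of_real (test z \<gamma> N n t)) \<le> norm (?g t)"
      by (simp add: test_def norm_mult norm_power abs_mult power_abs mult_ac)
  qed
qed

section \<open>Transfer of the differential equations to the integral transform\<close>

lemma phi_monom: "phi (weyl_monom \<gamma> (\<lambda>_. 0)) = weyl_monom (\<lambda>_. 0) (case_sum (\<lambda>_. 0) \<gamma>)"
proof (induction "\<Sum>v\<in>UNIV. \<gamma> v" arbitrary: \<gamma> rule: less_induct)
  case less
  show ?case
  proof (cases "\<gamma> = (\<lambda>_. 0)")
    case True
    have "case_sum (\<lambda>_. 0) (\<lambda>_. 0) = (\<lambda>_. 0 :: nat)" by (auto simp: fun_eq_iff split: sum.split)
    then show ?thesis by (simp add: True phi_simps flip: one_weyl_def)
  next
    case False
    then obtain i where i: "\<gamma> i \<noteq> 0" by auto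
    define c where "c = \<gamma>(i := \<gamma> i - 1)"
    have \<gamma>: "\<gamma> = c(i := Suc (c i))" using i by (auto simp: c_def)
    have "(\<Sum>v\<in>UNIV. c v) < (\<Sum>v\<in>UNIV. \<gamma> v)"
      by (rule sum_strict_mono_ex1) (use i in \<open>auto simp: c_def intro!: exI[of _ i]\<close>)
    then have "phi (weyl_monom \<gamma> (\<lambda>_. 0)) = dyvar i * weyl_monom (\<lambda>_. 0) (case_sum (\<lambda>_. 0) c)"
      by (simp add: \<gamma> phi_simps phi_props(2) less flip: weyl_x_monom)
    also have "\<dots> = weyl_monom (\<lambda>_. 0) ((case_sum (\<lambda>_. 0) c)(Inr i := Suc (c i)))"
      by (simp add: weyl_d_monom)
    also have "(case_sum (\<lambda>_. 0) c)(Inr i := Suc (c i)) = case_sum (\<lambda>_. 0) \<gamma>"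
      by (auto simp: \<gamma> fun_eq_iff split: sum.split)
    finally show ?thesis .
  qed
qed

lemma weyl_act_phi_monom:
  assumes "tame f" "z \<in> xy_domain"
  shows "weyl_act (phi (weyl_monom \<gamma> (\<lambda>_. 0))) (laplace f) z = laplace (\<lambda>t. f t * of_real (tmon \<gamma> t)) z"
proof -
  have "(\<Prod>v\<in>UNIV. complex_of_real (xy_monom v t) ^ case_sum (\<lambda>_. 0) \<gamma> v) = of_real (tmon \<gamma> t)" for t
    by (subst UNIV_Plus_UNIV[symmetric])
       (simp add: prod.Plus tmon_def xy_monom_def del: UNIV_Plus_UNIV)
  then show ?thesis by (simp add: phi_monom weyl_act_monom multi_partial_laplace[OF assms])
qed

text \<open>Together with the commutator of t^\<gamma> and d_i this is the recursion of
  \<open>pairing_partial\<close> without its cutoff term.\<close>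

lemma weyl_act_phi_d:
  "weyl_act (phi (weyl_d i * P)) g z = - of_real (y_vector z $ i) * weyl_act (phi P) g z
     - 2 * (\<Sum>k\<in>UNIV. of_real (x_matrix z $ i $ k) * weyl_act (phi (weyl_x k * P)) g z)"
proof -
  have "phi (weyl_d i * P) = - (yvar i * phi P)
      - weyl_scale 2 (\<Sum>k\<in>UNIV. xvar i k * phi (weyl_x k * P))"
    using weyl_scale_of_nat[of 2 "\<Sum>k\<in>UNIV. xvar i k * phi (weyl_x k * P)"]
    by (simp add: phi_simps phi_props left_diff_distrib sum_distrib_right sum_distrib_left mult.assoc)
  then show ?thesis
    by (simp add: weyl_act_diff weyl_act_uminus weyl_act_scale weyl_act_sum weyl_act_x_mult
        x_matrix_def y_vector_def)
qed

text \<open>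
  Only \<open>f\<close> itself is assumed to grow at most exponentially. Therefore all derivatives are moved to
  the compactly supported test function before the cutoff is removed.
\<close>

lemma pairing_tendsto:
  assumes f: "smooth_on UNIV f" "tame f" and z: "z \<in> xy_domain"
  shows "N > Suc (length l) \<Longrightarrow> (\<lambda>n. pairing z (foldr partial l f) \<gamma> N n)
    \<longlonglongrightarrow> weyl_act (phi (weyl_monom \<gamma> (\<lambda>_. 0) * prod_list (map weyl_d l))) (laplace f) z"
proof (induction l arbitrary: \<gamma> N)
  case Nil
  then show ?case using pairing_tendsto_laplace[OF f(2) z] weyl_act_phi_monom[OF f(2) z] by simp
next
  case (Cons i l)
  define u where "u = foldr partial l f"
  define A where "A \<gamma> = weyl_act (phi (weyl_monom \<gamma> (\<lambda>_. 0) * prod_list (map weyl_d l))) (laplace f) z" for \<gamma>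
  have IH: "(\<lambda>n. pairing z u \<gamma> N n) \<longlonglongrightarrow> A \<gamma>" if "N > Suc (length l)" for \<gamma> N
    unfolding u_def A_def by (rule Cons.IH[OF that])
  \<comment> \<open>Each derivative spends one power of the cutoff. The bound on \<open>N\<close> is
    chosen so that even the lowered power \<open>Suc k\<close> meets the induction hypothesis for
    the shorter list.\<close>
  obtain k where N: "N = Suc (Suc k)" using Cons.prems by (cases N; cases "N - 1") auto
  have diff: "u differentiable (at t)" "partial i u differentiable (at t)" for t
    using f(1) unfolding smooth_on_def u_def by (auto dest: spec[of _ l] spec[of _ "i # l"])
  have cont: "continuous_on UNIV (partial i u)"
    using diff(2) by (auto simp: continuous_on_eq_continuous_at intro: differentiable_imp_continuous_within)
  \<comment> \<open>The coefficient of the cutoff term tends to 0 while the pairing it multiplies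
    converges, so this term disappears.\<close>
  have c0: "(\<lambda>n. complex_of_real (2 * real (Suc (Suc k)) / (real (Suc n))\<^sup>2)) \<longlonglongrightarrow> of_real 0"
  proof (intro tendsto_of_real)
    have "(\<lambda>n. 2 * real (Suc (Suc k)) * (inverse (real (Suc n)))\<^sup>2) \<longlonglongrightarrow> 2 * real (Suc (Suc k)) * 0\<^sup>2"
      by (intro tendsto_intros LIMSEQ_inverse_real_of_nat)
    then show "(\<lambda>n. 2 * real (Suc (Suc k)) / (real (Suc n))\<^sup>2) \<longlonglongrightarrow> 0"
      by (simp add: divide_inverse power_inverse)
  qed
  have "(\<lambda>n. pairing z (partial i u) \<gamma> N n) \<longlonglongrightarrow>
     - of_nat (\<gamma> i) * A (\<gamma>(i := \<gamma> i - 1)) + of_real 0 * A (\<gamma>(i := Suc (\<gamma> i)))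
     - of_real (y_vector z $ i) * A \<gamma>
     - 2 * (\<Sum>k\<in>UNIV. of_real (x_matrix z $ i $ k) * A (\<gamma>(k := Suc (\<gamma> k))))"
    unfolding N pairing_partial[OF diff(1) cont]
    by (intro tendsto_intros c0 IH) (use Cons.prems N in auto)
  also have "- of_nat (\<gamma> i) * A (\<gamma>(i := \<gamma> i - 1)) + of_real 0 * A (\<gamma>(i := Suc (\<gamma> i)))
     - of_real (y_vector z $ i) * A \<gamma>
     - 2 * (\<Sum>k\<in>UNIV. of_real (x_matrix z $ i $ k) * A (\<gamma>(k := Suc (\<gamma> k))))
     = weyl_act (phi (weyl_monom \<gamma> (\<lambda>_. 0) * prod_list (map weyl_d (i # l)))) (laplace f) z"
  proof -
    let ?D = "prod_list (map weyl_d l)"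
    \<comment> \<open>The derivation is brought to the left, where \<open>weyl_act_phi_d\<close>
      applies; the commutator accounts for the term in which the monomial is differentiated.\<close>
    have "weyl_monom \<gamma> (\<lambda>_. 0) * weyl_d i
        = weyl_d i * weyl_monom \<gamma> (\<lambda>_. 0) - weyl_scale (of_nat (\<gamma> i)) (weyl_monom (\<gamma>(i := \<gamma> i - 1)) (\<lambda>_. 0))"
      by (simp add: weyl_monom_d weyl_d_monom)
    then have "weyl_monom \<gamma> (\<lambda>_. 0) * prod_list (map weyl_d (i # l))
        = weyl_d i * (weyl_monom \<gamma> (\<lambda>_. 0) * ?D)
          - weyl_scale (of_nat (\<gamma> i)) (weyl_monom (\<gamma>(i := \<gamma> i - 1)) (\<lambda>_. 0) * ?D)"
      by (simp add: left_diff_distrib weyl_scale_times_left flip: mult.assoc)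
    then have "weyl_act (phi (weyl_monom \<gamma> (\<lambda>_. 0) * prod_list (map weyl_d (i # l)))) (laplace f) z
        = weyl_act (phi (weyl_d i * (weyl_monom \<gamma> (\<lambda>_. 0) * ?D))) (laplace f) z
          - of_nat (\<gamma> i) * A (\<gamma>(i := \<gamma> i - 1))"
      by (simp only: phi_simps(4,6) weyl_act_diff weyl_act_scale A_def)
    also have "weyl_x k * (weyl_monom \<gamma> (\<lambda>_. 0) * ?D) = weyl_monom (\<gamma>(k := Suc (\<gamma> k))) (\<lambda>_. 0) * ?D" for k
      by (simp add: weyl_x_monom flip: mult.assoc)
    then have "weyl_act (phi (weyl_d i * (weyl_monom \<gamma> (\<lambda>_. 0) * ?D))) (laplace f) z
        = - of_real (y_vector z $ i) * A \<gamma>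
          - 2 * (\<Sum>k\<in>UNIV. of_real (x_matrix z $ i $ k) * A (\<gamma>(k := Suc (\<gamma> k))))"
      by (simp only: weyl_act_phi_d A_def)
    finally have eq: "weyl_act (phi (weyl_monom \<gamma> (\<lambda>_. 0) * prod_list (map weyl_d (i # l)))) (laplace f) z
        = - of_real (y_vector z $ i) * A \<gamma>
          - 2 * (\<Sum>k\<in>UNIV. of_real (x_matrix z $ i $ k) * A (\<gamma>(k := Suc (\<gamma> k))))
          - of_nat (\<gamma> i) * A (\<gamma>(i := \<gamma> i - 1))" .
    have "- c * a + of_real 0 * b - d - e = - d - e - c * a" for a b c d e :: complex by simp
    then show ?thesis unfolding eq mult_minus_left[of "of_real (y_vector z $ i)"] .
  qed
  finally show ?case by (simp add: u_def)
qed

lemma prod_list_weyl_d: "prod_list (map weyl_d l) = weyl_monom (\<lambda>_. 0) (count_list l)"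
proof (induction l)
  case (Cons i l)
  have "count_list (i # l) = (count_list l)(i := Suc (count_list l i))" by auto
  then show ?case using Cons by (simp add: weyl_d_monom fun_upd_def del: count_list.simps)
qed (simp add: one_weyl_def)

lemma weyl_monom_split: "weyl_monom a b = weyl_monom a (\<lambda>_. 0) * weyl_monom (\<lambda>_. 0) b"
proof -
  have "{k :: 'a \<Rightarrow> nat. k \<le> (\<lambda>_. 0) \<and> k \<le> (\<lambda>_. 0)} = {\<lambda>_. 0}" by (auto simp: le_fun_def)
  then show ?thesis by (simp add: weyl_monom_mult weyl_monom_times_def)
qed

theorem annihilator_transform:
  assumes f: "smooth_on UNIV f" "tame f" and z: "z \<in> xy_domain"
    and P: "\<And>t. weyl_act P f t = 0"
  shows "weyl_act (phi P) (laplace f) z = 0"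
proof -
  \<comment> \<open>The very list that \<open>multi_partial\<close> chooses, so that iterated
    derivatives of f match in their order as well.\<close>
  define l where "l b = (SOME l. \<forall>v. count_list l v = b v)" for b :: "'a \<Rightarrow> nat"
  have count: "count_list (l b) = b" for b
    using someI_ex[OF ex_count_list[of b]] unfolding l_def by blast
  \<comment> \<open>One power of the cutoff large enough for all monomials of P: their pairings must
    share it in order to recombine into P f.\<close>
  define N where "N = Suc (Suc (\<Sum>m\<in>weyl_supp P. length (l (snd m))))"
  have N: "N > Suc (length (l (snd m)))" if "m \<in> weyl_supp P" for m
    unfolding N_def using member_le_sum[of m "weyl_supp P" "\<lambda>m. length (l (snd m))"] that by simp
  have mp: "multi_partial b f = foldr partial (l b) f" for b by (simp add: multi_partial_def l_def)
  let ?S = "\<lambda>n. \<Sum>m\<in>weyl_supp P. weyl_coeff P m * pairing z (multi_partial (snd m) f) (fst m) N n"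
  have "?S \<longlonglongrightarrow> (\<Sum>m\<in>weyl_supp P. weyl_coeff P m * weyl_act (phi (weyl_monom (fst m) (snd m))) (laplace f) z)"
  proof (intro tendsto_sum tendsto_mult tendsto_const)
    fix m assume "m \<in> weyl_supp P"
    from pairing_tendsto[OF f z N[OF this], of "fst m"]
    show "pairing z (multi_partial (snd m) f) (fst m) N \<longlonglongrightarrow> weyl_act (phi (weyl_monom (fst m) (snd m))) (laplace f) z"
      unfolding mp prod_list_weyl_d count weyl_monom_split[symmetric] .
  qed
  \<comment> \<open>Before the limit, the pairings add up to the integral of P f against the kernel
    times the cutoff, hence to 0 for every n.\<close>
  moreover have "?S n = 0" for n
  proof -
    have int: "integrable lborel (\<lambda>t. multi_partial b f t * of_real (test z a N n t))" for a b
    proof (rule test_integrable)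
      show "continuous_on UNIV (multi_partial b f)" unfolding mp
        using f(1) unfolding smooth_on_def
        by (auto simp: continuous_on_eq_continuous_at intro!: differentiable_imp_continuous_within)
    qed (simp add: N_def)
    have "?S n = (LINT t|lborel. (\<Sum>m\<in>weyl_supp P. weyl_coeff P m *
        (multi_partial (snd m) f t * of_real (test z (fst m) N n t))))"
      unfolding pairing_def
      by (subst Bochner_Integration.integral_sum) (auto intro: int)
    also have "(\<lambda>t. \<Sum>m\<in>weyl_supp P. weyl_coeff P m *
        (multi_partial (snd m) f t * of_real (test z (fst m) N n t)))
      = (\<lambda>t. weyl_act P f t * of_real (cutoff n t ^ N * exp (phase z t)))"
    proof (rule ext)
      fix t
      show "(\<Sum>m\<in>weyl_supp P. weyl_coeff P m * (multi_partial (snd m) f t * of_real (test z (fst m) N n t)))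
        = weyl_act P f t * of_real (cutoff n t ^ N * exp (phase z t))"
        unfolding weyl_act_superset[OF finite_weyl_supp subset_refl] test_def tmon_def[symmetric] sum_distrib_right
        by (rule sum.cong) simp_all
    qed
    finally show ?thesis by (simp add: P)
  qed
  ultimately have "0 = (\<Sum>m\<in>weyl_supp P. weyl_coeff P m * weyl_act (phi (weyl_monom (fst m) (snd m))) (laplace f) z)"
    by (simp add: LIMSEQ_const_iff)
  also have "\<dots> = weyl_act (phi P) (laplace f) z"
  proof -
    have "phi P = (\<Sum>m\<in>weyl_supp P. weyl_scale (weyl_coeff P m) (phi (weyl_monom (fst m) (snd m))))"
      by (rule weyl_linear_expand) (simp_all add: phi_simps)
    then show ?thesis by (simp add: weyl_act_sum weyl_act_scale)
  qed
  finally show ?thesis by simp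
qed

lemma xy_monom_Upair: "xy_monom (Inl (Upair i j)) t = (if i = j then (t $ i)\<^sup>2 else 2 * (t $ i * t $ j))"
proof -
  have "xy_monom (Inl (Upair i j)) t = (\<Sum>k\<in>UNIV. \<Sum>l\<in>UNIV.
      (if l = j then if k = i then t $ i * t $ j else 0 else 0)
      + (if l = i then if k = j \<and> i \<noteq> j then t $ i * t $ j else 0 else 0))"
    unfolding xy_monom_def sum.case by (intro sum.cong) auto
  then show ?thesis by (auto simp: sum.distrib power2_eq_square)
qed

text \<open>Both parts of the heat operator multiply the amplitude by the same polynomial, t_i^2 on
  the diagonal and 2 t_i t_j off it.\<close>

lemma heat_annihilates:
  assumes "tame f" "z \<in> xy_domain"
  shows "weyl_act (heat i j) (laplace f) z = 0"
proof -
  have d: "weyl_act (weyl_d v) (laplace f) z = laplace (\<lambda>t. f t * of_real (xy_monom v t)) z" for v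
  proof -
    have "(\<Prod>w\<in>UNIV. complex_of_real (xy_monom w t) ^ ((\<lambda>_. 0)(v := Suc 0)) w) = of_real (xy_monom v t)" for t
      using prod_power_Suc[of "\<lambda>w. complex_of_real (xy_monom w t)" "\<lambda>_. 0" v] by simp
    then show ?thesis unfolding weyl_d_alt by (simp add: weyl_act_monom multi_partial_laplace[OF assms])
  qed
  define e where "e = (\<lambda>_ :: 'a. 0 :: nat)(j := Suc 0)"
  have "tmon e t = t $ j" for t
    using tmon_Suc[of "\<lambda>_. 0" j t] by (simp add: e_def tmon_def[of "\<lambda>_. 0"])
  then have "tmon (e(i := Suc (e i))) t = t $ i * t $ j" for t by (simp only: tmon_Suc)
  moreover have "weyl_monom (e(i := Suc (e i))) (\<lambda>_. 0) = weyl_x i * weyl_x j"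
    unfolding weyl_x_alt[of j] weyl_x_monom e_def ..
  then have "dyvar i * dyvar j = phi (weyl_monom (e(i := Suc (e i))) (\<lambda>_. 0))"
    by (simp only: phi_simps phi_props(2))
  ultimately have "weyl_act (dyvar i * dyvar j) (laplace f) z = laplace (\<lambda>t. f t * of_real (t $ i * t $ j)) z"
    using weyl_act_phi_monom[OF assms, of "e(i := Suc (e i))"] by (simp only:)
  moreover have "weyl_act (2 * (dyvar i * dyvar j)) (laplace f) z = 2 * weyl_act (dyvar i * dyvar j) (laplace f) z"
    using weyl_scale_of_nat[of 2 "dyvar i * dyvar j"] by (simp add: weyl_act_scale)
  moreover have "laplace (\<lambda>t. f t * (2 * of_real (t $ i * t $ j))) z = 2 * laplace (\<lambda>t. f t * of_real (t $ i * t $ j)) z"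
    unfolding laplace_def integral_mult_right_zero[symmetric]
    by (rule Bochner_Integration.integral_cong) simp_all
  ultimately show ?thesis
    by (cases "i = j") (simp_all add: heat_def weyl_act_diff d xy_monom_Upair power2_eq_square)
qed

lemma integral_transform_eq_laplace: "integral_transform f = laplace f"
  by (simp add: fun_eq_iff integral_transform_def laplace_def phase_def quad_def)

theorem theorem2:
  fixes f :: "real ^ 'd::finite \<Rightarrow> complex" and P :: "nat \<Rightarrow> 'd weyl" and s :: nat
  assumes "smooth_on UNIV f" and "exponential_growth f"
    and "\<forall>k\<in>{1..s}. annihilates_on UNIV (P k) f"
  shows "(\<forall>k\<in>{1..s}. annihilates_on xy_domain (phi (P k)) (integral_transform f))
    \<and> (\<forall>i j. i \<noteq> j \<longrightarrow>
         annihilates_on xy_domain (dxvar i j - 2 * dyvar i * dyvar j) (integral_transform f))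
    \<and> (\<forall>i. annihilates_on xy_domain (dxvar i i - dyvar i ^ 2) (integral_transform f))
    \<and> (holonomic_ideal (left_ideal_gen (P ` {1..s})) \<longrightarrow>
       holonomic_ideal (left_ideal_gen
         ((\<lambda>k. phi (P k)) ` {1..s}
          \<union> {dxvar i j - 2 * dyvar i * dyvar j | i j. i \<noteq> j}
          \<union> {dxvar i i - dyvar i ^ 2 | i. True})))"
proof -
  \<comment> \<open>The empty list of derivatives in \<open>smooth_on\<close> gives continuity of f,
    which supplies the measurability in \<open>tame\<close>.\<close>
  have "continuous_on UNIV f"
    using assms(1) unfolding smooth_on_def
    by (auto simp: continuous_on_eq_continuous_at dest: spec[of _ "[]"] intro!: differentiable_imp_continuous_within)
  then have f: "tame f" using assms(2) by (simp add: tame_def borel_measurable_continuous_onI)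
  have heat: "heat i j = dxvar i j - 2 * dyvar i * dyvar j" if "i \<noteq> j" for i j :: 'd
    using that by (simp add: heat_def mult.assoc)
  have heat': "heat i i = dxvar i i - dyvar i ^ 2" for i :: 'd
    by (simp add: heat_def power2_eq_square)
  let ?J = "left_ideal_gen ((\<lambda>k. phi (P k)) ` {1..s}
          \<union> {dxvar i j - 2 * dyvar i * dyvar j | i j. i \<noteq> j}
          \<union> {dxvar i i - dyvar i ^ 2 | i. True})"
  have annih: "annihilates_on xy_domain Q (integral_transform f)"
    if "\<And>z. z \<in> xy_domain \<Longrightarrow> weyl_act Q (laplace f) z = 0" for Q
    using that smooth_on_laplace[OF f] by (simp add: annihilates_on_def integral_transform_eq_laplace)
  have an_heat: "annihilates_on xy_domain (heat i j) (integral_transform f)" for i j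
    by (intro annih heat_annihilates f)
  have "annihilates_on xy_domain (phi (P k)) (integral_transform f)" if "k \<in> {1..s}" for k
    using assms(3) that by (intro annih annihilator_transform assms(1) f) (auto simp: annihilates_on_def)
  moreover have "annihilates_on xy_domain (dxvar i j - 2 * dyvar i * dyvar j) (integral_transform f)" if "i \<noteq> j" for i j
    using an_heat[of i j] by (simp only: heat[OF that])
  moreover have "annihilates_on xy_domain (dxvar i i - dyvar i ^ 2) (integral_transform f)" for i
    using an_heat[of i i] by (simp only: heat')
  moreover have "holonomic_ideal ?J" if "holonomic_ideal (left_ideal_gen (P ` {1..s}))"
  proof (rule holonomic_transform[OF left_ideal_gen(1) left_ideal_gen(1) _ _ that])
    show "phi Q \<in> ?J" if "Q \<in> left_ideal_gen (P ` {1..s})" for Q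
      by (rule phi_left_ideal_gen[OF left_ideal_gen(1) _ that]) (use left_ideal_gen(2) in fast)
    show "heat i j \<in> ?J" for i j
      by (rule subsetD[OF left_ideal_gen(2)]) (cases "i = j", auto simp: heat heat')
  qed
  ultimately show ?thesis by blast
qed

end
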